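(* With the objects defined in the context, let $C_N=(\varphi_k(x_j))_{1\le k\le N,\,1\le j\le M}\in\mathbb{R}^{N\times M}$, assume $\mathrm{rank}(C_N)=N$, let $\sigma_{\min}(C_N)>0$ be its smallest singular value, and choose $U_N$ according to the minimum-norm cancellation rule, so that $\|U_N\|_{\mathcal L(X_N,\mathbb{R}^M)}\le C/\sigma_{\min}(C_N)$ with a constant $C>0$ not depending on the points $x_j$. Then $$\|T_N\|_{\mathcal L(X_N)}\le L_N\,\|B\|_{\mathcal L(\mathbb{R}^M,\mathcal X)}\,\|U_N\|_{\mathcal L(X_N,\mathbb{R}^M)}\le C\,L_N\,\|B\|_{\mathcal L(\mathbb{R}^M,\mathcal X)}\,\frac{1}{\sigma_{\min}(C_N)} .$$ In particular, if $\sigma_{\min}(C_N)>C\,L_N\,\|B\|_{\mathcal L(\mathbb{R}^M,\mathcal X)}$, then for every $y_r\in X_N$ the equation $(I+T_N)y^\star=y_r$ is solvable in $X_N$.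
   Context: $\Omega\subset\mathbb{R}^3$ is a bounded connected $C^2$ domain, $\kappa_m>0$, $H=L^2(\Omega)$; $A_0=\kappa_m\Delta$ with homogeneous Neumann boundary condition, $D(A_0)=\{y\in H^2(\Omega):\partial_\nu y=0\}$; $\mathcal A=I-A_0$, $D(\mathcal A)=D(A_0)$; $\mathcal X=D(\mathcal A)'$ with norm $\|\eta\|_{\mathcal X}=\|\mathcal A^{-1}\eta\|_H$. $\{\varphi_k\}_{k\ge1}$ is an $L^2$-orthonormal basis of Neumann eigenfunctions of $-\Delta$ with eigenvalues $0=\lambda_1\le\lambda_2\le\cdots$; $X_N=\mathrm{span}\{\varphi_1,\dots,\varphi_N\}$, with the norm inherited from $\mathcal X$; $P_N$ is the spectral projector onto $X_N$ ($H$-orthogonal, extended to $\mathcal X$ by $P_N\eta=\sum_{k\le N}\langle\eta,\varphi_k\rangle\varphi_k$) and $Q_N=I-P_N$. For points $x_1,\dots,x_M\in\Omega$, $B:\mathbb{R}^M\to\mathcal X$, $Bu=\sum_ju_j\delta_{x_j}$. The closed-loop generator is $A_{\mathrm{cl}}z=A_0z-\lambda\sum_{j=1}^M(\mathcal A^{-1}z)(x_j)\delta_{x_j}$ with $\lambda>0$ such that $S_{\mathrm{cl}}(t)=e^{tA_{\mathrm{cl}}}$ is exponentially stable on $(H^1(\Omega))'$ and extends to an exponentially stable semigroup on $\mathcal X$; $R_{\mathrm{cl}}:=\int_0^\infty S_{\mathrm{cl}}(t)\,dt$; $L_N:=\|P_NR_{\mathrm{cl}}Q_N\|_{\mathcal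 L(\mathcal X)}$; $T_N:=P_NR_{\mathrm{cl}}Q_NBU_N:X_N\to X_N$. The minimum-norm cancellation rule: $U_Ny\in\mathbb{R}^M$ is the minimum-Euclidean-norm vector $u$ with $P_N(A_0y+Bu)=0$, i.e. $\sum_ju_j\varphi_k(x_j)=-\langle A_0y,\varphi_k\rangle_H$ for $k=1,\dots,N$. *)

theory Defs
  imports
    "HOL-Analysis.Analysis"
    "HOL-Library.Function_Algebras"
    "Jordan_Normal_Form.Char_Poly"
    "Jordan_Normal_Form.DL_Rank"
begin

(* both imports claim the infixes $ and \<bullet>; keep the vec_index and inner readings *)
unbundle no vec_syntax
no_notation scalar_prod (infix "\<bullet>" 70)

definition sq_integrable :: "(real^3 \<Rightarrow> real) \<Rightarrow> bool" where
  "sq_integrable f \<longleftrightarrow> f \<in> borel_measurable lborel \<and> integrable lborel (\<lambda>x. (f x)\<^sup>2)"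

lemma sq_integrable_mult:
  assumes "sq_integrable f" "sq_integrable g"
  shows "integrable lborel (\<lambda>x. f x * g x)"
proof (rule Bochner_Integration.integrable_bound)
  show "integrable lborel (\<lambda>x. (f x)\<^sup>2 + (g x)\<^sup>2)"
    using assms by (simp add: sq_integrable_def)
  show "(\<lambda>x. f x * g x) \<in> borel_measurable lborel"
    using assms by (auto simp: sq_integrable_def intro!: borel_measurable_times)
  have "\<bar>a * b\<bar> \<le> a\<^sup>2 + b\<^sup>2" for a b :: real
  proof -
    have "2 * (\<bar>a\<bar> * \<bar>b\<bar>) \<le> a\<^sup>2 + b\<^sup>2"
      using sum_squares_bound[of "\<bar>a\<bar>" "\<bar>b\<bar>"] by simp
    moreover have "0 \<le> \<bar>a\<bar> * \<bar>b\<bar>"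
      by simp
    ultimately show ?thesis
      unfolding abs_mult by linarith
  qed
  then show "AE x in lborel. norm (f x * g x) \<le> norm ((f x)\<^sup>2 + (g x)\<^sup>2)"
    by simp
qed

lemma sq_integrable_0: "sq_integrable (\<lambda>x. 0)"
  by (simp add: sq_integrable_def)

lemma sq_integrable_scale: "sq_integrable f \<Longrightarrow> sq_integrable (\<lambda>x. c * f x)"
  by (auto simp: sq_integrable_def power_mult_distrib intro!: borel_measurable_times)

lemma sq_integrable_add:
  assumes "sq_integrable f" "sq_integrable g"
  shows "sq_integrable (\<lambda>x. f x + g x)"
  using assms sq_integrable_mult[OF assms]
  by (auto simp: sq_integrable_def power2_sum mult.assoc intro!: borel_measurable_add)

definition l2_rel :: "(real^3 \<Rightarrow> real) \<Rightarrow> (real^3 \<Rightarrow> real) \<Rightarrow> bool" where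
  "l2_rel f g \<longleftrightarrow> sq_integrable f \<and> sq_integrable g \<and> (AE x in lborel. f x = g x)"

quotient_type l2 = "real^3 \<Rightarrow> real" / partial: l2_rel
proof (rule part_equivpI)
  show "\<exists>f. l2_rel f f"
    using sq_integrable_0 by (auto simp: l2_rel_def)
  show "symp l2_rel"
    by (auto simp: symp_def l2_rel_def eq_commute)
  show "transp l2_rel"
    unfolding transp_def l2_rel_def by (auto elim: AE_mp)
qed

instantiation l2 :: real_inner
begin

lift_definition zero_l2 :: l2 is "\<lambda>x. 0"
  by (simp add: l2_rel_def sq_integrable_0)

lift_definition plus_l2 :: "l2 \<Rightarrow> l2 \<Rightarrow> l2" is "\<lambda>f g x. f x + g x"
  by (auto simp: l2_rel_def intro: sq_integrable_add)

lift_definition scaleR_l2 :: "real \<Rightarrow> l2 \<Rightarrow> l2" is "\<lambda>c f x. c * f x"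
  by (auto simp: l2_rel_def intro: sq_integrable_scale)

lift_definition inner_l2 :: "l2 \<Rightarrow> l2 \<Rightarrow> real" is "\<lambda>f g. LINT x|lborel. f x * g x"
  by (rule integral_cong_AE) (auto simp: l2_rel_def sq_integrable_def)

definition uminus_l2 :: "l2 \<Rightarrow> l2" where
  "uminus_l2 f = scaleR (-1) f"

definition minus_l2 :: "l2 \<Rightarrow> l2 \<Rightarrow> l2" where
  "minus_l2 f g = f + - g"

definition norm_l2 :: "l2 \<Rightarrow> real" where
  "norm_l2 f = sqrt (inner f f)"

definition sgn_l2 :: "l2 \<Rightarrow> l2" where
  "sgn_l2 f = scaleR (inverse (norm f)) f"

definition dist_l2 :: "l2 \<Rightarrow> l2 \<Rightarrow> real" where
  "dist_l2 f g = norm (f - g)"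

definition uniformity_l2 :: "(l2 \<times> l2) filter" where
  "uniformity_l2 = (INF e\<in>{0<..}. principal {(f, g). dist f g < e})"

definition open_l2 :: "l2 set \<Rightarrow> bool" where
  "open_l2 U \<longleftrightarrow> (\<forall>f\<in>U. \<forall>\<^sub>F (f', g) in uniformity. f' = f \<longrightarrow> g \<in> U)"

instance
proof
  fix f g h :: l2 and a b :: real and U :: "l2 set"
  show "f + g + h = f + (g + h)"
    by transfer (auto simp: l2_rel_def add.assoc intro!: sq_integrable_add)
  show "f + g = g + f"
    by transfer (auto simp: l2_rel_def add.commute intro!: sq_integrable_add)
  show "0 + f = f"
    by transfer (auto simp: l2_rel_def)
  show "- f + f = 0"
    unfolding uminus_l2_def
    by transfer (auto simp: l2_rel_def intro!: sq_integrable_0 sq_integrable_add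
        sq_integrable_scale[where c = "-1", simplified])
  show "f - g = f + - g"
    by (rule minus_l2_def)
  show "scaleR a (f + g) = scaleR a f + scaleR a g"
    by transfer (auto simp: l2_rel_def distrib_left intro!: sq_integrable_add sq_integrable_scale)
  show "scaleR (a + b) f = scaleR a f + scaleR b f"
    by transfer (auto simp: l2_rel_def distrib_right intro!: sq_integrable_add sq_integrable_scale)
  show "scaleR a (scaleR b f) = scaleR (a * b) f"
    by transfer (auto simp: l2_rel_def mult.assoc intro!: sq_integrable_scale)
  show "scaleR 1 f = f"
    by transfer (auto simp: l2_rel_def)
  show "dist f g = norm (f - g)"
    by (rule dist_l2_def)
  show "sgn f = scaleR (inverse (norm f)) f"
    by (rule sgn_l2_def)
  show "(uniformity :: (l2 \<times> l2) filter) = (INF e\<in>{0<..}. principal {(f, g). dist f g < e})"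
    by (rule uniformity_l2_def)
  show "open U \<longleftrightarrow> (\<forall>f\<in>U. \<forall>\<^sub>F (f', g) in uniformity. f' = f \<longrightarrow> g \<in> U)"
    by (rule open_l2_def)
  show "inner f g = inner g f"
    by transfer (simp add: mult.commute)
  show "inner (f + g) h = inner f h + inner g h"
    by transfer (simp add: l2_rel_def distrib_right sq_integrable_mult)
  show "inner (scaleR a f) g = a * inner f g"
    by transfer (simp add: mult.assoc)
  show "0 \<le> inner f f"
    by transfer simp
  show "inner f f = 0 \<longleftrightarrow> f = 0"
  proof transfer
    fix f assume "l2_rel f f"
    then have "sq_integrable f"
      by (simp add: l2_rel_def)
    moreover from this have "(LINT x|lborel. f x * f x) = 0 \<longleftrightarrow> (AE x in lborel. f x * f x = 0)"
      by (intro integral_nonneg_eq_0_iff_AE) (auto simp: sq_integrable_def power2_eq_square)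
    ultimately show "((LINT x|lborel. f x * f x) = 0) = l2_rel f (\<lambda>x. 0)"
      by (simp add: l2_rel_def sq_integrable_0)
  qed
  show "norm f = sqrt (inner f f)"
    by (rule norm_l2_def)
qed

end

text \<open>\<open>L\<^sup>2(\<Omega>)\<close> is identified, by extension by zero, with a closed subspace of \<open>L\<^sup>2\<close> of the
  whole space; \<^const>\<open>rep_l2\<close> picks a representative of the class.\<close>

definition L2 :: "(real^3) set \<Rightarrow> l2 set" where
  "L2 \<Omega> = {f. AE x in lborel. x \<notin> \<Omega> \<longrightarrow> rep_l2 f x = 0}"

text \<open>The value at \<open>x\<close> of the representative of \<open>f\<close> that is continuous on \<open>\<Omega>\<close>.  In dimension
  three it exists for every \<open>f\<close> in \<open>H\<^sup>2(\<Omega>)\<close>.\<close>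

definition pt_value :: "(real^3) set \<Rightarrow> l2 \<Rightarrow> real^3 \<Rightarrow> real" where
  "pt_value \<Omega> f x = (THE c. \<exists>g. continuous_on \<Omega> g \<and>
     (AE z in lborel. z \<in> \<Omega> \<longrightarrow> rep_l2 f z = g z) \<and> c = g x)"


primrec Ck_on :: "nat \<Rightarrow> (real^3) set \<Rightarrow> (real^3 \<Rightarrow> real) \<Rightarrow> bool" where
  "Ck_on 0 S f \<longleftrightarrow> continuous_on S f"
| "Ck_on (Suc k) S f \<longleftrightarrow> (\<forall>x\<in>S. f differentiable (at x)) \<and>
     (\<forall>b\<in>Basis. Ck_on k S (\<lambda>x. frechet_derivative f (at x) b))"

text \<open>The boundary is locally the zero set of a \<open>C\<^sup>2\<close> function with nonvanishing gradient, and
  the domain lies locally on one side of it.\<close>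

definition bounded_C2_domain :: "(real^3) set \<Rightarrow> bool" where
  "bounded_C2_domain \<Omega> \<longleftrightarrow> open \<Omega> \<and> bounded \<Omega> \<and> connected \<Omega> \<and> \<Omega> \<noteq> {} \<and>
     (\<forall>p\<in>frontier \<Omega>. \<exists>r>0. \<exists>\<psi>. Ck_on 2 (ball p r) \<psi> \<and>
        (\<forall>q\<in>ball p r. \<exists>b\<in>Basis. frechet_derivative \<psi> (at q) b \<noteq> 0) \<and>
        \<Omega> \<inter> ball p r = {q\<in>ball p r. \<psi> q < 0})"

definition test_function :: "(real^3) set \<Rightarrow> (real^3 \<Rightarrow> real) \<Rightarrow> bool" where
  "test_function \<Omega> \<psi> \<longleftrightarrow> (\<forall>k. Ck_on k UNIV \<psi>) \<and>
     compact (closure {x. \<psi> x \<noteq> 0}) \<and> closure {x. \<psi> x \<noteq> 0} \<subseteq> \<Omega>"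

definition weak_partial :: "(real^3) set \<Rightarrow> real^3 \<Rightarrow> l2 \<Rightarrow> l2 \<Rightarrow> bool" where
  "weak_partial \<Omega> b f g \<longleftrightarrow> f \<in> L2 \<Omega> \<and> g \<in> L2 \<Omega> \<and>
     (\<forall>\<psi>. test_function \<Omega> \<psi> \<longrightarrow>
        (LINT x|lborel. rep_l2 f x * frechet_derivative \<psi> (at x) b) =
        - (LINT x|lborel. rep_l2 g x * \<psi> x))"

definition wderiv :: "(real^3) set \<Rightarrow> real^3 \<Rightarrow> l2 \<Rightarrow> l2" where
  "wderiv \<Omega> b f = (THE g. weak_partial \<Omega> b f g)"

definition H1 :: "(real^3) set \<Rightarrow> l2 set" where
  "H1 \<Omega> = {f \<in> L2 \<Omega>. \<forall>b\<in>Basis. \<exists>g. weak_partial \<Omega> b f g}"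

definition H2 :: "(real^3) set \<Rightarrow> l2 set" where
  "H2 \<Omega> = {f \<in> H1 \<Omega>. \<forall>b\<in>Basis. wderiv \<Omega> b f \<in> H1 \<Omega>}"

definition H1_norm :: "(real^3) set \<Rightarrow> l2 \<Rightarrow> real" where
  "H1_norm \<Omega> f = sqrt ((norm f)\<^sup>2 + (\<Sum>b\<in>Basis. (norm (wderiv \<Omega> b f))\<^sup>2))"

definition laplacian :: "(real^3) set \<Rightarrow> l2 \<Rightarrow> l2" where
  "laplacian \<Omega> f = (\<Sum>b\<in>Basis. wderiv \<Omega> b (wderiv \<Omega> b f))"

text \<open>The normal derivative \<open>\<partial>\<^sub>\<nu> y\<close> in the trace space \<open>H\<^bsup>-1/2\<^esup>(\<partial>\<Omega>)\<close>, as usual defined through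
  Green's formula: its pairing with the trace of \<open>v\<close> is \<open>\<integral>\<^sub>\<Omega> (\<Delta>y) v + \<integral>\<^sub>\<Omega> \<nabla>y \<cdot> \<nabla>v\<close>.  As every
  element of \<open>H\<^bsup>1/2\<^esup>(\<partial>\<Omega>)\<close> is a trace, \<open>\<partial>\<^sub>\<nu> y = 0\<close> means that all these pairings vanish.\<close>

definition normal_derivative :: "(real^3) set \<Rightarrow> l2 \<Rightarrow> l2 \<Rightarrow> real" where
  "normal_derivative \<Omega> y v =
     inner (laplacian \<Omega> y) v + (\<Sum>b\<in>Basis. inner (wderiv \<Omega> b y) (wderiv \<Omega> b v))"


definition dom_A0 :: "(real^3) set \<Rightarrow> l2 set" where
  "dom_A0 \<Omega> = {y \<in> H2 \<Omega>. \<forall>v\<in>H1 \<Omega>. normal_derivative \<Omega> y v = 0}"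

definition A0 :: "real \<Rightarrow> (real^3) set \<Rightarrow> l2 \<Rightarrow> l2" where
  "A0 \<kappa> \<Omega> y = \<kappa> *\<^sub>R laplacian \<Omega> y"

definition calA :: "real \<Rightarrow> (real^3) set \<Rightarrow> l2 \<Rightarrow> l2" where
  "calA \<kappa> \<Omega> y = y - A0 \<kappa> \<Omega> y"

instantiation "fun" :: (type, real_vector) real_vector
begin

definition scaleR_fun :: "real \<Rightarrow> ('a \<Rightarrow> 'b) \<Rightarrow> 'a \<Rightarrow> 'b" where
  "scaleR_fun c f = (\<lambda>x. c *\<^sub>R f x)"

instance
  by standard (auto simp: scaleR_fun_def fun_eq_iff scaleR_add_right scaleR_add_left)

end

text \<open>Elements of \<open>\<X>\<close> are the functionals on \<open>D(\<A>)\<close> that are bounded for the norm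
  \<open>\<parallel>\<A>y\<parallel>\<close>; they are extended by zero outside \<open>D(\<A>)\<close>, so that equality
  of functions is equality in \<open>\<X>\<close>.\<close>

definition X_space :: "real \<Rightarrow> (real^3) set \<Rightarrow> (l2 \<Rightarrow> real) set" where
  "X_space \<kappa> \<Omega> = {\<eta>. (\<forall>y. y \<notin> dom_A0 \<Omega> \<longrightarrow> \<eta> y = 0) \<and>
     (\<forall>y\<in>dom_A0 \<Omega>. \<forall>z\<in>dom_A0 \<Omega>. \<forall>a b. \<eta> (a *\<^sub>R y + b *\<^sub>R z) = a * \<eta> y + b * \<eta> z) \<and>
     (\<exists>K. \<forall>y\<in>dom_A0 \<Omega>. \<bar>\<eta> y\<bar> \<le> K * norm (calA \<kappa> \<Omega> y))}"

text \<open>\<open>\<A>\<^sup>-\<^sup>1 : \<X> \<rightarrow> H\<close> by duality, \<open>\<A>\<close> being selfadjoint: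
  \<open>(\<A>\<^sup>-\<^sup>1\<eta>, \<A>y) = \<langle>\<eta>, y\<rangle>\<close> for all \<open>y\<close> in \<open>D(\<A>)\<close>.\<close>

definition calA_inv :: "real \<Rightarrow> (real^3) set \<Rightarrow> (l2 \<Rightarrow> real) \<Rightarrow> l2" where
  "calA_inv \<kappa> \<Omega> \<eta> = (THE f. f \<in> L2 \<Omega> \<and> (\<forall>y\<in>dom_A0 \<Omega>. inner f (calA \<kappa> \<Omega> y) = \<eta> y))"

definition X_norm :: "real \<Rightarrow> (real^3) set \<Rightarrow> (l2 \<Rightarrow> real) \<Rightarrow> real" where
  "X_norm \<kappa> \<Omega> \<eta> = norm (calA_inv \<kappa> \<Omega> \<eta>)"

definition embed :: "(real^3) set \<Rightarrow> l2 \<Rightarrow> l2 \<Rightarrow> real" where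
  "embed \<Omega> f = (\<lambda>y. if y \<in> dom_A0 \<Omega> then inner f y else 0)"

definition delta :: "(real^3) set \<Rightarrow> real^3 \<Rightarrow> l2 \<Rightarrow> real" where
  "delta \<Omega> x = (\<lambda>y. if y \<in> dom_A0 \<Omega> then pt_value \<Omega> y x else 0)"

text \<open>\<open>(H\<^sup>1(\<Omega>))'\<close> as a subspace of \<open>\<X>\<close>: since \<open>D(\<A>)\<close> is dense in \<open>H\<^sup>1(\<Omega>)\<close>, an element of the
  dual is determined by its restriction to \<open>D(\<A>)\<close>, and so is its dual norm.\<close>

definition H1_dual :: "real \<Rightarrow> (real^3) set \<Rightarrow> (l2 \<Rightarrow> real) set" where
  "H1_dual \<kappa> \<Omega> = {\<eta> \<in> X_space \<kappa> \<Omega>. \<exists>K. \<forall>y\<in>dom_A0 \<Omega>. \<bar>\<eta> y\<bar> \<le> K * H1_norm \<Omega> y}"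

definition H1_dual_norm :: "(real^3) set \<Rightarrow> (l2 \<Rightarrow> real) \<Rightarrow> real" where
  "H1_dual_norm \<Omega> \<eta> = Sup {\<bar>\<eta> y\<bar> | y. y \<in> dom_A0 \<Omega> \<and> H1_norm \<Omega> y \<le> 1}"

definition A0_ext :: "real \<Rightarrow> (real^3) set \<Rightarrow> l2 \<Rightarrow> l2 \<Rightarrow> real" where
  "A0_ext \<kappa> \<Omega> z = (\<lambda>y. if y \<in> dom_A0 \<Omega> then inner z (A0 \<kappa> \<Omega> y) else 0)"


definition op_norm :: "'v set \<Rightarrow> ('v \<Rightarrow> real) \<Rightarrow> ('w \<Rightarrow> real) \<Rightarrow> ('v \<Rightarrow> 'w) \<Rightarrow> real" where
  "op_norm V n m T = Sup {m (T v) | v. v \<in> V \<and> n v \<le> 1}"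

definition C0_semigroup_on ::
  "'v::real_vector set \<Rightarrow> ('v \<Rightarrow> real) \<Rightarrow> (real \<Rightarrow> 'v \<Rightarrow> 'v) \<Rightarrow> bool" where
  "C0_semigroup_on V n S \<longleftrightarrow>
     (\<forall>t\<ge>0. \<forall>v\<in>V. S t v \<in> V) \<and>
     (\<forall>t\<ge>0. \<forall>v\<in>V. \<forall>w\<in>V. \<forall>a b. S t (a *\<^sub>R v + b *\<^sub>R w) = a *\<^sub>R S t v + b *\<^sub>R S t w) \<and>
     (\<forall>t\<ge>0. \<exists>K. \<forall>v\<in>V. n (S t v) \<le> K * n v) \<and>
     (\<forall>v\<in>V. S 0 v = v) \<and>
     (\<forall>s\<ge>0. \<forall>t\<ge>0. \<forall>v\<in>V. S (s + t) v = S s (S t v)) \<and>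
     (\<forall>v\<in>V. ((\<lambda>t. n (S t v - v)) \<longlongrightarrow> 0) (at_right 0))"

definition exp_stable_on :: "'v set \<Rightarrow> ('v \<Rightarrow> real) \<Rightarrow> (real \<Rightarrow> 'v \<Rightarrow> 'v) \<Rightarrow> bool" where
  "exp_stable_on V n S \<longleftrightarrow>
     (\<exists>K \<omega>. \<omega> > 0 \<and> (\<forall>t\<ge>0. \<forall>v\<in>V. n (S t v) \<le> K * exp (- \<omega> * t) * n v))"

definition generator_graph ::
  "'v::real_vector set \<Rightarrow> ('v \<Rightarrow> real) \<Rightarrow> (real \<Rightarrow> 'v \<Rightarrow> 'v) \<Rightarrow> ('v \<times> 'v) set" where
  "generator_graph V n S = {(v, w). v \<in> V \<and> w \<in> V \<and>
     ((\<lambda>h. n ((1 / h) *\<^sub>R (S h v - v) - w)) \<longlongrightarrow> 0) (at_right 0)}"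

text \<open>The definition of \<^const>\<open>has_integral\<close> with the type class norm replaced by \<open>n\<close>.\<close>

definition has_integral_on ::
  "'v::real_vector set \<Rightarrow> ('v \<Rightarrow> real) \<Rightarrow> (real \<Rightarrow> 'v) \<Rightarrow> 'v \<Rightarrow> real set \<Rightarrow> bool" where
  "has_integral_on V n f I J \<longleftrightarrow> I \<in> V \<and>
     (\<forall>e>0. \<exists>\<gamma>. gauge \<gamma> \<and>
        (\<forall>p. p tagged_division_of J \<and> \<gamma> fine p \<longrightarrow>
           n ((\<Sum>(x, K)\<in>p. measure lborel K *\<^sub>R f x) - I) < e))"

definition improper_integral_on ::
  "'v::real_vector set \<Rightarrow> ('v \<Rightarrow> real) \<Rightarrow> (real \<Rightarrow> 'v) \<Rightarrow> 'v" where
  "improper_integral_on V n f = (THE I. I \<in> V \<and>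
     (\<exists>F. (\<forall>T\<ge>0. has_integral_on V n f (F T) {0..T}) \<and>
          ((\<lambda>T. n (F T - I)) \<longlongrightarrow> 0) at_top))"


text \<open>Indices start at 0: \<open>\<phi> k\<close> and \<open>\<mu> k\<close> are the eigenfunction and eigenvalue number \<open>k + 1\<close>.\<close>

definition neumann_eigenbasis :: "(real^3) set \<Rightarrow> (nat \<Rightarrow> l2) \<Rightarrow> (nat \<Rightarrow> real) \<Rightarrow> bool" where
  "neumann_eigenbasis \<Omega> \<phi> \<mu> \<longleftrightarrow>
     (\<forall>k. \<phi> k \<in> dom_A0 \<Omega> \<and> - laplacian \<Omega> (\<phi> k) = \<mu> k *\<^sub>R \<phi> k) \<and>
     (\<forall>i j. inner (\<phi> i) (\<phi> j) = (if i = j then 1 else 0)) \<and>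
     closure (span (range \<phi>)) = L2 \<Omega> \<and>
     \<mu> 0 = 0 \<and> mono \<mu>"

definition XN :: "(nat \<Rightarrow> l2) \<Rightarrow> nat \<Rightarrow> l2 set" where
  "XN \<phi> N = span (\<phi> ` {..<N})"

definition XN_norm :: "real \<Rightarrow> (real^3) set \<Rightarrow> l2 \<Rightarrow> real" where
  "XN_norm \<kappa> \<Omega> y = X_norm \<kappa> \<Omega> (embed \<Omega> y)"

definition PN :: "(nat \<Rightarrow> l2) \<Rightarrow> nat \<Rightarrow> (l2 \<Rightarrow> real) \<Rightarrow> l2" where
  "PN \<phi> N \<eta> = (\<Sum>k<N. \<eta> (\<phi> k) *\<^sub>R \<phi> k)"

definition QN :: "(real^3) set \<Rightarrow> (nat \<Rightarrow> l2) \<Rightarrow> nat \<Rightarrow> (l2 \<Rightarrow> real) \<Rightarrow> l2 \<Rightarrow> real" where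
  "QN \<Omega> \<phi> N \<eta> = \<eta> - embed \<Omega> (PN \<phi> N \<eta>)"

definition euclid_norm :: "real Matrix.vec \<Rightarrow> real" where
  "euclid_norm u = sqrt (scalar_prod u u)"

definition B_op :: "(real^3) set \<Rightarrow> nat \<Rightarrow> (nat \<Rightarrow> real^3) \<Rightarrow> real Matrix.vec \<Rightarrow> l2 \<Rightarrow> real" where
  "B_op \<Omega> M x u = (\<Sum>j<M. vec_index u j *\<^sub>R delta \<Omega> (x j))"

definition A_cl ::
  "real \<Rightarrow> (real^3) set \<Rightarrow> nat \<Rightarrow> (nat \<Rightarrow> real^3) \<Rightarrow> real \<Rightarrow> l2 \<Rightarrow> l2 \<Rightarrow> real" where
  "A_cl \<kappa> \<Omega> M x lam z = A0_ext \<kappa> \<Omega> z -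
     lam *\<^sub>R (\<Sum>j<M. pt_value \<Omega> (calA_inv \<kappa> \<Omega> (embed \<Omega> z)) (x j) *\<^sub>R delta \<Omega> (x j))"

text \<open>\<open>S\<close> is the closed-loop semigroup on \<open>\<X>\<close>.  The domain of its generator \<open>A\<^sub>c\<^sub>l\<close> there is
  \<open>H\<close>, the space on which the feedback \<open>(\<A>\<^sup>-\<^sup>1z)(x\<^sub>j)\<close> is defined because
  \<open>\<A>\<^sup>-\<^sup>1 H = D(\<A>)\<close> consists of continuous functions.  On the invariant subspace \<open>(H\<^sup>1(\<Omega>))'\<close> it is
  the semigroup generated by the part of \<open>A\<^sub>c\<^sub>l\<close> in that space.\<close>

definition closed_loop_semigroup ::
  "real \<Rightarrow> (real^3) set \<Rightarrow> nat \<Rightarrow> (nat \<Rightarrow> real^3) \<Rightarrow> real \<Rightarrow>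
   (real \<Rightarrow> (l2 \<Rightarrow> real) \<Rightarrow> (l2 \<Rightarrow> real)) \<Rightarrow> bool" where
  "closed_loop_semigroup \<kappa> \<Omega> M x lam S \<longleftrightarrow>
     C0_semigroup_on (X_space \<kappa> \<Omega>) (X_norm \<kappa> \<Omega>) S \<and>
     generator_graph (X_space \<kappa> \<Omega>) (X_norm \<kappa> \<Omega>) S =
       {(embed \<Omega> z, A_cl \<kappa> \<Omega> M x lam z) | z. z \<in> L2 \<Omega>} \<and>
     exp_stable_on (X_space \<kappa> \<Omega>) (X_norm \<kappa> \<Omega>) S \<and>
     C0_semigroup_on (H1_dual \<kappa> \<Omega>) (H1_dual_norm \<Omega>) S \<and>
     exp_stable_on (H1_dual \<kappa> \<Omega>) (H1_dual_norm \<Omega>) S"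

definition R_cl ::
  "real \<Rightarrow> (real^3) set \<Rightarrow> (real \<Rightarrow> (l2 \<Rightarrow> real) \<Rightarrow> (l2 \<Rightarrow> real)) \<Rightarrow> (l2 \<Rightarrow> real) \<Rightarrow> l2 \<Rightarrow> real" where
  "R_cl \<kappa> \<Omega> S \<eta> = improper_integral_on (X_space \<kappa> \<Omega>) (X_norm \<kappa> \<Omega>) (\<lambda>t. S t \<eta>)"

definition L_N ::
  "real \<Rightarrow> (real^3) set \<Rightarrow> (nat \<Rightarrow> l2) \<Rightarrow> nat \<Rightarrow>
   (real \<Rightarrow> (l2 \<Rightarrow> real) \<Rightarrow> (l2 \<Rightarrow> real)) \<Rightarrow> real" where
  "L_N \<kappa> \<Omega> \<phi> N S = op_norm (X_space \<kappa> \<Omega>) (X_norm \<kappa> \<Omega>) (X_norm \<kappa> \<Omega>)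
     (\<lambda>\<eta>. embed \<Omega> (PN \<phi> N (R_cl \<kappa> \<Omega> S (QN \<Omega> \<phi> N \<eta>))))"

definition B_norm :: "real \<Rightarrow> (real^3) set \<Rightarrow> nat \<Rightarrow> (nat \<Rightarrow> real^3) \<Rightarrow> real" where
  "B_norm \<kappa> \<Omega> M x = op_norm (carrier_vec M) euclid_norm (X_norm \<kappa> \<Omega>) (B_op \<Omega> M x)"

definition cancels ::
  "real \<Rightarrow> (real^3) set \<Rightarrow> (nat \<Rightarrow> l2) \<Rightarrow> nat \<Rightarrow> nat \<Rightarrow> (nat \<Rightarrow> real^3) \<Rightarrow> l2 \<Rightarrow>
   real Matrix.vec \<Rightarrow> bool" where
  "cancels \<kappa> \<Omega> \<phi> N M x y u \<longleftrightarrow> u \<in> carrier_vec M \<and>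
     PN \<phi> N (embed \<Omega> (A0 \<kappa> \<Omega> y) + B_op \<Omega> M x u) = 0"

definition U_N ::
  "real \<Rightarrow> (real^3) set \<Rightarrow> (nat \<Rightarrow> l2) \<Rightarrow> nat \<Rightarrow> nat \<Rightarrow> (nat \<Rightarrow> real^3) \<Rightarrow> l2 \<Rightarrow>
   real Matrix.vec" where
  "U_N \<kappa> \<Omega> \<phi> N M x y = (THE u. cancels \<kappa> \<Omega> \<phi> N M x y u \<and>
     (\<forall>w. cancels \<kappa> \<Omega> \<phi> N M x y w \<longrightarrow> euclid_norm u \<le> euclid_norm w))"

definition U_norm ::
  "real \<Rightarrow> (real^3) set \<Rightarrow> (nat \<Rightarrow> l2) \<Rightarrow> nat \<Rightarrow> nat \<Rightarrow> (nat \<Rightarrow> real^3) \<Rightarrow> real" where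
  "U_norm \<kappa> \<Omega> \<phi> N M x = op_norm (XN \<phi> N) (XN_norm \<kappa> \<Omega>) euclid_norm (U_N \<kappa> \<Omega> \<phi> N M x)"

definition T_N ::
  "real \<Rightarrow> (real^3) set \<Rightarrow> (nat \<Rightarrow> l2) \<Rightarrow> nat \<Rightarrow> nat \<Rightarrow> (nat \<Rightarrow> real^3) \<Rightarrow>
   (real \<Rightarrow> (l2 \<Rightarrow> real) \<Rightarrow> (l2 \<Rightarrow> real)) \<Rightarrow> l2 \<Rightarrow> l2" where
  "T_N \<kappa> \<Omega> \<phi> N M x S y =
     PN \<phi> N (R_cl \<kappa> \<Omega> S (QN \<Omega> \<phi> N (B_op \<Omega> M x (U_N \<kappa> \<Omega> \<phi> N M x y))))"

definition T_norm ::
  "real \<Rightarrow> (real^3) set \<Rightarrow> (nat \<Rightarrow> l2) \<Rightarrow> nat \<Rightarrow> nat \<Rightarrow> (nat \<Rightarrow> real^3) \<Rightarrow>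
   (real \<Rightarrow> (l2 \<Rightarrow> real) \<Rightarrow> (l2 \<Rightarrow> real)) \<Rightarrow> real" where
  "T_norm \<kappa> \<Omega> \<phi> N M x S =
     op_norm (XN \<phi> N) (XN_norm \<kappa> \<Omega>) (XN_norm \<kappa> \<Omega>) (T_N \<kappa> \<Omega> \<phi> N M x S)"

definition C_mat ::
  "(real^3) set \<Rightarrow> (nat \<Rightarrow> l2) \<Rightarrow> nat \<Rightarrow> nat \<Rightarrow> (nat \<Rightarrow> real^3) \<Rightarrow> real Matrix.mat" where
  "C_mat \<Omega> \<phi> N M x = Matrix.mat N M (\<lambda>(k, j). pt_value \<Omega> (\<phi> k) (x j))"

text \<open>A matrix with \<open>r\<close> rows and \<open>c\<close> columns has \<open>min r c\<close> singular values, the square roots of the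
  eigenvalues of the smaller one of its two Gram matrices.\<close>

definition singular_values :: "real Matrix.mat \<Rightarrow> real set" where
  "singular_values C =
     (let G = (if dim_row C \<le> dim_col C then C * transpose_mat C else transpose_mat C * C)
      in {sqrt e | e. eigenvalue G e})"

definition sigma_min :: "real Matrix.mat \<Rightarrow> real" where
  "sigma_min C = Min (singular_values C)"

end

theory Submission
  imports Defs
begin

text \<open>Everything is read off in the coordinates of the eigenbasis.  \<open>\<A>\<^sup>-\<^sup>1\<close> is an isometry of \<open>\<X>\<close> onto
  \<open>L\<^sup>2(\<Omega>)\<close>, so the exponentially stable semigroup has a bounded linear resolvent integral and \<open>L\<^sub>N\<close> is a finite
  operator norm.  With \<open>b = (-\<langle>A\<^sub>0 y, \<phi>\<^sub>k\<rangle>)\<^sub>k\<close> the minimum-norm control is \<open>C\<^sub>N\<^sup>T (C\<^sub>N C\<^sub>N\<^sup>T)\<^sup>-\<^sup>1 b\<close>, whose norm is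
  at most \<open>\<bar>b\<bar> / \<sigma>\<^sub>m\<^sub>i\<^sub>n\<close> by the Rayleigh quotient of \<open>C\<^sub>N C\<^sub>N\<^sup>T\<close>, and \<open>\<bar>b\<bar>\<close> is bounded by \<open>\<parallel>y\<parallel>\<close> on \<open>X\<^sub>N\<close> with a
  constant depending only on the eigenvalues.  The bound on \<open>T\<^sub>N\<close> is submultiplicativity; if it is below one,
  \<open>I + T\<^sub>N\<close> is injective on the finite-dimensional \<open>X\<^sub>N\<close>.\<close>

section \<open>Completeness of \<open>L\<^sup>2\<close>\<close>

text \<open>Most objects are definite descriptions (\<open>wderiv\<close>, \<open>calA_inv\<close>,
  the integral in \<open>R_cl\<close>, \<open>U_N\<close>) or real suprema (\<open>op_norm\<close>);
  each says something only once existence and uniqueness, or an upper bound, has been proved. This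
  dictates the preparatory work: test functions must determine an element of L2 for
  \<open>wderiv\<close>, the quotient type \<open>l2\<close> must be complete for
  \<open>calA_inv\<close> and \<open>R_cl\<close>, and a crude bound precedes every use of an
  operator norm. The norm of the dual space is a function on a set of functionals and not the norm
  of a type, so integrals and limits are computed for the images under \<open>calA_inv\<close> in
  \<open>l2\<close> and then pulled back. The delicate membership is that of the point evaluations
  in the dual space; it is extracted from the generator identity. The constant C comes from
  \<open><A0 y, \<phi> k> = - \<kappa> \<mu>_k \<rho>_k <calA_inv y, \<phi> k>\<close> with
  \<open>\<rho>_k = 1 + \<kappa> \<mu>_k\<close>: the factor \<open>\<rho>_k\<close> is the price of
  measuring y in the weak norm, and monotonicity of the eigenvalues bounds the product for all k
  below N at once.\<close>

lemma sq_integrable_rep_l2: "sq_integrable (rep_l2 f)"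
  using Quotient_rep_reflp[OF Quotient_l2, of f] by (simp add: l2_rel_def)

lemma rep_l2_measurable [measurable]: "rep_l2 f \<in> borel_measurable lborel"
  using sq_integrable_rep_l2[of f] by (simp add: sq_integrable_def)

text \<open>\<open>rep_l2\<close> picks an arbitrary member of the class, so this and all later
  pointwise rules for it hold only almost everywhere.\<close>

lemma rep_abs_l2:
  assumes "sq_integrable f"
  shows "AE x in lborel. rep_l2 (abs_l2 f) x = f x"
proof -
  have "l2_rel f f" using assms by (simp add: l2_rel_def)
  then have "l2_rel (rep_l2 (abs_l2 f)) f"
    by (rule Quotient3_rep_abs[OF Quotient3_l2])
  then show ?thesis by (simp add: l2_rel_def)
qed

lemma l2_eqI:
  assumes "AE x in lborel. rep_l2 f x = rep_l2 g x"
  shows "f = g"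
proof -
  have "l2_rel (rep_l2 f) (rep_l2 g)"
    using assms by (simp add: l2_rel_def sq_integrable_rep_l2)
  then show ?thesis
    by (metis Quotient3_rel_rep[OF Quotient3_l2])
qed

lemma rep_l2_0: "AE x in lborel. rep_l2 0 x = 0"
  using rep_abs_l2[OF sq_integrable_0] by (simp add: zero_l2_def)

lemma rep_l2_add: "AE x in lborel. rep_l2 (f + g) x = rep_l2 f x + rep_l2 g x"
proof -
  have "f + g = abs_l2 (\<lambda>x. rep_l2 f x + rep_l2 g x)"
    by (simp add: plus_l2_def)
  then show ?thesis
    using rep_abs_l2[OF sq_integrable_add[OF sq_integrable_rep_l2 sq_integrable_rep_l2]] by metis
qed

lemma rep_l2_scale: "AE x in lborel. rep_l2 (c *\<^sub>R f) x = c * rep_l2 f x"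
proof -
  have "c *\<^sub>R f = abs_l2 (\<lambda>x. c * rep_l2 f x)"
    by (simp add: scaleR_l2_def)
  then show ?thesis
    using rep_abs_l2[OF sq_integrable_scale[OF sq_integrable_rep_l2]] by metis
qed

lemma rep_l2_diff: "AE x in lborel. rep_l2 (f - g) x = rep_l2 f x - rep_l2 g x"
proof -
  have "f - g = f + (-1) *\<^sub>R g" by simp
  then show ?thesis
    using rep_l2_add[of f "(-1) *\<^sub>R g"] rep_l2_scale[of "-1" g] by auto
qed

lemma inner_l2_eq: "inner f g = (LINT x|lborel. rep_l2 f x * rep_l2 g x)"
  by (simp add: inner_l2_def)

lemma rep_l2_sum: "AE x in lborel. rep_l2 (sum f {..<n::nat}) x = (\<Sum>i<n. rep_l2 (f i) x)"
proof (induction n)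
  case 0
  then show ?case using rep_l2_0 by simp
next
  case (Suc n)
  then show ?case using rep_l2_add[of "sum f {..<n}" "f n"] by auto
qed

text \<open>The squared norm as an extended nonnegative integral, the form to which monotone
  convergence and Fatou's lemma apply.\<close>

lemma nn_integral_rep_l2: "(\<integral>\<^sup>+ x. ennreal ((rep_l2 f x)\<^sup>2) \<partial>lborel) = ennreal ((norm f)\<^sup>2)"
  using sq_integrable_rep_l2[of f]
  by (subst nn_integral_eq_integral)
     (auto simp: sq_integrable_def power2_norm_eq_inner inner_l2_eq simp flip: power2_eq_square)

lemma sq_integrable_abs: "sq_integrable f \<Longrightarrow> sq_integrable (\<lambda>x. \<bar>f x\<bar>)"
  by (auto simp: sq_integrable_def)

text \<open>Lets the triangle inequality of \<open>l2\<close> act on sums of absolute increments,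
  whose norms are those of the increments themselves.\<close>

lemma norm_abs_l2_abs: "norm (abs_l2 (\<lambda>x. \<bar>rep_l2 f x\<bar>)) = norm f"
proof -
  let ?g = "abs_l2 (\<lambda>x. \<bar>rep_l2 f x\<bar>)"
  have "inner ?g ?g = inner f f"
    unfolding inner_l2_eq
    by (rule integral_cong_AE)
       (use rep_abs_l2[OF sq_integrable_abs[OF sq_integrable_rep_l2[of f]]] in auto)
  then show ?thesis by (simp add: norm_eq_sqrt_inner)
qed

text \<open>Riesz--Fischer: the partial sums of the absolute increments of a rapidly Cauchy sequence stay bounded in
  \<open>L\<^sup>2\<close>, so the sequence converges almost everywhere, and Fatou's lemma gives convergence in norm.\<close>

lemma l2_rapidly_Cauchy_convergent:
  fixes X :: "nat \<Rightarrow> l2"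
  assumes X: "\<And>n. norm (X (Suc n) - X n) \<le> (1/2) ^ n"
  shows "\<exists>L. X \<longlonglongrightarrow> L"
proof -
  define D where "D n x = \<bar>rep_l2 (X (Suc n) - X n) x\<bar>" for n x
  define G where "G n x = (\<Sum>i<n. D i x)" for n x
  have D_meas [measurable]: "D n \<in> borel_measurable lborel" for n
    unfolding D_def by measurable
  have G_meas [measurable]: "G n \<in> borel_measurable lborel" for n
    unfolding G_def by measurable
  have D_nonneg: "D n x \<ge> 0" for n x by (simp add: D_def)
  have G_mono: "mono (\<lambda>n. G n x)" for x
    by (rule incseq_SucI) (simp add: G_def D_nonneg)
  have G_nonneg: "G n x \<ge> 0" for n x
    by (simp add: G_def D_nonneg sum_nonneg)
  \<comment> \<open>The pointwise sums \<open>G n\<close> are represented by elements of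
    \<open>l2\<close>; the geometric series bounds their norms by 2, hence the squared integrals by
    4, uniformly in n.\<close>
  have G_bound: "(\<integral>\<^sup>+ x. ennreal ((G n x)\<^sup>2) \<partial>lborel) \<le> 4" for n
  proof -
    define d where "d i = abs_l2 (D i)" for i
    have nd: "norm (d i) \<le> (1/2) ^ i" for i
      using X[of i] norm_abs_l2_abs[of "X (Suc i) - X i"] by (simp add: d_def D_def[abs_def])
    have "AE x in lborel. \<forall>i<n. rep_l2 (d i) x = D i x"
      unfolding d_def D_def
      by (intro AE_all_countable[THEN iffD2] allI AE_impI)
         (rule rep_abs_l2[OF sq_integrable_abs[OF sq_integrable_rep_l2]])
    with rep_l2_sum[of d n] have "AE x in lborel. rep_l2 (sum d {..<n}) x = G n x"
      by eventually_elim (auto simp: G_def intro!: sum.cong)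
    then have "(\<integral>\<^sup>+ x. ennreal ((G n x)\<^sup>2) \<partial>lborel) = (\<integral>\<^sup>+ x. ennreal ((rep_l2 (sum d {..<n}) x)\<^sup>2) \<partial>lborel)"
      by (intro nn_integral_cong_AE) auto
    also have "\<dots> = ennreal ((norm (sum d {..<n}))\<^sup>2)"
      by (rule nn_integral_rep_l2)
    finally have eq: "(\<integral>\<^sup>+ x. ennreal ((G n x)\<^sup>2) \<partial>lborel) = ennreal ((norm (sum d {..<n}))\<^sup>2)" .
    have "norm (sum d {..<n}) \<le> (\<Sum>i<n. (1/2)^i)"
      by (rule sum_norm_le) (use nd in auto)
    also have "\<dots> \<le> 2"
      by (simp add: sum_gp_strict)
    finally have "(norm (sum d {..<n}))\<^sup>2 \<le> 2\<^sup>2"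
      by (intro power_mono) auto
    then have "ennreal ((norm (sum d {..<n}))\<^sup>2) \<le> ennreal 4"
      by (intro ennreal_leI) simp
    then show ?thesis by (simp add: eq)
  qed
  have "(\<integral>\<^sup>+ x. (SUP n. ennreal ((G n x)\<^sup>2)) \<partial>lborel) = (SUP n. \<integral>\<^sup>+ x. ennreal ((G n x)\<^sup>2) \<partial>lborel)"
    by (rule nn_integral_monotone_convergence_SUP)
       (auto simp: incseq_def le_fun_def intro!: ennreal_leI power_mono G_mono[THEN monoD] G_nonneg)
  also have "\<dots> \<le> 4" by (rule SUP_least) (rule G_bound)
  finally have "(\<integral>\<^sup>+ x. (SUP n. ennreal ((G n x)\<^sup>2)) \<partial>lborel) \<noteq> \<infinity>"
    by (auto simp: top_unique)
  then have fin: "AE x in lborel. (SUP n. ennreal ((G n x)\<^sup>2)) \<noteq> \<infinity>"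
    by (intro nn_integral_noteq_infinite) auto
  have incr: "AE x in lborel. \<forall>n. rep_l2 (X (Suc n) - X n) x = rep_l2 (X (Suc n)) x - rep_l2 (X n) x"
    by (intro AE_all_countable[THEN iffD2] allI rep_l2_diff)
  \<comment> \<open>\<open>lim\<close> is total, so measurability of \<open>f\<close> can be settled
    without knowing where the sequence converges.\<close>
  define f where "f x = lim (\<lambda>n. rep_l2 (X n) x)" for x
  have [measurable]: "f \<in> borel_measurable lborel"
    unfolding f_def by measurable
  have conv: "AE x in lborel. (\<lambda>n. rep_l2 (X n) x) \<longlonglongrightarrow> f x"
    using fin incr
  proof eventually_elim
    case (elim x)
    obtain B where B: "(SUP n. ennreal ((G n x)\<^sup>2)) = ennreal B" "B \<ge> 0"
      using elim(1) by (cases "SUP n. ennreal ((G n x)\<^sup>2)") auto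
    have "G n x \<le> sqrt B" for n
    proof -
      have "ennreal ((G n x)\<^sup>2) \<le> ennreal B"
        unfolding B(1)[symmetric] by (rule SUP_upper) simp
      then have "(G n x)\<^sup>2 \<le> B" using B(2) by (simp add: ennreal_le_iff)
      then show ?thesis by (rule real_le_rsqrt)
    qed
    then have "(\<Sum>i\<le>n. D i x) \<le> sqrt B" for n
      by (metis G_def lessThan_Suc_atMost)
    then have "summable (\<lambda>n. D n x)"
      by (intro bounded_imp_summable[where B = "sqrt B"] D_nonneg)
    then have "summable (\<lambda>n. rep_l2 (X (Suc n)) x - rep_l2 (X n) x)"
      using elim(2) summable_norm_cancel[of "\<lambda>n. rep_l2 (X (Suc n)) x - rep_l2 (X n) x"] by (simp add: D_def)
    then have "convergent (\<lambda>n. (rep_l2 (X n) x - rep_l2 (X 0) x) + rep_l2 (X 0) x)"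
      unfolding summable_iff_convergent sum_lessThan_telescope [where f = "\<lambda>n. rep_l2 (X n) x"]
      by (rule convergent_add[OF _ convergent_const])
    then have "convergent (\<lambda>n. rep_l2 (X n) x)"
      by simp
    then show ?case by (simp add: f_def convergent_LIMSEQ_iff)
  qed
  have step: "norm (X (n + k) - X n) \<le> 2 * (1/2) ^ n" for n k
  proof -
    have "norm (X (n + k) - X n) \<le> (\<Sum>i<k. (1/2)^(n+i))"
    proof (induction k)
      case (Suc k)
      have "norm (X (n + Suc k) - X n) \<le> norm (X (Suc (n + k)) - X (n+k)) + norm (X (n + k) - X n)"
        by (metis add_Suc_right diff_add_cancel norm_triangle_ineq add_diff_eq)
      then show ?case using Suc X[of "n+k"] by simp
    qed simp
    also have "\<dots> = (1/2)^n * (\<Sum>i<k. (1/2)^i)"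
      by (simp add: power_add sum_distrib_left)
    also have "\<dots> \<le> (1/2)^n * 2"
      by (intro mult_left_mono) (auto simp: sum_gp_strict)
    finally show ?thesis by simp
  qed
  \<comment> \<open>With n fixed and k tending to infinity, the increments over k steps converge
    almost everywhere to \<open>f\<close> minus the n-th term, so the uniform Cauchy estimate
    \<open>step\<close> passes to the limit.\<close>
  have fatou: "(\<integral>\<^sup>+ x. ennreal ((f x - rep_l2 (X n) x)\<^sup>2) \<partial>lborel) \<le> ennreal ((2 * (1/2)^n)\<^sup>2)" for n
  proof -
    have d: "AE x in lborel. \<forall>k. rep_l2 (X (n+k) - X n) x = rep_l2 (X (n+k)) x - rep_l2 (X n) x"
      by (intro AE_all_countable[THEN iffD2] allI rep_l2_diff)
    have "(\<integral>\<^sup>+ x. ennreal ((f x - rep_l2 (X n) x)\<^sup>2) \<partial>lborel)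
        = (\<integral>\<^sup>+ x. liminf (\<lambda>k. ennreal ((rep_l2 (X (n+k) - X n) x)\<^sup>2)) \<partial>lborel)"
    proof (rule nn_integral_cong_AE)
      show "AE x in lborel. ennreal ((f x - rep_l2 (X n) x)\<^sup>2) = liminf (\<lambda>k. ennreal ((rep_l2 (X (n+k) - X n) x)\<^sup>2))"
        using conv d
      proof eventually_elim
        case (elim x)
        have "(\<lambda>k. rep_l2 (X (k+n)) x) \<longlonglongrightarrow> f x"
          by (rule LIMSEQ_ignore_initial_segment[OF elim(1)])
        then have "(\<lambda>k. ennreal ((rep_l2 (X (n+k)) x - rep_l2 (X n) x)\<^sup>2)) \<longlonglongrightarrow> ennreal ((f x - rep_l2 (X n) x)\<^sup>2)"
          by (intro tendsto_intros tendsto_ennrealI) (simp add: add.commute)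
        from lim_imp_Liminf[OF _ this] show ?case using elim(2) by simp
      qed
    qed
    also have "\<dots> \<le> liminf (\<lambda>k. \<integral>\<^sup>+ x. ennreal ((rep_l2 (X (n+k) - X n) x)\<^sup>2) \<partial>lborel)"
      by (rule nn_integral_liminf) measurable
    also have "\<dots> = liminf (\<lambda>k. ennreal ((norm (X (n+k) - X n))\<^sup>2))"
      by (simp add: nn_integral_rep_l2)
    also have "\<dots> \<le> liminf (\<lambda>k. ennreal ((2 * (1/2)^n)\<^sup>2))"
      by (intro Liminf_mono always_eventually allI ennreal_leI power_mono step) simp
    also have "\<dots> = ennreal ((2 * (1/2)^n)\<^sup>2)" by (simp add: Liminf_const)
    finally show ?thesis .
  qed
  have sqd: "sq_integrable (\<lambda>x. f x - rep_l2 (X n) x)" for n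
    unfolding sq_integrable_def
    using le_less_trans[OF fatou[of n] ennreal_less_top] by (auto intro!: integrableI_bounded)
  \<comment> \<open>The limit is the square integrable difference to \<open>X 0\<close> plus
    \<open>X 0\<close> itself.\<close>
  have "sq_integrable f"
    using sq_integrable_add[OF sqd[of 0] sq_integrable_rep_l2[of "X 0"]] by simp
  have bd: "norm (X n - abs_l2 f) \<le> 2 * (1/2)^n" for n
  proof -
    have "ennreal ((norm (abs_l2 f - X n))\<^sup>2) = (\<integral>\<^sup>+ x. ennreal ((f x - rep_l2 (X n) x)\<^sup>2) \<partial>lborel)"
      unfolding nn_integral_rep_l2[symmetric]
      by (intro nn_integral_cong_AE)
         (use rep_l2_diff[of "abs_l2 f" "X n"] rep_abs_l2[OF \<open>sq_integrable f\<close>] in auto)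
    also have "\<dots> \<le> ennreal ((2 * (1/2)^n)\<^sup>2)" by (rule fatou)
    finally have "(norm (abs_l2 f - X n))\<^sup>2 \<le> (2 * (1/2)^n)\<^sup>2"
      by (simp only: ennreal_le_iff zero_le_power2)
    then have "norm (abs_l2 f - X n) \<le> 2 * (1/2)^n"
      by (rule power2_le_imp_le) simp
    then show ?thesis
      by (subst norm_minus_commute)
  qed
  have "(\<lambda>n. 2 * (1/2::real)^n) \<longlonglongrightarrow> 0"
    by (intro tendsto_mult_right_zero LIMSEQ_power_zero) simp
  then have "(\<lambda>n. X n - abs_l2 f) \<longlonglongrightarrow> 0"
    by (rule Lim_null_comparison[rotated]) (use bd in auto)
  then show ?thesis using Lim_null by blast
qed

instance l2 :: complete_space
proof
  fix X :: "nat \<Rightarrow> l2"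
  assume X: "Cauchy X"
  have "\<exists>N. \<forall>m\<ge>N. \<forall>n\<ge>N. norm (X m - X n) < (1/2)^k" for k
    using X by (auto simp: Cauchy_iff)
  then obtain N where N: "\<And>k m n. m \<ge> N k \<Longrightarrow> n \<ge> N k \<Longrightarrow> norm (X m - X n) < (1/2)^k"
    by metis
  \<comment> \<open>\<open>Suc m\<close> in the maximum makes the indices strictly increasing,
    \<open>N (Suc k)\<close> makes consecutive increments geometrically small.\<close>
  define r where "r = rec_nat (N 0) (\<lambda>k m. max (Suc m) (N (Suc k)))"
  have r: "r 0 = N 0" "r (Suc k) = max (Suc (r k)) (N (Suc k))" for k
    by (simp_all add: r_def)
  have "strict_mono r" by (rule strict_mono_Suc_iff[THEN iffD2]) (simp add: r less_max_iff_disj)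
  have rN: "r k \<ge> N k" for k by (cases k) (auto simp: r)
  have "norm ((X \<circ> r) (Suc k) - (X \<circ> r) k) \<le> (1/2)^k" for k
    using N[of k "r (Suc k)" "r k"] rN[of k] strict_mono_leD[OF \<open>strict_mono r\<close>, of k "Suc k"] by simp
  then obtain L where "(X \<circ> r) \<longlonglongrightarrow> L"
    using l2_rapidly_Cauchy_convergent by blast
  then have "X \<longlonglongrightarrow> L"
    using X \<open>strict_mono r\<close> Cauchy_converges_subseq[of X r L] by auto
  then show "convergent X" by (auto simp: convergent_def)
qed

instance l2 :: banach ..

section \<open>Uniqueness of weak derivatives\<close>

definition flat_exp :: "real poly \<Rightarrow> real \<Rightarrow> real" where
  "flat_exp p t = (if t > 0 then poly p (1 / t) * exp (- (1 / t)) else 0)"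

lemma poly_times_exp_minus_tendsto_0: "((\<lambda>u. poly q u * exp (- u)) \<longlongrightarrow> (0::real)) at_top"
proof -
  have "((\<lambda>u. \<Sum>i\<le>degree q. coeff q i * (u ^ i / exp u)) \<longlongrightarrow> (\<Sum>i\<le>degree q. coeff q i * 0)) at_top"
    by (intro tendsto_intros tendsto_power_div_exp_0)
  moreover have "(\<lambda>u. poly q u * exp (- u)) = (\<lambda>u. \<Sum>i\<le>degree q. coeff q i * (u ^ i / exp u))"
    by (simp add: poly_altdef sum_distrib_right exp_minus divide_inverse mult.assoc)
  ultimately show ?thesis by simp
qed

text \<open>With u = 1/t, the derivative of p(u) exp(-u) is u^2 (p - p')(u) exp(-u), and
  \<open>[:0, 0, 1:]\<close> is that u^2; allowing an arbitrary polynomial thus makes the family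
  closed under differentiation. At t = 0 the right difference quotient is u p(u) exp(-u) with u
  tending to infinity, and the left one is 0.\<close>

lemma flat_exp_DERIV:
  "(flat_exp p has_real_derivative flat_exp ([:0, 0, 1:] * (p - pderiv p)) t) (at t)"
proof -
  consider "t > 0" | "t < 0" | "t = 0" by linarith
  then show ?thesis
  proof cases
    case 1
    have inv: "((\<lambda>t. 1 / t) has_real_derivative - (1 / t * (1 / t))) (at t)"
      using 1 by (auto intro!: derivative_eq_intros simp: power2_eq_square)
    have "((\<lambda>t. poly p (1 / t) * exp (- (1 / t))) has_real_derivative
        poly p (1 / t) * (exp (- (1 / t)) * - (- (1 / t * (1 / t)))) +
        poly (pderiv p) (1 / t) * (- (1 / t * (1 / t))) * exp (- (1 / t))) (at t)"
      by (intro DERIV_mult' DERIV_chain2[OF poly_DERIV inv] DERIV_chain2[OF DERIV_exp DERIV_minus[OF inv]])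
    also have "poly p (1 / t) * (exp (- (1 / t)) * - (- (1 / t * (1 / t)))) +
        poly (pderiv p) (1 / t) * (- (1 / t * (1 / t))) * exp (- (1 / t)) =
        flat_exp ([:0, 0, 1:] * (p - pderiv p)) t"
      using 1 by (simp add: flat_exp_def algebra_simps)
    finally have d: "((\<lambda>t. poly p (1 / t) * exp (- (1 / t))) has_real_derivative
        flat_exp ([:0, 0, 1:] * (p - pderiv p)) t) (at t)" .
    have ev: "\<forall>\<^sub>F s in nhds t. poly p (1 / s) * exp (- (1 / s)) = flat_exp p s"
      using eventually_nhds_in_open[of "{0<..}" t] 1 by (auto elim!: eventually_mono simp: flat_exp_def)
    show ?thesis using d DERIV_cong_ev[OF refl ev refl] by blast
  next
    case 2
    have d: "((\<lambda>t. 0) has_real_derivative flat_exp ([:0, 0, 1:] * (p - pderiv p)) t) (at t)"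
      using 2 by (simp add: flat_exp_def)
    have ev: "\<forall>\<^sub>F s in nhds t. 0 = flat_exp p s"
      using eventually_nhds_in_open[of "{..<0}" t] 2 by (auto elim!: eventually_mono simp: flat_exp_def)
    show ?thesis using d DERIV_cong_ev[OF refl ev refl] by blast
  next
    case 3
    have "((\<lambda>s. flat_exp p s / s) \<longlongrightarrow> 0) (at_right 0)"
    proof -
      have "((\<lambda>s. poly ([:0,1:] * p) (inverse s) * exp (- inverse s)) \<longlongrightarrow> 0) (at_right 0)"
        by (rule filterlim_compose[OF poly_times_exp_minus_tendsto_0 filterlim_inverse_at_top_right])
      then show ?thesis
        by (rule Lim_transform_eventually)
           (auto simp: eventually_at_right_field flat_exp_def field_simps intro!: exI[of _ 1])
    qed
    moreover have "((\<lambda>s. flat_exp p s / s) \<longlongrightarrow> 0) (at_left 0)"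
      by (rule Lim_transform_eventually[of "\<lambda>_. 0"])
         (auto simp: eventually_at_left_field flat_exp_def intro!: exI[of _ "-1"])
    ultimately have "((\<lambda>s. flat_exp p s / s) \<longlongrightarrow> 0) (at 0)"
      by (rule filterlim_split_at_real[rotated])
    then show ?thesis
      using 3 by (simp add: has_field_derivative_iff flat_exp_def)
  qed
qed

text \<open>A class chosen so that directional derivatives of members are again members;
  differentiability of every order then follows by one induction, without formulas for higher
  derivatives.\<close>

inductive flat_smooth :: "(real^3 \<Rightarrow> real) \<Rightarrow> bool" where
  flat: "flat_smooth (\<lambda>x. flat_exp p (a * (x \<bullet> b) + c))"
| const: "flat_smooth (\<lambda>x. c)"
| add: "flat_smooth f \<Longrightarrow> flat_smooth g \<Longrightarrow> flat_smooth (\<lambda>x. f x + g x)"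
| mult: "flat_smooth f \<Longrightarrow> flat_smooth g \<Longrightarrow> flat_smooth (\<lambda>x. f x * g x)"

lemma flat_smooth_prod:
  assumes "finite I" "\<And>i. i \<in> I \<Longrightarrow> flat_smooth (f i)"
  shows "flat_smooth (\<lambda>x. \<Prod>i\<in>I. f i x)"
  using assms by (induction I) (auto intro: flat_smooth.intros)

lemma flat_smooth_derivative:
  "flat_smooth f \<Longrightarrow> \<exists>f'. (\<forall>x. (f has_derivative f' x) (at x)) \<and> (\<forall>v. flat_smooth (\<lambda>x. f' x v))"
proof (induction rule: flat_smooth.induct)
  case (flat p a b c)
  let ?q = "[:0, 0, 1:] * (p - pderiv p)"
  have "((\<lambda>x. flat_exp p (a * (x \<bullet> b) + c)) has_derivative
      (\<lambda>v. flat_exp ?q (a * (x \<bullet> b) + c) * (a * (v \<bullet> b)))) (at x)" for x :: "real^3"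
    by (rule has_derivative_compose[OF _ flat_exp_DERIV[unfolded has_field_derivative_def], simplified comp_def])
       (auto intro!: derivative_eq_intros)
  then show ?case
    by (intro exI[of _ "\<lambda>x v. flat_exp ?q (a * (x \<bullet> b) + c) * (a * (v \<bullet> b))"])
       (auto intro: flat_smooth.intros)
next
  case (const c)
  then show ?case by (intro exI[of _ "\<lambda>x v. 0"]) (auto intro: flat_smooth.intros)
next
  case (add f g)
  then obtain f' g' where "\<forall>x. (f has_derivative f' x) (at x)" "\<forall>v. flat_smooth (\<lambda>x. f' x v)"
    "\<forall>x. (g has_derivative g' x) (at x)" "\<forall>v. flat_smooth (\<lambda>x. g' x v)" by blast
  then show ?case
    by (intro exI[of _ "\<lambda>x v. f' x v + g' x v"]) (auto intro: flat_smooth.intros has_derivative_add)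
next
  case (mult f g)
  then obtain f' g' where "\<forall>x. (f has_derivative f' x) (at x)" "\<forall>v. flat_smooth (\<lambda>x. f' x v)"
    "\<forall>x. (g has_derivative g' x) (at x)" "\<forall>v. flat_smooth (\<lambda>x. g' x v)" by blast
  then show ?case using mult.hyps
    by (intro exI[of _ "\<lambda>x v. f x * g' x v + f' x v * g x"]) (auto intro!: flat_smooth.intros has_derivative_mult)
qed

lemma flat_smooth_Ck_on: "flat_smooth f \<Longrightarrow> Ck_on k UNIV f"
proof (induction k arbitrary: f)
  case 0
  then show ?case
    using flat_smooth_derivative[OF 0]
    by (auto intro: continuous_at_imp_continuous_on has_derivative_continuous)
next
  case (Suc k)
  obtain f' where f': "\<And>x. (f has_derivative f' x) (at x)" "\<And>v. flat_smooth (\<lambda>x. f' x v)"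
    using flat_smooth_derivative[OF Suc.prems] by blast
  have "frechet_derivative f (at x) = f' x" for x
    using frechet_derivative_at[OF f'(1)] by simp
  then show ?case
    using f' Suc.IH by (auto simp: differentiable_def)
qed

text \<open>A tensor product of one-dimensional bumps that is positive exactly on the open box. The
  factor \<open>Suc n\<close> steepens the flanks: each factor is exp(-1/((n+1) s)), where s is the
  distance to a face, and tends to 1.\<close>

definition box_bump :: "real^3 \<Rightarrow> real^3 \<Rightarrow> nat \<Rightarrow> real^3 \<Rightarrow> real" where
  "box_bump a b n x = (\<Prod>i\<in>Basis. flat_exp 1 (real (Suc n) * (x \<bullet> i - a \<bullet> i)) * flat_exp 1 (real (Suc n) * (b \<bullet> i - x \<bullet> i)))"

lemma flat_exp_1: "flat_exp 1 t \<ge> 0" "flat_exp 1 t \<le> 1" "flat_exp 1 t \<noteq> 0 \<longleftrightarrow> t > 0"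
  by (auto simp: flat_exp_def)

lemma flat_exp_1_tendsto:
  "t > 0 \<Longrightarrow> (\<lambda>n. flat_exp 1 (real (Suc n) * t)) \<longlonglongrightarrow> 1"
proof -
  assume t: "t > 0"
  have "(\<lambda>n. exp (- (inverse (real (Suc n)) * (1 / t)))) \<longlonglongrightarrow> exp (- (0 * (1 / t)))"
    by (intro tendsto_intros LIMSEQ_inverse_real_of_nat)
  moreover have "flat_exp 1 (real (Suc n) * t) = exp (- (inverse (real (Suc n)) * (1 / t)))" for n
  proof -
    have "real (Suc n) * t > 0" using t by simp
    then show ?thesis by (simp add: flat_exp_def field_simps)
  qed
  ultimately show ?thesis by simp
qed

lemma box_bump_nonzero: "box_bump a b n x \<noteq> 0 \<longleftrightarrow> x \<in> box a b"
  by (auto simp: box_bump_def mem_box flat_exp_1(3) zero_less_mult_iff algebra_simps simp del: of_nat_Suc)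

lemma box_bump_bounds: "0 \<le> box_bump a b n x" "box_bump a b n x \<le> 1"
  unfolding box_bump_def
  by (auto intro!: prod_nonneg prod_le_1 mult_nonneg_nonneg mult_le_one flat_exp_1)

lemma box_bump_tendsto: "(\<lambda>n. box_bump a b n x) \<longlonglongrightarrow> indicator (box a b) x"
proof (cases "x \<in> box a b")
  case True
  have "(\<lambda>n. box_bump a b n x) \<longlonglongrightarrow> (\<Prod>i\<in>(Basis::(real^3) set). 1 * 1)"
    unfolding box_bump_def
    by (intro tendsto_prod tendsto_mult flat_exp_1_tendsto) (use True in \<open>auto simp: mem_box\<close>)
  then show ?thesis using True by simp
next
  case False
  then have "box_bump a b n x = 0" for n using box_bump_nonzero by blast
  then show ?thesis using False by simp
qed

lemma test_function_box_bump:
  assumes "cbox a b \<subseteq> \<Omega>"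
  shows "test_function \<Omega> (box_bump a b n)"
proof -
  have "flat_smooth (\<lambda>x. flat_exp 1 (real (Suc n) * (x \<bullet> i) + (- real (Suc n) * (a \<bullet> i)))
      * flat_exp 1 (- real (Suc n) * (x \<bullet> i) + real (Suc n) * (b \<bullet> i)))" for i
    by (intro flat_smooth.intros)
  then have "flat_smooth (box_bump a b n)"
    unfolding box_bump_def
    by (intro flat_smooth_prod) (auto simp: algebra_simps)
  moreover have "{x. box_bump a b n x \<noteq> 0} = box a b"
    by (auto simp: box_bump_nonzero)
  moreover have "closure (box a b) \<subseteq> cbox a b"
    by (intro closure_minimal box_subset_cbox closed_cbox)
  moreover have "compact (closure (box a b))"
    by (metis bounded_box compact_closure)
  ultimately show ?thesis
    using assms by (auto simp: test_function_def flat_smooth_Ck_on)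
qed

lemma test_function_measurable: "test_function \<Omega> \<psi> \<Longrightarrow> \<psi> \<in> borel_measurable lborel"
  unfolding test_function_def
  by (metis Ck_on.simps(1) borel_measurable_continuous_onI measurable_lborel2)

text \<open>Open boxes generate the Borel sets and are stable under intersection, so a Dynkin
  argument carries the vanishing integral from boxes to all Borel sets, and a density that
  integrates to 0 over each of them is 0 almost everywhere.\<close>

lemma integral_zero_on_boxes_imp_AE_zero:
  fixes f :: "real^3 \<Rightarrow> real"
  assumes f: "integrable lborel f"
    and z: "\<And>c d. (LINT x|lborel. indicator (box c d) x * f x) = 0"
  shows "AE x in lborel. f x = 0"
proof (rule sigma_finite_measure.density_zero[OF lborel.sigma_finite_measure_axioms f])
  fix A :: "(real^3) set"
  let ?G = "range (\<lambda>(a, b). box a b) :: (real^3) set set"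
  have int: "integrable lborel (\<lambda>x. indicator A x * f x)" if "A \<in> sets lborel" for A
    using integrable_mult_indicator[OF that f] by simp
  \<comment> \<open>The complement step of the Dynkin induction subtracts from the integral over the
    whole space, which is exhausted here by growing cubes.\<close>
  have whole: "(LINT x|lborel. f x) = 0"
  proof -
    have "(\<lambda>n. LINT x|lborel. indicator (box (- real (Suc n) *\<^sub>R One) (real (Suc n) *\<^sub>R One)) x * f x) \<longlonglongrightarrow> (LINT x|lborel. f x)"
    proof (rule integral_dominated_convergence[where w = "\<lambda>x. \<bar>f x\<bar>"])
      show "AE x in lborel. (\<lambda>n. indicator (box (- real (Suc n) *\<^sub>R One) (real (Suc n) *\<^sub>R One)) x * f x) \<longlonglongrightarrow> f x"
      proof (rule AE_I2, rule tendsto_eventually)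
        fix x :: "real^3"
        obtain m :: nat where m: "norm x < real m" using reals_Archimedean2 by blast
        have "x \<in> box (- real (Suc n) *\<^sub>R One) (real (Suc n) *\<^sub>R One)" if "n \<ge> m" for n
        proof -
          have "\<bar>x \<bullet> i\<bar> < real (Suc n)" if "i \<in> Basis" for i
            using Basis_le_norm[OF that, of x] m \<open>n \<ge> m\<close> by linarith
          then show ?thesis by (fastforce simp: mem_box abs_less_iff simp del: of_nat_Suc)
        qed
        then show "\<forall>\<^sub>F n in sequentially. indicator (box (- real (Suc n) *\<^sub>R One) (real (Suc n) *\<^sub>R One)) x * f x = f x"
          by (intro eventually_sequentiallyI[of m]) simp
      qed
    qed (use f in \<open>auto simp: indicator_def\<close>)
    then show ?thesis by (simp add: z LIMSEQ_const_iff)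
  qed
  assume "A \<in> sets lborel"
  then have A: "A \<in> sigma_sets UNIV ?G"
    by (simp add: borel_eq_box)
  have G: "Int_stable ?G" "?G \<subseteq> Pow UNIV"
    by (fastforce simp: Int_stable_def box_Int_box) simp
  from G A have "(LINT x|lborel. indicator A x * f x) = 0"
  proof (induction A rule: sigma_sets_induct_disjoint)
    case (basic A)
    then show ?case using z by auto
  next
    case empty
    then show ?case by simp
  next
    case (compl A)
    have A: "A \<in> sets lborel" using compl by (simp add: borel_eq_box)
    have "(LINT x|lborel. indicator (UNIV - A) x * f x) = (LINT x|lborel. f x - indicator A x * f x)"
      by (rule Bochner_Integration.integral_cong) (auto simp: indicator_def)
    then show ?case using f int[OF A] compl whole by simp
  next
    case (union A)
    have A: "A i \<in> sets lborel" for i using union by (auto simp: borel_eq_box)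
    have "(\<Sum>i. LINT x:A i|lborel. f x) = (LINT x:(\<Union>i. A i)|lborel. f x)"
      using union(1) A integrable_mult_indicator[OF sets.countable_UN[of A UNIV] f]
      by (intro lebesgue_integral_countable_add[symmetric])
         (auto simp: disjoint_family_on_def set_integrable_def)
    then show ?case using union by (simp add: set_lebesgue_integral_def)
  qed
  then show "(LINT x:A|lborel. f x) = 0" by (simp add: set_lebesgue_integral_def)
qed

lemma sq_integrable_indicator:
  "S \<in> sets lborel \<Longrightarrow> emeasure lborel S < \<infinity> \<Longrightarrow> sq_integrable (indicator S)"
  by (auto simp: sq_integrable_def power2_eq_square simp flip: indicator_inter_arith)

text \<open>Test functions increasing to the indicator of a box show that \<open>f\<close> has vanishing integral over
  every box inside \<open>\<Omega>\<close>.\<close>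

lemma AE_zero_of_test_functions:
  assumes "open \<Omega>" and f: "sq_integrable f" and out: "AE x in lborel. x \<notin> \<Omega> \<longrightarrow> f x = 0"
    and z: "\<And>\<psi>. test_function \<Omega> \<psi> \<Longrightarrow> (LINT x|lborel. f x * \<psi> x) = 0"
  shows "AE x in lborel. f x = 0"
proof -
  have f_meas [measurable]: "f \<in> borel_measurable lborel" using f by (simp add: sq_integrable_def)
  have int_box: "integrable lborel (\<lambda>x. indicator (box a b) x * f x)" for a b
    by (intro sq_integrable_mult f sq_integrable_indicator) (auto simp: emeasure_lborel_box_eq)
  have box0: "(LINT x|lborel. indicator (box a b) x * f x) = 0" if ab: "cbox a b \<subseteq> \<Omega>" for a b
  proof -
    have [measurable]: "box_bump a b n \<in> borel_measurable lborel" for n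
      by (rule test_function_measurable[OF test_function_box_bump[OF ab]])
    have "(\<lambda>n. LINT x|lborel. f x * box_bump a b n x) \<longlonglongrightarrow> (LINT x|lborel. indicator (box a b) x * f x)"
    proof (rule integral_dominated_convergence[where w = "\<lambda>x. \<bar>indicator (box a b) x * f x\<bar>"])
      show "AE x in lborel. (\<lambda>n. f x * box_bump a b n x) \<longlonglongrightarrow> indicator (box a b) x * f x"
        using tendsto_mult[OF tendsto_const box_bump_tendsto] by (auto simp: mult.commute)
      show "AE x in lborel. norm (f x * box_bump a b n x) \<le> \<bar>indicator (box a b) x * f x\<bar>" for n
      proof (rule AE_I2)
        fix x
        have "box_bump a b n x \<le> indicator (box a b) x"
          using box_bump_bounds[of a b n x] box_bump_nonzero[of a b n x] by (auto simp: indicator_def)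
        then show "norm (f x * box_bump a b n x) \<le> \<bar>indicator (box a b) x * f x\<bar>"
          using box_bump_bounds[of a b n x]
          by (simp add: abs_mult mult.commute[of "\<bar>f x\<bar>"] mult_right_mono)
      qed
    qed (use int_box in auto)
    then show ?thesis by (simp add: z[OF test_function_box_bump[OF ab]] LIMSEQ_const_iff)
  qed
  have cbox0: "AE x in lborel. x \<in> cbox a b \<longrightarrow> f x = 0" if ab: "cbox a b \<subseteq> \<Omega>" for a b
  proof -
    have "AE x in lborel. indicator (box a b) x * f x = 0"
    proof (rule integral_zero_on_boxes_imp_AE_zero[OF int_box])
      fix c d :: "real^3"
      obtain a' b' where box: "box c d \<inter> box a b = box a' b'"
        by (simp add: box_Int_box)
      show "(LINT x|lborel. indicator (box c d) x * (indicator (box a b) x * f x)) = 0"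
      \<comment> \<open>The inclusion of \<open>cbox a' b'\<close> in \<open>cbox a b\<close> is
        obtained by taking closures, and the closure of an open box is the closed box only if the
        open box is nonempty.\<close>
      proof (cases "box a' b' = {}")
        case False
        then have "cbox a' b' = closure (box a' b')" by (simp add: closure_box)
        also have "\<dots> \<subseteq> cbox a b"
          unfolding box[symmetric] by (intro closure_minimal closed_cbox) (use box_subset_cbox in blast)
        finally show ?thesis
          using box0[of a' b'] ab by (simp add: mult.assoc[symmetric] box flip: indicator_inter_arith)
      next
        case True
        then have "(\<lambda>x. indicator (box c d) x * (indicator (box a b) x * f x)) = (\<lambda>x. 0)"
          using True box by (fastforce simp: fun_eq_iff indicator_def)
        then show ?thesis by (simp only:) simp
      qed
    qed
    moreover have "AE x in lborel. x \<notin> cbox a b - box a b"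
      using negligible_frontier_interval[of a b]
      by (intro AE_not_in) (simp add: negligible_iff_null_sets null_sets_completion_iff)
    ultimately show ?thesis by eventually_elim (auto simp: indicator_def)
  qed
  obtain D where D: "countable D" "D \<subseteq> Pow \<Omega>" "\<And>X. X \<in> D \<Longrightarrow> \<exists>a b. X = cbox a b" "\<Union>D = \<Omega>"
    using open_countable_Union_open_cbox[OF \<open>open \<Omega>\<close>] by metis
  have "AE x in lborel. \<forall>X\<in>D. x \<in> X \<longrightarrow> f x = 0"
    using D(1) by (rule AE_ball_countable[THEN iffD2]) (use D(2,3) cbox0 in blast)
  with out show ?thesis
    by eventually_elim (use D(4) in blast)
qed

lemma sq_integrable_compact_support:
  assumes "continuous_on UNIV f" "compact K" "\<And>x. x \<notin> K \<Longrightarrow> f x = 0"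
  shows "sq_integrable f"
proof -
  have "integrable lborel (\<lambda>x. indicator K x *\<^sub>R (f x)\<^sup>2)"
    by (intro borel_integrable_compact assms continuous_intros continuous_on_subset[OF assms(1)]) simp
  moreover have "(\<lambda>x. indicator K x *\<^sub>R (f x)\<^sup>2) = (\<lambda>x. (f x)\<^sup>2)"
    using assms(3) by (force simp: indicator_def)
  moreover have "f \<in> borel_measurable lborel"
    using borel_measurable_continuous_onI[OF assms(1)] by simp
  ultimately show ?thesis by (simp add: sq_integrable_def)
qed

lemma test_function_sq_integrable:
  assumes "test_function \<Omega> \<psi>"
  shows "sq_integrable \<psi>"
proof (rule sq_integrable_compact_support)
  show "continuous_on UNIV \<psi>"
    using assms Ck_on.simps(1) unfolding test_function_def by blast
  show "compact (closure {x. \<psi> x \<noteq> 0})"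
    using assms by (simp add: test_function_def)
  show "\<psi> x = 0" if "x \<notin> closure {x. \<psi> x \<noteq> 0}" for x
    using that closure_subset[of "{x. \<psi> x \<noteq> 0}"] by blast
qed

lemma test_function_partial_sq_integrable:
  assumes "test_function \<Omega> \<psi>" "b \<in> Basis"
  shows "sq_integrable (\<lambda>x. frechet_derivative \<psi> (at x) b)"
proof (rule sq_integrable_compact_support)
  have "Ck_on (Suc 0) UNIV \<psi>" using assms unfolding test_function_def by blast
  then show "continuous_on UNIV (\<lambda>x. frechet_derivative \<psi> (at x) b)"
    using assms(2) by simp
  show "compact (closure {x. \<psi> x \<noteq> 0})"
    using assms by (simp add: test_function_def)
  show "frechet_derivative \<psi> (at x) b = 0" if x: "x \<notin> closure {x. \<psi> x \<noteq> 0}" for x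
  proof -
    have "(\<psi> has_derivative (\<lambda>_. 0)) (at x)"
    proof (rule has_derivative_transform_within_open[of "\<lambda>_. 0" _ _ UNIV "- closure {x. \<psi> x \<noteq> 0}"])
      show "0 = \<psi> z" if "z \<in> - closure {x. \<psi> x \<noteq> 0}" for z
        using that closure_subset[of "{x. \<psi> x \<noteq> 0}"] by auto
    qed (use x in auto)
    then show ?thesis using frechet_derivative_at by metis
  qed
qed

lemma integral_rep_l2_mult:
  assumes "sq_integrable h"
  shows "(LINT x|lborel. rep_l2 f x * h x) = inner f (abs_l2 h)"
  unfolding inner_l2_eq
  by (rule integral_cong_AE)
     (use rep_abs_l2[OF assms] assms in \<open>auto simp: sq_integrable_def intro!: borel_measurable_times\<close>)

text \<open>Written as inner products with the classes of test functions, integration by parts no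
  longer mentions representatives, and linearity in f and g is that of the inner product.\<close>

lemma weak_partial_iff:
  assumes "b \<in> Basis"
  shows "weak_partial \<Omega> b f g \<longleftrightarrow> f \<in> L2 \<Omega> \<and> g \<in> L2 \<Omega> \<and>
    (\<forall>\<psi>. test_function \<Omega> \<psi> \<longrightarrow>
      inner f (abs_l2 (\<lambda>x. frechet_derivative \<psi> (at x) b)) = - inner g (abs_l2 \<psi>))"
  unfolding weak_partial_def
  using integral_rep_l2_mult[OF test_function_sq_integrable]
    integral_rep_l2_mult[OF test_function_partial_sq_integrable[OF _ assms]]
  by auto

lemma subspace_L2: "Real_Vector_Spaces.subspace (L2 \<Omega>)"
proof (rule real_vector.subspaceI)
  show "0 \<in> L2 \<Omega>" using rep_l2_0 by (auto simp: L2_def)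
  show "f + g \<in> L2 \<Omega>" if "f \<in> L2 \<Omega>" "g \<in> L2 \<Omega>" for f g
    using that rep_l2_add[of f g] by (auto simp: L2_def)
  show "c *\<^sub>R f \<in> L2 \<Omega>" if "f \<in> L2 \<Omega>" for c f
    using that rep_l2_scale[of c f] by (auto simp: L2_def)
qed

lemma subspaceI_comb:
  fixes V :: "'a::real_vector set"
  assumes "0 \<in> V" "\<And>f g s t. f \<in> V \<Longrightarrow> g \<in> V \<Longrightarrow> s *\<^sub>R f + t *\<^sub>R g \<in> V"
  shows "Real_Vector_Spaces.subspace V"
  by (rule real_vector.subspaceI) (use assms(1) assms(2)[of _ _ 1 1] assms(2)[of _ _ _ 0] in auto)

section \<open>Calculus of weak derivatives and the Neumann Laplacian\<close>

locale open_set =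
  fixes \<Omega> :: "(real^3) set"
  assumes open_Omega: "open \<Omega>"
begin

text \<open>Test functions see no difference between the two derivatives. This is what gives the
  definite description in \<open>wderiv\<close> its value.\<close>

lemma weak_partial_unique:
  assumes b: "b \<in> Basis" and "weak_partial \<Omega> b f g" "weak_partial \<Omega> b f h"
  shows "g = h"
proof -
  have gh: "g - h \<in> L2 \<Omega>"
    using assms by (simp add: weak_partial_def real_vector.subspace_diff[OF subspace_L2])
  have "AE x in lborel. rep_l2 (g - h) x = 0"
  proof (rule AE_zero_of_test_functions[OF open_Omega sq_integrable_rep_l2])
    show "AE x in lborel. x \<notin> \<Omega> \<longrightarrow> rep_l2 (g - h) x = 0"
      using gh by (simp add: L2_def)
    show "(LINT x|lborel. rep_l2 (g - h) x * \<psi> x) = 0" if "test_function \<Omega> \<psi>" for \<psi>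
    proof -
      have "inner g (abs_l2 \<psi>) = inner h (abs_l2 \<psi>)"
        using that assms(2,3) unfolding weak_partial_iff[OF b] by (metis neg_equal_iff_equal)
      then show ?thesis
        by (simp add: integral_rep_l2_mult[OF test_function_sq_integrable[OF that]] inner_diff_left)
    qed
  qed
  with rep_l2_0 have "AE x in lborel. rep_l2 (g - h) x = rep_l2 0 x"
    by eventually_elim simp
  then have "g - h = 0" by (rule l2_eqI)
  then show ?thesis by simp
qed

lemma wderiv_eqI:
  assumes "b \<in> Basis" "weak_partial \<Omega> b f g"
  shows "wderiv \<Omega> b f = g"
  unfolding wderiv_def using assms weak_partial_unique by blast

lemma weak_partial_wderiv:
  assumes "f \<in> H1 \<Omega>" "b \<in> Basis"
  shows "weak_partial \<Omega> b f (wderiv \<Omega> b f)"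
  using assms wderiv_eqI unfolding H1_def by blast

lemma weak_partial_linear:
  assumes "b \<in> Basis" "weak_partial \<Omega> b f f'" "weak_partial \<Omega> b g g'"
  shows "weak_partial \<Omega> b (s *\<^sub>R f + t *\<^sub>R g) (s *\<^sub>R f' + t *\<^sub>R g')"
  using assms(2,3) unfolding weak_partial_iff[OF assms(1)]
  by (auto simp: inner_add_left subspace_L2 real_vector.subspace_add real_vector.subspace_scale)

lemma wderiv_linear:
  assumes "f \<in> H1 \<Omega>" "g \<in> H1 \<Omega>" "b \<in> Basis"
  shows "wderiv \<Omega> b (s *\<^sub>R f + t *\<^sub>R g) = s *\<^sub>R wderiv \<Omega> b f + t *\<^sub>R wderiv \<Omega> b g"
  using assms by (intro wderiv_eqI weak_partial_linear weak_partial_wderiv)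

lemma weak_partial_0: "b \<in> Basis \<Longrightarrow> weak_partial \<Omega> b 0 0"
  by (simp add: weak_partial_iff real_vector.subspace_0 subspace_L2)

lemma H1_comb: "f \<in> H1 \<Omega> \<Longrightarrow> g \<in> H1 \<Omega> \<Longrightarrow> s *\<^sub>R f + t *\<^sub>R g \<in> H1 \<Omega>"
  unfolding H1_def using weak_partial_linear
  by (auto simp: subspace_L2 real_vector.subspace_add real_vector.subspace_scale) blast

lemma H1_0: "0 \<in> H1 \<Omega>"
  unfolding H1_def using weak_partial_0 by (auto simp: subspace_L2 real_vector.subspace_0)

lemma H2_comb: "f \<in> H2 \<Omega> \<Longrightarrow> g \<in> H2 \<Omega> \<Longrightarrow> s *\<^sub>R f + t *\<^sub>R g \<in> H2 \<Omega>"
  unfolding H2_def by (auto simp: H1_comb wderiv_linear)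

lemma H2_0: "0 \<in> H2 \<Omega>"
  unfolding H2_def using wderiv_eqI[OF _ weak_partial_0] by (auto simp: H1_0)

lemma wderiv_in_L2: "f \<in> H1 \<Omega> \<Longrightarrow> b \<in> Basis \<Longrightarrow> wderiv \<Omega> b f \<in> L2 \<Omega>"
  using weak_partial_wderiv by (simp add: weak_partial_def)

lemma laplacian_in_L2: "f \<in> H2 \<Omega> \<Longrightarrow> laplacian \<Omega> f \<in> L2 \<Omega>"
  unfolding laplacian_def H2_def
  by (auto intro!: real_vector.subspace_sum[OF subspace_L2] wderiv_in_L2)

lemma laplacian_linear:
  assumes "f \<in> H2 \<Omega>" "g \<in> H2 \<Omega>"
  shows "laplacian \<Omega> (s *\<^sub>R f + t *\<^sub>R g) = s *\<^sub>R laplacian \<Omega> f + t *\<^sub>R laplacian \<Omega> g"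
  using assms unfolding laplacian_def H2_def
  by (simp add: wderiv_linear scaleR_sum_right sum.distrib)

lemma normal_derivative_linear:
  assumes "f \<in> H2 \<Omega>" "g \<in> H2 \<Omega>"
  shows "normal_derivative \<Omega> (s *\<^sub>R f + t *\<^sub>R g) v = s * normal_derivative \<Omega> f v + t * normal_derivative \<Omega> g v"
proof -
  have "f \<in> H1 \<Omega>" "g \<in> H1 \<Omega>" using assms by (auto simp: H2_def)
  then show ?thesis
    unfolding normal_derivative_def laplacian_linear[OF assms]
    by (simp add: wderiv_linear inner_add_left sum.distrib sum_distrib_left algebra_simps)
qed

lemma dom_A0_comb: "y \<in> dom_A0 \<Omega> \<Longrightarrow> z \<in> dom_A0 \<Omega> \<Longrightarrow> s *\<^sub>R y + t *\<^sub>R z \<in> dom_A0 \<Omega>"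
  by (simp add: dom_A0_def H2_comb normal_derivative_linear)

lemma subspace_dom_A0: "Real_Vector_Spaces.subspace (dom_A0 \<Omega>)"
proof (rule subspaceI_comb[OF _ dom_A0_comb])
  have "normal_derivative \<Omega> 0 v = 0" for v
    using normal_derivative_linear[OF H2_0 H2_0, of 0 0] by simp
  then show "0 \<in> dom_A0 \<Omega>" by (simp add: dom_A0_def H2_0)
qed

lemma dom_A0_L2: "y \<in> dom_A0 \<Omega> \<Longrightarrow> y \<in> L2 \<Omega>"
  by (simp add: dom_A0_def H2_def H1_def)

text \<open>The Neumann condition is tested against all of \<open>H1\<close>, so each function may
  serve as test function for the other; the two Green identities share the same symmetric gradient
  term.\<close>

lemma laplacian_symmetric:
  assumes "y \<in> dom_A0 \<Omega>" "z \<in> dom_A0 \<Omega>"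
  shows "inner (laplacian \<Omega> y) z = inner y (laplacian \<Omega> z)"
proof -
  have "normal_derivative \<Omega> y z = 0" "normal_derivative \<Omega> z y = 0"
    using assms by (auto simp: dom_A0_def H2_def)
  then show ?thesis
    by (simp add: normal_derivative_def inner_commute)
qed

lemma laplacian_nonpos:
  assumes "y \<in> dom_A0 \<Omega>"
  shows "inner (laplacian \<Omega> y) y \<le> 0"
proof -
  have "normal_derivative \<Omega> y y = 0"
    using assms by (auto simp: dom_A0_def H2_def)
  moreover have "(\<Sum>b\<in>Basis. inner (wderiv \<Omega> b y) (wderiv \<Omega> b y)) \<ge> 0"
    by (intro sum_nonneg) simp
  ultimately show ?thesis by (simp add: normal_derivative_def)
qed

end

section \<open>The space \<open>\<X>\<close> and the isometry \<open>\<A>\<^sup>-\<^sup>1\<close>\<close>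

lemma fun_scaleR_apply: "(c *\<^sub>R f) x = c *\<^sub>R f x" for f :: "'a \<Rightarrow> 'b::real_vector"
  by (simp add: scaleR_fun_def)

locale neumann = open_set \<Omega> for \<Omega> +
  fixes \<kappa> :: real and \<phi> :: "nat \<Rightarrow> l2" and \<mu> :: "nat \<Rightarrow> real"
  assumes kappa_pos: "\<kappa> > 0"
    and eigenbasis: "neumann_eigenbasis \<Omega> \<phi> \<mu>"
begin

text \<open>The eigenvalue of \<open>calA\<close> at \<open>\<phi> k\<close>; it is at least 1, so
  coefficients can always be divided by it.\<close>

definition \<rho> :: "nat \<Rightarrow> real" where "\<rho> k = 1 + \<kappa> * \<mu> k"

lemma phi_dom: "\<phi> k \<in> dom_A0 \<Omega>"
  and phi_laplacian: "laplacian \<Omega> (\<phi> k) = - \<mu> k *\<^sub>R \<phi> k"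
  and phi_orthonormal: "inner (\<phi> i) (\<phi> j) = (if i = j then 1 else 0)"
  and phi_total: "closure (span (range \<phi>)) = L2 \<Omega>"
  and mu_0: "\<mu> 0 = 0" and mu_mono: "mono \<mu>"
  using eigenbasis by (auto simp: neumann_eigenbasis_def minus_equation_iff[of "laplacian \<Omega> _"])

lemma mu_nonneg: "\<mu> k \<ge> 0"
  using mu_mono mu_0 by (metis le0 monoD)

lemma rho_ge_1: "\<rho> k \<ge> 1"
  using mu_nonneg kappa_pos by (simp add: \<rho>_def)

lemma rho_nonzero: "\<rho> k \<noteq> 0" and rho_pos: "\<rho> k > 0"
  using rho_ge_1[of k] by auto

lemma phi_L2: "\<phi> k \<in> L2 \<Omega>"
  by (rule dom_A0_L2[OF phi_dom])

text \<open>The totality assumption on the eigenbasis exhibits \<open>L2 \<Omega>\<close> as a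
  closure.\<close>

lemma closed_L2: "closed (L2 \<Omega>)"
  by (metis closed_closure phi_total)

lemma calA_linear:
  assumes "y \<in> dom_A0 \<Omega>" "z \<in> dom_A0 \<Omega>"
  shows "calA \<kappa> \<Omega> (s *\<^sub>R y + t *\<^sub>R z) = s *\<^sub>R calA \<kappa> \<Omega> y + t *\<^sub>R calA \<kappa> \<Omega> z"
  using assms by (simp add: calA_def A0_def dom_A0_def laplacian_linear algebra_simps)

lemma calA_diff:
  assumes "y \<in> dom_A0 \<Omega>" "z \<in> dom_A0 \<Omega>"
  shows "calA \<kappa> \<Omega> (y - z) = calA \<kappa> \<Omega> y - calA \<kappa> \<Omega> z"
  using calA_linear[OF assms, of 1 "-1"] by simp

lemma calA_L2: "y \<in> dom_A0 \<Omega> \<Longrightarrow> calA \<kappa> \<Omega> y \<in> L2 \<Omega>"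
  unfolding calA_def A0_def
  by (intro real_vector.subspace_diff[OF subspace_L2] real_vector.subspace_scale[OF subspace_L2]
      dom_A0_L2 laplacian_in_L2) (auto simp: dom_A0_def)

lemma calA_symmetric:
  assumes "y \<in> dom_A0 \<Omega>" "z \<in> dom_A0 \<Omega>"
  shows "inner (calA \<kappa> \<Omega> y) z = inner y (calA \<kappa> \<Omega> z)"
  using laplacian_symmetric[OF assms]
  by (simp add: calA_def A0_def inner_diff_left inner_diff_right)

lemma calA_phi: "calA \<kappa> \<Omega> (\<phi> k) = \<rho> k *\<^sub>R \<phi> k"
  by (simp add: calA_def A0_def phi_laplacian \<rho>_def algebra_simps)

text \<open>As \<open>A0\<close> is nonpositive, the form of \<open>calA\<close> dominates the
  squared norm. The inequality makes functionals bounded in the plain norm, such as those of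
  \<open>embed\<close>, bounded in the norm that defines the dual space.\<close>

lemma calA_coercive:
  assumes "y \<in> dom_A0 \<Omega>"
  shows "norm y \<le> norm (calA \<kappa> \<Omega> y)"
proof -
  have "\<kappa> * inner (laplacian \<Omega> y) y \<le> 0"
    using laplacian_nonpos[OF assms] kappa_pos by (simp add: mult_nonneg_nonpos)
  then have "norm y * norm y \<le> inner (calA \<kappa> \<Omega> y) y"
    by (simp add: calA_def A0_def inner_diff_left power2_norm_eq_inner flip: power2_eq_square)
  also have "\<dots> \<le> norm (calA \<kappa> \<Omega> y) * norm y"
    by (rule norm_cauchy_schwarz)
  finally show ?thesis
    by (cases "y = 0") auto
qed

lemma L2_eq_0:
  assumes "f \<in> L2 \<Omega>" "\<And>k. inner f (\<phi> k) = 0"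
  shows "f = 0"
proof -
  have "inner f g = 0" if "g \<in> span (range \<phi>)" for g
    using that by (induction rule: real_vector.span_induct_alt) (auto simp: inner_add_right assms(2))
  then have "span (range \<phi>) \<subseteq> {g. inner f g = 0}" by auto
  moreover have "closed {g. inner f g = 0}"
    by (intro closed_Collect_eq continuous_intros)
  ultimately have "L2 \<Omega> \<subseteq> {g. inner f g = 0}"
    unfolding phi_total[symmetric] by (rule closure_minimal)
  then show ?thesis using assms(1) by auto
qed

lemma span_phi_dom: "span (range \<phi>) \<subseteq> dom_A0 \<Omega>"
  using phi_dom subspace_dom_A0 by (intro real_vector.span_minimal) auto

text \<open>The operator is diagonal with nonzero entries on the span of the eigenfunctions. As that
  span is dense in \<open>L2 \<Omega>\<close>, any \<open>calA y\<close> can be approximated by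
  images of finite combinations.\<close>

lemma calA_span:
  assumes "g \<in> span (range \<phi>)"
  shows "\<exists>y\<in>span (range \<phi>). calA \<kappa> \<Omega> y = g"
  using assms
proof (induction rule: real_vector.span_induct_alt)
  case base
  have "calA \<kappa> \<Omega> 0 = 0"
    using calA_linear[OF phi_dom phi_dom, of 0 _ 0] by simp
  then show ?case using real_vector.span_zero by blast
next
  case (step c x z)
  then obtain k y where "x = \<phi> k" and y: "y \<in> span (range \<phi>)" "calA \<kappa> \<Omega> y = z" by blast
  then have "calA \<kappa> \<Omega> ((c / \<rho> k) *\<^sub>R \<phi> k + 1 *\<^sub>R y) = c *\<^sub>R x + z"
    using span_phi_dom calA_linear[OF phi_dom[of k], of y "c / \<rho> k" 1] rho_nonzero[of k]
    by (auto simp: calA_phi)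
  moreover have "(c / \<rho> k) *\<^sub>R \<phi> k + 1 *\<^sub>R y \<in> span (range \<phi>)"
    using y by (intro real_vector.span_add real_vector.span_scale) (auto intro: real_vector.span_base)
  ultimately show ?case by blast
qed

lemma norm_sum_phi: "finite I \<Longrightarrow> (norm (\<Sum>k\<in>I. c k *\<^sub>R \<phi> k))\<^sup>2 = (\<Sum>k\<in>I. (c k)\<^sup>2)"
  unfolding power2_norm_eq_inner
  by (simp add: inner_sum_left inner_sum_right phi_orthonormal if_distrib power2_eq_square cong: if_cong)

text \<open>Completeness of \<open>l2\<close> enters here: by orthonormality, blocks of the series
  have as squared norms the blocks of the convergent series of squared coefficients.\<close>

lemma exists_L2_with_coefficients:
  assumes B: "\<And>n. (\<Sum>k<n. (c k)\<^sup>2) \<le> B"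
  shows "\<exists>f\<in>L2 \<Omega>. \<forall>k. inner f (\<phi> k) = c k"
proof -
  have "summable (\<lambda>k. (c k)\<^sup>2)"
    by (rule bounded_imp_summable[where B = B]) (simp, metis B lessThan_Suc_atMost)
  have "summable (\<lambda>k. c k *\<^sub>R \<phi> k)"
    unfolding summable_Cauchy
  proof (intro allI impI)
    fix e :: real assume "e > 0"
    then obtain N where N: "\<And>m n. m \<ge> N \<Longrightarrow> norm (\<Sum>k=m..<n. (c k)\<^sup>2) < e\<^sup>2"
      using \<open>summable (\<lambda>k. (c k)\<^sup>2)\<close> unfolding summable_Cauchy by (meson zero_less_power)
    have "norm (\<Sum>k=m..<n. c k *\<^sub>R \<phi> k) < e" if "m \<ge> N" for m n
    proof -
      have "(norm (\<Sum>k=m..<n. c k *\<^sub>R \<phi> k))\<^sup>2 < e\<^sup>2"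
        using N[OF that, of n] by (simp add: norm_sum_phi)
      then show ?thesis using \<open>e > 0\<close> by (simp add: power2_less_imp_less)
    qed
    then show "\<exists>N. \<forall>m\<ge>N. \<forall>n. norm (\<Sum>k=m..<n. c k *\<^sub>R \<phi> k) < e" by blast
  qed
  then obtain f where f: "(\<lambda>k. c k *\<^sub>R \<phi> k) sums f" by (auto simp: summable_def)
  have "f \<in> L2 \<Omega>"
  proof (rule closed_sequentially[OF closed_L2])
    show "(\<lambda>n. \<Sum>k<n. c k *\<^sub>R \<phi> k) \<longlonglongrightarrow> f" using f by (simp add: sums_def)
    show "(\<Sum>k<n. c k *\<^sub>R \<phi> k) \<in> L2 \<Omega>" for n
      by (intro real_vector.subspace_sum real_vector.subspace_scale subspace_L2 phi_L2)
  qed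
  moreover have "inner f (\<phi> j) = c j" for j
  proof -
    have "(\<lambda>k. inner (c k *\<^sub>R \<phi> k) (\<phi> j)) sums inner f (\<phi> j)"
      using f by (rule bounded_linear.sums[OF bounded_linear_inner_left])
    moreover have "(\<lambda>k. inner (c k *\<^sub>R \<phi> k) (\<phi> j)) = (\<lambda>k. if k = j then c k else 0)"
      by (auto simp: phi_orthonormal)
    ultimately show ?thesis using sums_single[of j c] sums_unique2 by metis
  qed
  ultimately show ?thesis by blast
qed

section \<open>The dual space and its Riesz representation\<close>

abbreviation "X \<equiv> X_space \<kappa> \<Omega>"
abbreviation "J \<equiv> calA_inv \<kappa> \<Omega>"

lemma X_D:
  assumes "\<eta> \<in> X"
  shows "y \<notin> dom_A0 \<Omega> \<Longrightarrow> \<eta> y = 0"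
    and "y \<in> dom_A0 \<Omega> \<Longrightarrow> z \<in> dom_A0 \<Omega> \<Longrightarrow> \<eta> (a *\<^sub>R y + b *\<^sub>R z) = a * \<eta> y + b * \<eta> z"
    and "\<exists>K. \<forall>y\<in>dom_A0 \<Omega>. \<bar>\<eta> y\<bar> \<le> K * norm (calA \<kappa> \<Omega> y)"
  using assms by (auto simp: X_space_def)

lemma X_I:
  assumes "\<And>y. y \<notin> dom_A0 \<Omega> \<Longrightarrow> \<eta> y = 0"
    and "\<And>y z a b. y \<in> dom_A0 \<Omega> \<Longrightarrow> z \<in> dom_A0 \<Omega> \<Longrightarrow> \<eta> (a *\<^sub>R y + b *\<^sub>R z) = a * \<eta> y + b * \<eta> z"
    and "\<And>y. y \<in> dom_A0 \<Omega> \<Longrightarrow> \<bar>\<eta> y\<bar> \<le> K * norm (calA \<kappa> \<Omega> y)"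
  shows "\<eta> \<in> X"
  unfolding X_space_def using assms by blast

lemma subspace_X: "Real_Vector_Spaces.subspace X"
proof (rule subspaceI_comb)
  show "0 \<in> X" by (rule X_I[where K = 0]) auto
next
  fix \<eta> \<zeta> :: "l2 \<Rightarrow> real" and s t :: real
  assume X: "\<eta> \<in> X" "\<zeta> \<in> X"
  obtain K K' where K: "\<And>y. y \<in> dom_A0 \<Omega> \<Longrightarrow> \<bar>\<eta> y\<bar> \<le> K * norm (calA \<kappa> \<Omega> y)"
    "\<And>y. y \<in> dom_A0 \<Omega> \<Longrightarrow> \<bar>\<zeta> y\<bar> \<le> K' * norm (calA \<kappa> \<Omega> y)"
    using X X_D(3) by meson
  show "s *\<^sub>R \<eta> + t *\<^sub>R \<zeta> \<in> X"
  proof (rule X_I[where K = "\<bar>s\<bar> * K + \<bar>t\<bar> * K'"])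
    fix y assume y: "y \<in> dom_A0 \<Omega>"
    have "\<bar>(s *\<^sub>R \<eta> + t *\<^sub>R \<zeta>) y\<bar> \<le> \<bar>s\<bar> * \<bar>\<eta> y\<bar> + \<bar>t\<bar> * \<bar>\<zeta> y\<bar>"
      using abs_triangle_ineq[of "s * \<eta> y" "t * \<zeta> y"] by (simp add: fun_scaleR_apply abs_mult)
    also have "\<dots> \<le> \<bar>s\<bar> * (K * norm (calA \<kappa> \<Omega> y)) + \<bar>t\<bar> * (K' * norm (calA \<kappa> \<Omega> y))"
      by (intro add_mono mult_left_mono K y) auto
    finally show "\<bar>(s *\<^sub>R \<eta> + t *\<^sub>R \<zeta>) y\<bar> \<le> (\<bar>s\<bar> * K + \<bar>t\<bar> * K') * norm (calA \<kappa> \<Omega> y)"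
      by (simp add: algebra_simps)
  qed (auto simp: fun_scaleR_apply X_D[OF X(1)] X_D[OF X(2)] algebra_simps)
qed

text \<open>Riesz representation: the Fourier coefficients of \<open>\<A>\<^sup>-\<^sup>1\<eta>\<close> are \<open>\<eta> (\<phi> k) / \<rho> k\<close>; the resulting functional
  agrees with \<open>\<eta>\<close> on the span of the eigenfunctions, which is a core of \<open>\<A>\<close>.\<close>

lemma X_representation:
  assumes X: "\<eta> \<in> X"
  shows "\<exists>f\<in>L2 \<Omega>. \<forall>y\<in>dom_A0 \<Omega>. inner f (calA \<kappa> \<Omega> y) = \<eta> y"
proof -
  obtain K where K: "\<And>y. y \<in> dom_A0 \<Omega> \<Longrightarrow> \<bar>\<eta> y\<bar> \<le> K * norm (calA \<kappa> \<Omega> y)"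
    using X_D(3)[OF X] by blast
  define c where "c k = \<eta> (\<phi> k) / \<rho> k" for k
  have calA_0: "calA \<kappa> \<Omega> 0 = 0" and eta_0: "\<eta> 0 = 0"
    using calA_linear[OF phi_dom phi_dom, of 0 _ 0] X_D(2)[OF X phi_dom phi_dom, of 0 _ 0] by simp_all
  have fin: "(\<Sum>k<n. d k *\<^sub>R \<phi> k) \<in> dom_A0 \<Omega> \<and> \<eta> (\<Sum>k<n. d k *\<^sub>R \<phi> k) = (\<Sum>k<n. d k * \<eta> (\<phi> k))
      \<and> calA \<kappa> \<Omega> (\<Sum>k<n. d k *\<^sub>R \<phi> k) = (\<Sum>k<n. (d k * \<rho> k) *\<^sub>R \<phi> k)" for d n
  proof (induction n)
    case 0
    then show ?case using eta_0 calA_0 real_vector.subspace_0[OF subspace_dom_A0] by simp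
  next
    case (Suc n)
    then show ?case
      using X_D(2)[OF X, of "\<Sum>k<n. d k *\<^sub>R \<phi> k" "\<phi> n" 1 "d n"] phi_dom[of n]
        calA_linear[of "\<Sum>k<n. d k *\<^sub>R \<phi> k" "\<phi> n" 1 "d n"]
        dom_A0_comb[of "\<Sum>k<n. d k *\<^sub>R \<phi> k" "\<phi> n" 1 "d n"]
      by (simp add: calA_phi)
  qed
  have "(\<Sum>k<n. (c k)\<^sup>2) \<le> K\<^sup>2" for n
  proof -
    let ?S = "\<Sum>k<n. (c k)\<^sup>2"
    \<comment> \<open>The extremal test element: \<open>\<eta>\<close> takes the value S on it,
      where S is the sum of the squared coefficients, while its image under \<open>calA\<close> has
      norm sqrt S. Boundedness of \<open>\<eta>\<close> thus reads S \<le> K sqrt S, and K may have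
      either sign.\<close>
    let ?y = "\<Sum>k<n. (c k / \<rho> k) *\<^sub>R \<phi> k"
    have "\<eta> ?y = ?S"
      using fin[of "\<lambda>k. c k / \<rho> k" n] by (simp add: c_def power2_eq_square)
    moreover have "(norm (calA \<kappa> \<Omega> ?y))\<^sup>2 = ?S"
      using fin[of "\<lambda>k. c k / \<rho> k" n] by (simp add: rho_nonzero norm_sum_phi)
    moreover have S: "?S \<ge> 0" by (simp add: sum_nonneg)
    moreover have "\<bar>\<eta> ?y\<bar> \<le> K * norm (calA \<kappa> \<Omega> ?y)"
      using K fin[of "\<lambda>k. c k / \<rho> k" n] by blast
    ultimately have "?S \<le> K * sqrt ?S"
      using real_sqrt_unique[OF _ norm_ge_zero, of "calA \<kappa> \<Omega> ?y" ?S] by simp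
    then have "sqrt ?S * sqrt ?S \<le> K * sqrt ?S" using S by simp
    then have "sqrt ?S \<le> \<bar>K\<bar>"
    proof (cases "?S = 0")
      case False
      then have "sqrt ?S > 0" using S by simp
      then have "sqrt ?S \<le> K" using \<open>sqrt ?S * sqrt ?S \<le> K * sqrt ?S\<close>
        by (simp only: mult_le_cancel_right_pos)
      then show ?thesis by linarith
    qed simp
    then show ?thesis by (metis sqrt_le_D power2_abs)
  qed
  then obtain f where f: "f \<in> L2 \<Omega>" "\<And>k. inner f (\<phi> k) = c k"
    using exists_L2_with_coefficients by blast
  have span: "y \<in> dom_A0 \<Omega> \<and> inner f (calA \<kappa> \<Omega> y) = \<eta> y" if "y \<in> span (range \<phi>)" for y
    using that
  proof (induction rule: real_vector.span_induct_alt)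
    case base
    then show ?case by (simp add: calA_0 eta_0 real_vector.subspace_0[OF subspace_dom_A0])
  next
    case (step a x z)
    then obtain k where k: "x = \<phi> k" by blast
    have z: "z \<in> dom_A0 \<Omega>" "inner f (calA \<kappa> \<Omega> z) = \<eta> z" using step by blast+
    show ?case
      using calA_linear[OF phi_dom z(1), of a k 1] X_D(2)[OF X phi_dom z(1), of a k 1] z(2)
        dom_A0_comb[OF phi_dom z(1), of a k 1]
      by (simp add: k calA_phi inner_add_right f c_def rho_nonzero)
  qed
  have "inner f (calA \<kappa> \<Omega> y) = \<eta> y" if y: "y \<in> dom_A0 \<Omega>" for y
  proof -
    \<comment> \<open>Write \<open>g\<close> as \<open>calA z\<close> with \<open>z\<close> in the
      span. The two functionals agree at \<open>z\<close>, so their difference at \<open>y\<close>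
      is the one at \<open>y - z\<close>, where both are controlled by the distance from
      \<open>calA y\<close> to \<open>g\<close>.\<close>
    have small: "\<bar>\<eta> y - inner f (calA \<kappa> \<Omega> y)\<bar> \<le> (K + norm f) * norm (calA \<kappa> \<Omega> y - g)"
      if "g \<in> span (range \<phi>)" for g
    proof -
      obtain z where z: "z \<in> span (range \<phi>)" "calA \<kappa> \<Omega> z = g" using calA_span[OF \<open>g \<in> _\<close>] by blast
      have zd: "z \<in> dom_A0 \<Omega>" using z span_phi_dom by blast
      have yz: "y - z \<in> dom_A0 \<Omega>" using real_vector.subspace_diff[OF subspace_dom_A0 y zd] .
      have "\<eta> (y - z) = \<eta> y - \<eta> z" using X_D(2)[OF X y zd, of 1 "-1"] by simp
      then have "\<eta> y - inner f (calA \<kappa> \<Omega> y) = \<eta> (y - z) - inner f (calA \<kappa> \<Omega> (y - z))"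
        using span[OF z(1)] by (simp add: calA_diff[OF y zd] inner_diff_right)
      also have "\<bar>\<dots>\<bar> \<le> \<bar>\<eta> (y - z)\<bar> + \<bar>inner f (calA \<kappa> \<Omega> (y - z))\<bar>" by simp
      also have "\<dots> \<le> K * norm (calA \<kappa> \<Omega> (y - z)) + norm f * norm (calA \<kappa> \<Omega> (y - z))"
        by (intro add_mono K yz Cauchy_Schwarz_ineq2)
      finally show ?thesis by (simp add: calA_diff[OF y zd] z algebra_simps)
    qed
    have "calA \<kappa> \<Omega> y \<in> closure (span (range \<phi>))" using calA_L2[OF y] by (simp add: phi_total)
    then obtain g where g: "\<And>n::nat. g n \<in> span (range \<phi>)" "g \<longlonglongrightarrow> calA \<kappa> \<Omega> y"
      unfolding closure_sequential by blast
    have "(\<lambda>n. (K + norm f) * norm (calA \<kappa> \<Omega> y - g n)) \<longlonglongrightarrow> (K + norm f) * norm (calA \<kappa> \<Omega> y - calA \<kappa> \<Omega> y)"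
      by (intro tendsto_intros g)
    then have "\<bar>\<eta> y - inner f (calA \<kappa> \<Omega> y)\<bar> \<le> (K + norm f) * norm (calA \<kappa> \<Omega> y - calA \<kappa> \<Omega> y)"
      by (rule LIMSEQ_le_const) (use small g in blast)
    then show ?thesis by simp
  qed
  then show ?thesis using f(1) by blast
qed

text \<open>Testing with \<open>\<phi> k\<close> determines every Fourier coefficient up to the
  nonzero factor \<open>\<rho> k\<close>, so the description in \<open>calA_inv\<close> has at most
  one solution.\<close>

lemma J_eqI:
  assumes "f \<in> L2 \<Omega>" "\<And>y. y \<in> dom_A0 \<Omega> \<Longrightarrow> inner f (calA \<kappa> \<Omega> y) = \<eta> y"
  shows "J \<eta> = f"
  unfolding calA_inv_def
proof (rule the_equality)
  fix g assume g: "g \<in> L2 \<Omega> \<and> (\<forall>y\<in>dom_A0 \<Omega>. inner g (calA \<kappa> \<Omega> y) = \<eta> y)"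
  have "g - f = 0"
  proof (rule L2_eq_0)
    show "g - f \<in> L2 \<Omega>" using g assms(1) by (simp add: real_vector.subspace_diff[OF subspace_L2])
    have "inner (g - f) (calA \<kappa> \<Omega> (\<phi> k)) = 0" for k
      using g assms(2) phi_dom by (simp add: inner_diff_left)
    then show "inner (g - f) (\<phi> k) = 0" for k
      by (simp add: calA_phi rho_nonzero)
  qed
  then show "g = f" by simp
qed (use assms in auto)

lemma J_X:
  assumes "\<eta> \<in> X"
  shows "J \<eta> \<in> L2 \<Omega>" "y \<in> dom_A0 \<Omega> \<Longrightarrow> inner (J \<eta>) (calA \<kappa> \<Omega> y) = \<eta> y"
proof -
  obtain f where "f \<in> L2 \<Omega>" "\<forall>y\<in>dom_A0 \<Omega>. inner f (calA \<kappa> \<Omega> y) = \<eta> y"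
    using X_representation[OF assms] by blast
  then show "J \<eta> \<in> L2 \<Omega>" "y \<in> dom_A0 \<Omega> \<Longrightarrow> inner (J \<eta>) (calA \<kappa> \<Omega> y) = \<eta> y"
    using J_eqI[of f \<eta>] by auto
qed

lemma J_linear:
  assumes "\<eta> \<in> X" "\<zeta> \<in> X"
  shows "J (s *\<^sub>R \<eta> + t *\<^sub>R \<zeta>) = s *\<^sub>R J \<eta> + t *\<^sub>R J \<zeta>"
  by (rule J_eqI)
     (use assms in \<open>auto simp: J_X fun_scaleR_apply inner_add_left
        intro!: real_vector.subspace_add real_vector.subspace_scale subspace_L2\<close>)

lemma J_scale: "\<eta> \<in> X \<Longrightarrow> J (s *\<^sub>R \<eta>) = s *\<^sub>R J \<eta>"
  using J_linear[of \<eta> \<eta> s 0] by simp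

lemma J_add: "\<eta> \<in> X \<Longrightarrow> \<zeta> \<in> X \<Longrightarrow> J (\<eta> + \<zeta>) = J \<eta> + J \<zeta>"
  using J_linear[of \<eta> \<zeta> 1 1] by simp

lemma J_diff: "\<eta> \<in> X \<Longrightarrow> \<zeta> \<in> X \<Longrightarrow> J (\<eta> - \<zeta>) = J \<eta> - J \<zeta>"
  using J_linear[of \<eta> \<zeta> 1 "-1"] by simp

lemma J_inj: "\<eta> \<in> X \<Longrightarrow> \<zeta> \<in> X \<Longrightarrow> J \<eta> = J \<zeta> \<Longrightarrow> \<eta> = \<zeta>"
proof (rule ext)
  fix y assume "\<eta> \<in> X" "\<zeta> \<in> X" "J \<eta> = J \<zeta>"
  then show "\<eta> y = \<zeta> y"
    using J_X(2)[of \<eta> y] J_X(2)[of \<zeta> y] X_D(1)[of \<eta> y] X_D(1)[of \<zeta> y]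
    by (cases "y \<in> dom_A0 \<Omega>") auto
qed

lemma J_0: "J 0 = 0"
  by (rule J_eqI) (auto simp: real_vector.subspace_0[OF subspace_L2])

text \<open>Brings integrals and limits computed in \<open>L2 \<Omega>\<close> back to
  functionals.\<close>

lemma J_surj:
  assumes "f \<in> L2 \<Omega>"
  shows "\<exists>\<eta>\<in>X. J \<eta> = f"
proof
  let ?e = "\<lambda>y. if y \<in> dom_A0 \<Omega> then inner f (calA \<kappa> \<Omega> y) else 0"
  show "?e \<in> X"
    by (rule X_I[where K = "norm f"])
       (auto simp: calA_linear inner_add_right dom_A0_comb Cauchy_Schwarz_ineq2)
  show "J ?e = f"
    by (rule J_eqI) (use assms in auto)
qed

lemma embed_X: "embed \<Omega> f \<in> X"
proof (rule X_I[where K = "norm f"])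
  fix y assume y: "y \<in> dom_A0 \<Omega>"
  have "\<bar>inner f y\<bar> \<le> norm f * norm y" by (rule Cauchy_Schwarz_ineq2)
  also have "\<dots> \<le> norm f * norm (calA \<kappa> \<Omega> y)"
    by (intro mult_left_mono calA_coercive y) simp
  finally show "\<bar>embed \<Omega> f y\<bar> \<le> norm f * norm (calA \<kappa> \<Omega> y)" using y by (simp add: embed_def)
qed (auto simp: embed_def inner_add_right dom_A0_comb)

text \<open>By symmetry of \<open>calA\<close>. Every z in the domain therefore occurs as the
  inverse image of an element of L2, which later allows the feedback term of \<open>A_cl\<close> to
  be evaluated at any such z.\<close>

lemma J_embed_calA: "z \<in> dom_A0 \<Omega> \<Longrightarrow> J (embed \<Omega> (calA \<kappa> \<Omega> z)) = z"
  by (rule J_eqI) (auto simp: embed_def calA_symmetric dom_A0_L2)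

lemma eta_phi: "\<eta> \<in> X \<Longrightarrow> \<eta> (\<phi> k) = \<rho> k * inner (J \<eta>) (\<phi> k)"
  using J_X(2)[OF _ phi_dom[of k], of \<eta>] by (simp add: calA_phi)

end

section \<open>The resolvent integral\<close>

lemma op_norm_bdd:
  fixes V :: "'v set" and n :: "'v \<Rightarrow> real" and m :: "'w \<Rightarrow> real" and T :: "'v \<Rightarrow> 'w"
  assumes "\<And>v. v \<in> V \<Longrightarrow> m (T v) \<le> K * n v" "\<And>v. v \<in> V \<Longrightarrow> n v \<ge> 0"
  shows "bdd_above {m (T v) | v. v \<in> V \<and> n v \<le> 1}"
proof (rule bdd_aboveI)
  fix r assume "r \<in> {m (T v) | v. v \<in> V \<and> n v \<le> 1}"
  then obtain v where v: "r = m (T v)" "v \<in> V" "n v \<le> 1" by blast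
  have "m (T v) \<le> K * n v" by (rule assms(1)[OF v(2)])
  also have "\<dots> \<le> \<bar>K\<bar> * 1"
    using assms(2)[OF v(2)] v(3) by (intro mult_mono) auto
  finally show "r \<le> \<bar>K\<bar>" using v(1) by simp
qed

lemma op_norm_nonneg:
  fixes V :: "'v set" and n :: "'v \<Rightarrow> real" and m :: "'w \<Rightarrow> real" and T :: "'v \<Rightarrow> 'w"
  assumes "\<And>v. v \<in> V \<Longrightarrow> m (T v) \<le> K * n v" "\<And>v. v \<in> V \<Longrightarrow> n v \<ge> 0"
    and "v \<in> V" "n v \<le> 1" "0 \<le> m (T v)"
  shows "0 \<le> op_norm V n m T"
  unfolding op_norm_def
  by (rule cSup_upper2[OF _ assms(5) op_norm_bdd[where V = V and n = n and m = m and T = T and K = K, OF assms(1,2)]]) (use assms(3,4) in auto)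

text \<open>The a priori bound K makes the supremum meaningful and settles vectors with n v = 0,
  which cannot be normalised. Scaling is passed as a function \<open>s\<close> because the lemma
  serves matrix vectors, elements of \<open>l2\<close> and functionals alike.\<close>

lemma op_norm_bound:
  fixes V :: "'v set" and n :: "'v \<Rightarrow> real" and m :: "'w \<Rightarrow> real" and T :: "'v \<Rightarrow> 'w"
  assumes K: "\<And>v. v \<in> V \<Longrightarrow> m (T v) \<le> K * n v" and n: "\<And>v. v \<in> V \<Longrightarrow> n v \<ge> 0"
    and s: "\<And>c v. c > 0 \<Longrightarrow> v \<in> V \<Longrightarrow> s c v \<in> V \<and> n (s c v) = c * n v \<and> m (T (s c v)) = c * m (T v)"
    and v: "v \<in> V"
  shows "m (T v) \<le> op_norm V n m T * n v"
proof (cases "n v = 0")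
  case True
  then show ?thesis using K[OF v] by simp
next
  case False
  then have c: "1 / n v > 0" using n[OF v] by simp
  have "m (T (s (1 / n v) v)) \<le> op_norm V n m T"
    unfolding op_norm_def 
    by (intro cSup_upper op_norm_bdd[where V = V and n = n and m = m and T = T, OF K n] CollectI
        exI[of _ "s (1 / n v) v"]) (use s[OF c v] c in auto)
  then show ?thesis using s[OF c v] c by (simp add: field_simps)
qed

lemma op_norm_le:
  assumes "v \<in> V" "n v \<le> 1" "\<And>v. v \<in> V \<Longrightarrow> n v \<le> 1 \<Longrightarrow> m (T v) \<le> K"
  shows "op_norm V n m T \<le> K"
  unfolding op_norm_def by (rule cSup_least) (use assms in auto)

context neumann
begin

lemma J_sum:
  assumes "\<And>i. i \<in> I \<Longrightarrow> f i \<in> X"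
  shows "(\<Sum>i\<in>I. c i *\<^sub>R f i) \<in> X" "J (\<Sum>i\<in>I. c i *\<^sub>R f i) = (\<Sum>i\<in>I. c i *\<^sub>R J (f i))"
proof -
  have X: "(\<Sum>i\<in>I. c i *\<^sub>R f i) \<in> X" if "\<And>i. i \<in> I \<Longrightarrow> f i \<in> X" for I
    by (intro real_vector.subspace_sum real_vector.subspace_scale subspace_X that)
  then show "(\<Sum>i\<in>I. c i *\<^sub>R f i) \<in> X" using assms by blast
  from assms show "J (\<Sum>i\<in>I. c i *\<^sub>R f i) = (\<Sum>i\<in>I. c i *\<^sub>R J (f i))"
  proof (induction I rule: infinite_finite_induct)
    case (insert i I)
    then show ?case
      using X[of I] real_vector.subspace_scale[OF subspace_X, of "f i" "c i"]
      by (simp add: J_add J_scale del: plus_fun_apply)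
  qed (simp_all add: J_0)
qed

text \<open>\<open>J\<close> is linear and turns \<open>X_norm\<close> into the norm of
  \<open>l2\<close>, so it carries Riemann sums to Riemann sums with the same error. Integration
  theory in the Banach space \<open>l2\<close> thereby becomes available.\<close>

lemma has_integral_on_X_iff:
  assumes f: "\<And>t. 0 \<le> t \<Longrightarrow> f t \<in> X"
  shows "has_integral_on X (X_norm \<kappa> \<Omega>) f I {0..T} \<longleftrightarrow>
    I \<in> X \<and> ((\<lambda>t. J (f t)) has_integral J I) {0..T}"
proof (cases "I \<in> X")
  case True
  have "X_norm \<kappa> \<Omega> ((\<Sum>(x, K)\<in>p. measure lborel K *\<^sub>R f x) - I)
      = norm ((\<Sum>(x, K)\<in>p. measure lborel K *\<^sub>R J (f x)) - J I)"
    if p: "p tagged_division_of {0..T}" for p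
  proof -
    have *: "f (fst i) \<in> X" if "i \<in> p" for i
      using tag_in_interval[OF p, of "fst i" "snd i"] that f by auto
    have "J ((\<Sum>i\<in>p. measure lborel (snd i) *\<^sub>R f (fst i)) - I)
       = (\<Sum>i\<in>p. measure lborel (snd i) *\<^sub>R J (f (fst i))) - J I"
      using J_sum[OF *, where I = p and c = "\<lambda>i. measure lborel (snd i)"] True by (simp add: J_diff)
    then show ?thesis by (simp add: X_norm_def case_prod_beta)
  qed
  then show ?thesis
    unfolding has_integral_on_def has_integral_real using True by (simp cong: conj_cong)
qed (simp add: has_integral_on_def)

end

section \<open>Integrating an exponentially stable semigroup\<close>

locale stable_semigroup = neumann +
  fixes S :: "real \<Rightarrow> (l2 \<Rightarrow> real) \<Rightarrow> (l2 \<Rightarrow> real)"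
  assumes semigroup: "C0_semigroup_on (X_space \<kappa> \<Omega>) (X_norm \<kappa> \<Omega>) S"
    and stable: "exp_stable_on (X_space \<kappa> \<Omega>) (X_norm \<kappa> \<Omega>) S"
begin

lemma S_X: "t \<ge> 0 \<Longrightarrow> \<eta> \<in> X \<Longrightarrow> S t \<eta> \<in> X"
  and S_linear: "t \<ge> 0 \<Longrightarrow> \<eta> \<in> X \<Longrightarrow> \<zeta> \<in> X \<Longrightarrow> S t (a *\<^sub>R \<eta> + b *\<^sub>R \<zeta>) = a *\<^sub>R S t \<eta> + b *\<^sub>R S t \<zeta>"
  and S_add: "s \<ge> 0 \<Longrightarrow> t \<ge> 0 \<Longrightarrow> \<eta> \<in> X \<Longrightarrow> S (s + t) \<eta> = S s (S t \<eta>)"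
  and S_right_0: "\<eta> \<in> X \<Longrightarrow> ((\<lambda>t. norm (J (S t \<eta> - \<eta>))) \<longlongrightarrow> 0) (at_right 0)"
  using semigroup unfolding C0_semigroup_on_def X_norm_def by blast+

lemma S_decay: "\<exists>K \<omega>. K \<ge> 0 \<and> \<omega> > 0 \<and> (\<forall>t\<ge>0. \<forall>\<eta>\<in>X. norm (J (S t \<eta>)) \<le> K * exp (- \<omega> * t) * norm (J \<eta>))"
proof -
  obtain K \<omega> where K: "\<omega> > 0" "\<And>t \<eta>. t \<ge> 0 \<Longrightarrow> \<eta> \<in> X \<Longrightarrow> norm (J (S t \<eta>)) \<le> K * exp (- \<omega> * t) * norm (J \<eta>)"
    using stable by (auto simp: exp_stable_on_def X_norm_def)
  have "norm (J (S t \<eta>)) \<le> \<bar>K\<bar> * exp (- \<omega> * t) * norm (J \<eta>)" if "t \<ge> 0" "\<eta> \<in> X" for t \<eta>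
    by (rule order_trans[OF K(2)[OF that]]) (intro mult_right_mono, auto)
  then show ?thesis using K(1) by (intro exI[of _ "\<bar>K\<bar>"] exI[of _ \<omega>]) auto
qed

text \<open>Strong continuity is assumed only at 0 from the right. The semigroup law and a bound
  uniform in time give an increment estimate \<open>step\<close> that depends on the time difference
  alone, hence continuity from the left as well.\<close>

lemma continuous_on_JS:
  assumes X: "\<eta> \<in> X"
  shows "continuous_on {0..} (\<lambda>t. J (S t \<eta>))"
proof -
  obtain K \<omega> where K: "K \<ge> 0" "\<omega> > 0" "\<And>t \<eta>. t \<ge> 0 \<Longrightarrow> \<eta> \<in> X \<Longrightarrow> norm (J (S t \<eta>)) \<le> K * exp (- \<omega> * t) * norm (J \<eta>)"
    using S_decay by blast
  have Kb: "norm (J (S t \<eta>)) \<le> K * norm (J \<eta>)" if "t \<ge> 0" "\<eta> \<in> X" for t \<eta>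
  proof -
    have "K * exp (- \<omega> * t) * norm (J \<eta>) \<le> K * 1 * norm (J \<eta>)"
      using K that by (intro mult_right_mono mult_left_mono) auto
    then show ?thesis using K(3)[OF that] by simp
  qed
  have step: "norm (J (S (s + h) \<eta>) - J (S s \<eta>)) \<le> K * norm (J (S h \<eta> - \<eta>))" if "s \<ge> 0" "h \<ge> 0" for s h
  proof -
    have h: "S h \<eta> \<in> X" "S h \<eta> - \<eta> \<in> X"
      using S_X[OF that(2) X] X by (auto intro: real_vector.subspace_diff[OF subspace_X])
    have "S (s + h) \<eta> - S s \<eta> = S s (S h \<eta> - \<eta>)"
      using S_linear[OF that(1) h(1) X, of 1 "-1"] S_add[OF that X] by simp
    then have "J (S (s + h) \<eta>) - J (S s \<eta>) = J (S s (S h \<eta> - \<eta>))"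
      using J_diff[OF S_X S_X, of "s + h" \<eta> s \<eta>] that X by simp
    then show ?thesis using Kb[OF that(1) h(2)] by simp
  qed
  show ?thesis
    unfolding continuous_on_iff
  proof (intro ballI allI impI)
    fix s e :: real assume s: "s \<in> {0..}" and e: "e > 0"
    have "((\<lambda>h. K * norm (J (S h \<eta> - \<eta>))) \<longlongrightarrow> K * 0) (at_right 0)"
      by (intro tendsto_intros S_right_0 X)
    then have "\<forall>\<^sub>F h in at_right 0. K * norm (J (S h \<eta> - \<eta>)) < e"
      using e by (intro order_tendstoD(2)) auto
    then obtain d where d: "d > 0" "\<And>h. 0 < h \<Longrightarrow> h < d \<Longrightarrow> K * norm (J (S h \<eta> - \<eta>)) < e"
      by (auto simp: eventually_at_right_field)
    have "dist (J (S t \<eta>)) (J (S s \<eta>)) < e" if t: "t \<in> {0..}" "dist t s < d" for t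
    proof -
      consider "t = s" | "t > s" | "t < s" by linarith
      then show ?thesis
      proof cases
        case 2
        then show ?thesis
          using step[of s "t - s"] d(2)[of "t - s"] s t by (simp add: dist_norm)
      next
        case 3
        then show ?thesis
          using step[of t "s - t"] d(2)[of "s - t"] s t by (simp add: dist_norm norm_minus_commute)
      qed (use e in simp)
    qed
    then show "\<exists>d>0. \<forall>t\<in>{0..}. dist t s < d \<longrightarrow> dist (J (S t \<eta>)) (J (S s \<eta>)) < e"
      using d(1) by blast
  qed
qed

definition JF :: "(l2 \<Rightarrow> real) \<Rightarrow> real \<Rightarrow> l2" where
  "JF \<eta> T = integral {0..T} (\<lambda>t. J (S t \<eta>))"

lemma JS_integrable: "\<eta> \<in> X \<Longrightarrow> a \<ge> 0 \<Longrightarrow> (\<lambda>t. J (S t \<eta>)) integrable_on {a..b}"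
  by (intro integrable_continuous_real continuous_on_subset[OF continuous_on_JS]) auto

text \<open>Riemann sums lie in the subspace, and the subspace is closed.\<close>

lemma integral_in_L2:
  assumes f: "(f has_integral I) {0..T::real}" and L2: "\<And>t. t \<in> {0..T} \<Longrightarrow> f t \<in> L2 \<Omega>"
  shows "I \<in> L2 \<Omega>"
proof -
  have "I \<in> closure (L2 \<Omega>)"
    unfolding closure_approachable
  proof (intro allI impI)
    fix e :: real assume "e > 0"
    then obtain \<gamma> where \<gamma>: "gauge \<gamma>" "\<forall>p. p tagged_division_of {0..T} \<and> \<gamma> fine p \<longrightarrow>
        norm ((\<Sum>(x, K)\<in>p. measure lborel K *\<^sub>R f x) - I) < e"
      using has_integral_real[THEN iffD1, OF f] by meson
    obtain p where p: "p tagged_division_of {0..T}" "\<gamma> fine p"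
      using fine_division_exists_real[OF \<gamma>(1)] by blast
    have "(\<Sum>i\<in>p. measure lborel (snd i) *\<^sub>R f (fst i)) \<in> L2 \<Omega>"
    proof (intro real_vector.subspace_sum real_vector.subspace_scale subspace_L2)
      fix i assume "i \<in> p"
      then show "f (fst i) \<in> L2 \<Omega>"
        using tag_in_interval[OF p(1), of "fst i" "snd i"] by (intro L2) auto
    qed
    then show "\<exists>y\<in>L2 \<Omega>. dist y I < e"
      using \<gamma>(2) p by (auto simp: dist_norm case_prod_beta)
  qed
  then show ?thesis by (simp add: closed_L2)
qed

lemma integral_exp_decay_bound:
  fixes \<omega> c a b :: real
  assumes "\<omega> > 0" "c \<ge> 0" "a \<le> b"
  shows "(\<lambda>t. c * exp (- \<omega> * t)) integrable_on {a..b}"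
    and "integral {a..b} (\<lambda>t. c * exp (- \<omega> * t)) \<le> c / \<omega> * exp (- \<omega> * a)"
proof -
  have i: "((\<lambda>t. c * exp (- \<omega> * t)) has_integral (- (c / \<omega> * exp (- \<omega> * b)) - - (c / \<omega> * exp (- \<omega> * a)))) {a..b}"
    using assms
    by (intro fundamental_theorem_of_calculus[of a b "\<lambda>t. - (c / \<omega> * exp (- \<omega> * t))"])
       (auto intro!: derivative_eq_intros simp: has_real_derivative_iff_has_vector_derivative[symmetric])
  then show "(\<lambda>t. c * exp (- \<omega> * t)) integrable_on {a..b}" by blast
  have "c / \<omega> * exp (- \<omega> * b) \<ge> 0" using assms by simp
  then show "integral {a..b} (\<lambda>t. c * exp (- \<omega> * t)) \<le> c / \<omega> * exp (- \<omega> * a)"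
    using integral_unique[OF i] by simp
qed

text \<open>One estimate with two uses: for large T it is the Cauchy criterion, and for T = 0 it
  bounds the integral operator. The constants are chosen before \<open>\<eta>\<close>, as the second
  use demands.\<close>

lemma JF_tail: "\<exists>C \<omega>. C \<ge> 0 \<and> \<omega> > 0 \<and> (\<forall>\<eta>\<in>X. \<forall>T\<ge>0. \<forall>T'\<ge>T. norm (JF \<eta> T' - JF \<eta> T) \<le> C * norm (J \<eta>) * exp (- \<omega> * T))"
proof -
  obtain K \<omega> where K: "K \<ge> 0" "\<omega> > 0" "\<And>t \<eta>. t \<ge> 0 \<Longrightarrow> \<eta> \<in> X \<Longrightarrow> norm (J (S t \<eta>)) \<le> K * exp (- \<omega> * t) * norm (J \<eta>)"
    using S_decay by blast
  have "norm (JF \<eta> T' - JF \<eta> T) \<le> K / \<omega> * norm (J \<eta>) * exp (- \<omega> * T)"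
    if X: "\<eta> \<in> X" and T: "0 \<le> T" "T \<le> T'" for \<eta> T T'
  proof -
    have c: "K * norm (J \<eta>) \<ge> 0" using K by simp
    have bd: "norm (J (S t \<eta>)) \<le> (K * norm (J \<eta>)) * exp (- \<omega> * t)" if "t \<ge> 0" for t
      using K(3)[OF that X] by (simp only: ac_simps)
    have "JF \<eta> T + integral {T..T'} (\<lambda>t. J (S t \<eta>)) = JF \<eta> T'"
      unfolding JF_def using T by (intro Henstock_Kurzweil_Integration.integral_combine JS_integrable X) auto
    then have "norm (JF \<eta> T' - JF \<eta> T) = norm (integral {T..T'} (\<lambda>t. J (S t \<eta>)))"
      by (metis add_diff_cancel_left')
    also have "\<dots> \<le> integral {T..T'} (\<lambda>t. (K * norm (J \<eta>)) * exp (- \<omega> * t))"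
      by (intro integral_norm_bound_integral JS_integrable X integral_exp_decay_bound K c T)
         (use bd T in auto)
    also have "\<dots> \<le> (K * norm (J \<eta>)) / \<omega> * exp (- \<omega> * T)"
      by (intro integral_exp_decay_bound K c T)
    finally show ?thesis by simp
  qed
  then show ?thesis using K by (intro exI[of _ "K / \<omega>"] exI[of _ \<omega>]) auto
qed

lemma JF_convergent:
  assumes X: "\<eta> \<in> X"
  shows "\<exists>I. (JF \<eta> \<longlongrightarrow> I) at_top"
proof -
  obtain C \<omega> where C: "C \<ge> 0" "\<omega> > 0" and tail: "\<And>\<eta> T T'. \<eta> \<in> X \<Longrightarrow> T \<ge> 0 \<Longrightarrow> T' \<ge> T \<Longrightarrow>
      norm (JF \<eta> T' - JF \<eta> T) \<le> C * norm (J \<eta>) * exp (- \<omega> * T)"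
    using JF_tail by blast
  let ?b = "\<lambda>T. C * norm (J \<eta>) * exp (- \<omega> * T)"
  have "filterlim (\<lambda>T. \<omega> * T) at_top at_top"
    using C by (intro filterlim_tendsto_pos_mult_at_top[OF tendsto_const] filterlim_ident)
  then have "((\<lambda>T. exp (- (\<omega> * T))) \<longlongrightarrow> 0) at_top"
    by (intro filterlim_compose[OF exp_at_bot] filterlim_uminus_at_bot_at_top[THEN filterlim_compose])
  then have b0: "(?b \<longlongrightarrow> 0) at_top"
    by (intro tendsto_mult_right_zero) simp
  have "Cauchy (\<lambda>n. JF \<eta> (real n))"
  proof (rule CauchyI')
    fix e :: real assume "e > 0"
    then have "\<forall>\<^sub>F T in at_top. ?b T < e" by (intro order_tendstoD(2)[OF b0])
    then obtain T0 where T0: "\<And>T. T \<ge> T0 \<Longrightarrow> ?b T < e" by (auto simp: eventually_at_top_linorder)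
    obtain N :: nat where N: "real N \<ge> T0" using real_arch_simple by blast
    show "\<exists>N. \<forall>m\<ge>N. \<forall>n>m. dist (JF \<eta> (real m)) (JF \<eta> (real n)) < e"
    proof (intro exI[of _ N] allI impI)
      fix m n assume "m \<ge> N" "n > m"
      then show "dist (JF \<eta> (real m)) (JF \<eta> (real n)) < e"
        using tail[OF X, of "real m" "real n"] T0[of "real m"] N
        by (simp add: dist_norm norm_minus_commute)
    qed
  qed
  then obtain I where I: "(\<lambda>n. JF \<eta> (real n)) \<longlonglongrightarrow> I"
    using Cauchy_convergent convergent_def by blast
  \<comment> \<open>The limit was found along the integers; letting the later endpoint run through
    them in the tail estimate extends it to all real T.\<close>
  have "norm (JF \<eta> T - I) \<le> ?b T" if "T \<ge> 0" for T
  proof -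
    have "(\<lambda>n. norm (JF \<eta> (real n) - JF \<eta> T)) \<longlonglongrightarrow> norm (I - JF \<eta> T)"
      by (intro tendsto_intros I)
    moreover obtain N :: nat where "real N \<ge> T" using real_arch_simple by blast
    then have "\<exists>N. \<forall>n\<ge>N. norm (JF \<eta> (real n) - JF \<eta> T) \<le> ?b T"
      using tail[OF X that] by (intro exI[of _ N]) auto
    ultimately have "norm (I - JF \<eta> T) \<le> ?b T" by (rule LIMSEQ_le_const2)
    then show ?thesis by (subst norm_minus_commute)
  qed
  then have "\<forall>\<^sub>F T in at_top. norm (JF \<eta> T - I) \<le> ?b T"
    using eventually_ge_at_top[of 0] by (rule eventually_mono[rotated])
  then have "((\<lambda>T. JF \<eta> T - I) \<longlongrightarrow> 0) at_top"
    using b0 by (rule Lim_null_comparison)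
  then show ?thesis using LIM_zero_cancel by blast
qed

abbreviation "R \<equiv> R_cl \<kappa> \<Omega> S"

text \<open>\<open>R_cl\<close> is a definite description over functionals. Existence is obtained by
  lifting the truncated integrals and their limit from L2 through \<open>J_surj\<close>, uniqueness
  from injectivity of \<open>J\<close>; the predicate \<open>P\<close> below is the one being
  described.\<close>

lemma R_cl_limit:
  assumes X: "\<eta> \<in> X"
  shows "R \<eta> \<in> X" "(JF \<eta> \<longlongrightarrow> J (R \<eta>)) at_top"
proof -
  have hi: "((\<lambda>t. J (S t \<eta>)) has_integral JF \<eta> T) {0..T}" for T
    unfolding JF_def by (intro integrable_integral JS_integrable X) simp
  have FL2: "JF \<eta> T \<in> L2 \<Omega>" for T
    by (rule integral_in_L2[OF hi]) (use J_X(1)[OF S_X[OF _ X]] in auto)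
  define F where "F T = (SOME \<zeta>. \<zeta> \<in> X \<and> J \<zeta> = JF \<eta> T)" for T
  have F: "F T \<in> X" "J (F T) = JF \<eta> T" for T
    using someI_ex[of "\<lambda>\<zeta>. \<zeta> \<in> X \<and> J \<zeta> = JF \<eta> T"] J_surj[OF FL2[of T]] unfolding F_def by blast+
  obtain I' where I': "(JF \<eta> \<longlongrightarrow> I') at_top" using JF_convergent[OF X] by blast
  have "I' \<in> L2 \<Omega>"
    by (rule Lim_in_closed_set[OF closed_L2 _ _ I']) (simp_all add: FL2)
  then obtain I where I: "I \<in> X" "J I = I'" using J_surj by blast
  define P where "P I \<longleftrightarrow> I \<in> X \<and> (\<exists>F. (\<forall>T\<ge>0. has_integral_on X (X_norm \<kappa> \<Omega>) (\<lambda>t. S t \<eta>) (F T) {0..T}) \<and>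
          ((\<lambda>T. X_norm \<kappa> \<Omega> (F T - I)) \<longlongrightarrow> 0) at_top)" for I
  have "P I"
  proof -
    have "((\<lambda>T. norm (JF \<eta> T - J I)) \<longlongrightarrow> norm (J I - J I)) at_top"
      by (intro tendsto_intros I'[folded I(2)])
    then have "((\<lambda>T. X_norm \<kappa> \<Omega> (F T - I)) \<longlongrightarrow> 0) at_top"
      by (simp add: X_norm_def J_diff F I)
    then show ?thesis
      unfolding P_def using hi by (auto intro!: exI[of _ F] simp: I F has_integral_on_X_iff[OF S_X[OF _ X]])
  qed
  \<comment> \<open>Whatever truncated integrals witness \<open>P L\<close>, uniqueness of the
    integral in \<open>l2\<close> identifies their images with \<open>JF \<eta>\<close>. This yields
    both uniqueness of L and the limit claimed at the end.\<close>
  moreover have lim: "(JF \<eta> \<longlongrightarrow> J L) at_top" if "P L" for L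
  proof -
    from that obtain G where L: "L \<in> X"
      and "\<And>T. T \<ge> 0 \<Longrightarrow> has_integral_on X (X_norm \<kappa> \<Omega>) (\<lambda>t. S t \<eta>) (G T) {0..T}"
        "((\<lambda>T. X_norm \<kappa> \<Omega> (G T - L)) \<longlongrightarrow> 0) at_top"
      unfolding P_def by blast
    then have G: "\<And>T. T \<ge> 0 \<Longrightarrow> G T \<in> X \<and> ((\<lambda>t. J (S t \<eta>)) has_integral J (G T)) {0..T}"
      "((\<lambda>T. X_norm \<kappa> \<Omega> (G T - L)) \<longlongrightarrow> 0) at_top"
      by (auto simp: has_integral_on_X_iff[OF S_X[OF _ X]])
    have "\<forall>\<^sub>F T in at_top. X_norm \<kappa> \<Omega> (G T - L) = norm (JF \<eta> T - J L)"
      using eventually_ge_at_top[of 0]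
    proof eventually_elim
      case (elim T)
      then have "J (G T) = JF \<eta> T" using G(1) hi has_integral_unique by blast
      then show ?case using G(1)[OF elim] L by (simp add: X_norm_def J_diff)
    qed
    then have "((\<lambda>T. norm (JF \<eta> T - J L)) \<longlongrightarrow> 0) at_top"
      using G(2) by (simp cong: tendsto_cong)
    then show ?thesis by (rule LIM_zero_cancel[OF tendsto_norm_zero_cancel])
  qed
  moreover have "L = L'" if "P L" "P L'" for L L'
    using tendsto_unique[OF _ lim[OF that(1)] lim[OF that(2)]] that by (auto simp: P_def intro: J_inj)
  ultimately have "P (THE L. P L)" by (metis theI)
  moreover have "R \<eta> = (THE L. P L)"
    by (simp add: R_cl_def improper_integral_on_def P_def)
  ultimately have "P (R \<eta>)" by simp
  then show "R \<eta> \<in> X" "(JF \<eta> \<longlongrightarrow> J (R \<eta>)) at_top"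
    using lim by (auto simp: P_def)
qed

lemma R_cl_linear:
  assumes "\<eta> \<in> X" "\<zeta> \<in> X"
  shows "R (a *\<^sub>R \<eta> + b *\<^sub>R \<zeta>) = a *\<^sub>R R \<eta> + b *\<^sub>R R \<zeta>"
proof -
  have comb: "s *\<^sub>R f + t *\<^sub>R g \<in> X" if "f \<in> X" "g \<in> X" for f g s t
    using that by (intro real_vector.subspace_add real_vector.subspace_scale subspace_X)
  have "JF (a *\<^sub>R \<eta> + b *\<^sub>R \<zeta>) T = a *\<^sub>R JF \<eta> T + b *\<^sub>R JF \<zeta> T" for T
  proof -
    have "((\<lambda>t. a *\<^sub>R J (S t \<eta>) + b *\<^sub>R J (S t \<zeta>)) has_integral a *\<^sub>R JF \<eta> T + b *\<^sub>R JF \<zeta> T) {0..T}"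
      unfolding JF_def by (intro has_integral_add has_integral_cmul integrable_integral JS_integrable assms) auto
    then have "((\<lambda>t. J (S t (a *\<^sub>R \<eta> + b *\<^sub>R \<zeta>))) has_integral a *\<^sub>R JF \<eta> T + b *\<^sub>R JF \<zeta> T) {0..T}"
      by (rule has_integral_eq[rotated]) (auto simp: S_linear assms J_linear S_X)
    then show ?thesis unfolding JF_def by blast
  qed
  then have "JF (a *\<^sub>R \<eta> + b *\<^sub>R \<zeta>) = (\<lambda>T. a *\<^sub>R JF \<eta> T + b *\<^sub>R JF \<zeta> T)" ..
  then have "(JF (a *\<^sub>R \<eta> + b *\<^sub>R \<zeta>) \<longlongrightarrow> a *\<^sub>R J (R \<eta>) + b *\<^sub>R J (R \<zeta>)) at_top"
    by (simp only:) (intro tendsto_intros R_cl_limit assms)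
  then have "J (R (a *\<^sub>R \<eta> + b *\<^sub>R \<zeta>)) = J (a *\<^sub>R R \<eta> + b *\<^sub>R R \<zeta>)"
    using tendsto_unique[OF _ R_cl_limit(2)[OF comb[OF assms]]]
    by (simp add: J_linear R_cl_limit(1) assms)
  then show ?thesis
    by (rule J_inj[rotated 2]) (intro comb R_cl_limit assms)+
qed

lemma R_cl_bounded: "\<exists>C\<ge>0. \<forall>\<eta>\<in>X. norm (J (R \<eta>)) \<le> C * norm (J \<eta>)"
proof -
  obtain C \<omega> where C: "C \<ge> 0" "\<omega> > 0" and tail: "\<And>\<eta> T T'. \<eta> \<in> X \<Longrightarrow> T \<ge> 0 \<Longrightarrow> T' \<ge> T \<Longrightarrow>
      norm (JF \<eta> T' - JF \<eta> T) \<le> C * norm (J \<eta>) * exp (- \<omega> * T)"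
    using JF_tail by blast
  have "norm (J (R \<eta>)) \<le> C * norm (J \<eta>)" if X: "\<eta> \<in> X" for \<eta>
  proof (rule tendsto_upperbound[OF tendsto_norm[OF R_cl_limit(2)[OF X]]])
    show "\<forall>\<^sub>F T in at_top. norm (JF \<eta> T) \<le> C * norm (J \<eta>)"
      using eventually_ge_at_top[of 0]
    proof eventually_elim
      case (elim T)
      have "JF \<eta> 0 = 0" by (simp add: JF_def)
      then show ?case using tail[OF X _ elim] by simp
    qed
  qed simp
  then show ?thesis using C by blast
qed

end

section \<open>Minimum-norm solutions and singular values\<close>

lemma scalar_prod_self_nonneg: "0 \<le> scalar_prod v (v :: real Matrix.vec)"
  by (simp add: scalar_prod_def sum_nonneg)

lemma scalar_prod_self_eq_0:
  assumes "v \<in> carrier_vec n" "scalar_prod v v = (0::real)"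
  shows "v = 0\<^sub>v n"
proof (rule eq_vecI)
  fix i assume "i < dim_vec (0\<^sub>v n)"
  then have i: "i < n" by simp
  have "(\<Sum>j\<in>{0..<n}. vec_index v j * vec_index v j) = 0"
    using assms by (simp add: scalar_prod_def)
  then have "vec_index v i * vec_index v i = 0"
    by (subst (asm) sum_nonneg_eq_0_iff) (use i in auto)
  then show "vec_index v i = vec_index (0\<^sub>v n) i" using i by simp
qed (use assms in simp)

text \<open>The vector v is orthogonal to every column. N independent columns form a basis, so v is
  a combination of vectors orthogonal to it, and its product with itself vanishes.\<close>

lemma full_row_rank_imp_transpose_inj:
  fixes C :: "real Matrix.mat"
  assumes C: "C \<in> carrier_mat N M" and rank: "vec_space.rank N C = N"
    and v: "v \<in> carrier_vec N" and z: "transpose_mat C *\<^sub>v v = 0\<^sub>v M"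
  shows "v = 0\<^sub>v N"
proof -
  interpret vec_space "TYPE(real)" N .
  have cols: "set (cols C) \<subseteq> carrier_vec N" using cols_dim C by blast
  obtain B where B: "maximal B (\<lambda>T. T \<subseteq> set (cols C) \<and> lin_indpt T)" "finite B"
    using maximal_exists_superset[of "set (cols C)" "\<lambda>T. T \<subseteq> set (cols C) \<and> lin_indpt T" "{}"]
    by (auto simp: lin_dep_def)
  have B': "B \<subseteq> set (cols C)" "lin_indpt B" using B(1) by (auto simp: maximal_def)
  have "card B = N" using rank_card_indpt[OF C B(1)] rank by simp
  then have "basis B"
    using B(2) B' cols by (intro dim_li_is_basis) (auto simp: dim_is_n)
  then have "v \<in> span B" using v by (simp add: basis_def)
  then obtain a where a: "v = lincomb a B"
    using finite_in_span[OF B(2)] B' cols by blast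
  have orth: "scalar_prod w v = 0" if "w \<in> B" for w
  proof -
    obtain j where j: "j < M" "w = col C j"
      using \<open>w \<in> B\<close> B'(1) C by (auto simp: cols_def)
    have "vec_index (transpose_mat C *\<^sub>v v) j = 0" using z j by simp
    then show ?thesis using j C by simp
  qed
  have "scalar_prod v v = (\<Sum>i\<in>{0..<N}. vec_index (lincomb a B) i * vec_index v i)"
    using v a by (simp add: scalar_prod_def)
  also have "\<dots> = (\<Sum>i\<in>{0..<N}. \<Sum>w\<in>B. a w * (vec_index w i * vec_index v i))"
    using B' cols by (intro sum.cong refl) (simp add: lincomb_index sum_distrib_right mult.assoc)
  also have "\<dots> = (\<Sum>w\<in>B. a w * scalar_prod w v)"
    using v by (subst sum.swap) (simp add: scalar_prod_def sum_distrib_left)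
  also have "\<dots> = 0" by (simp add: orth)
  finally show ?thesis by (rule scalar_prod_self_eq_0[OF v])
qed

text \<open>The quadratic form attains its minimum on the unit sphere by compactness. A minimiser is
  an eigenvector, since otherwise moving it along its residual would lower the Rayleigh
  quotient.\<close>

lemma rayleigh_minimum:
  fixes A :: "real Matrix.mat"
  assumes A: "A \<in> carrier_mat n n" and sym: "transpose_mat A = A" and n: "n > 0"
  shows "\<exists>m. eigenvalue A m \<and> (\<forall>w\<in>carrier_vec n. m * scalar_prod w w \<le> scalar_prod w (A *\<^sub>v w))"
proof -
  \<comment> \<open>The unit sphere inside a product of intervals, with the coordinates from n on
    pinned to 0: the product is compact, and the bounds -1 and 1 cut nothing off the sphere.\<close>
  define K :: "(nat \<Rightarrow> real) set" where
    "K = PiE UNIV (\<lambda>i. if i < n then {-1..1} else {0}) \<inter> {x. (\<Sum>i<n. (x i)\<^sup>2) = 1}"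
  define q where "q x = (\<Sum>i<n. \<Sum>j<n. x i * (A $$ (i, j) * x j))" for x :: "nat \<Rightarrow> real"
  have "compact (PiE UNIV (\<lambda>i. if i < n then {-1..1} else {0}) :: (nat \<Rightarrow> real) set)"
    unfolding compactin_euclidean_iff[symmetric] euclidean_product_topology[symmetric] compactin_PiE
    by (simp add: compactin_euclidean_iff)
  then have "compact K"
    unfolding K_def
    by (intro compact_Int_closed closed_Collect_eq continuous_intros continuous_on_product_coordinates)
  moreover have "K \<noteq> {}"
  proof -
    have "(\<lambda>i. if i = 0 then 1 else 0) \<in> K"
    proof -
      have "(\<Sum>i<n. ((if i = 0 then 1 else 0)::real)\<^sup>2) = (\<Sum>i<n. if i = 0 then 1 else 0)"
        by (rule sum.cong) auto
      also have "\<dots> = 1" using n by simp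
      finally show ?thesis using n by (auto simp: K_def PiE_iff)
    qed
    then show ?thesis by blast
  qed
  moreover have "continuous_on K q"
  proof -
    have "continuous_on UNIV q"
      unfolding q_def by (intro continuous_intros continuous_on_product_coordinates)
    then show ?thesis by (rule continuous_on_subset) simp
  qed
  ultimately obtain x where x: "x \<in> K" "\<And>y. y \<in> K \<Longrightarrow> q x \<le> q y"
    using continuous_attains_inf[of K q] by blast
  have q_vec: "scalar_prod w (A *\<^sub>v w) = q (\<lambda>i. if i < n then vec_index w i else 0)" if "w \<in> carrier_vec n" for w
    using that A by (simp add: q_def scalar_prod_def sum_distrib_left atLeast0LessThan)
  have min: "q x * scalar_prod w w \<le> scalar_prod w (A *\<^sub>v w)" if w: "w \<in> carrier_vec n" for w
  proof (cases "scalar_prod w w = 0")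
    case True
    then have "w = 0\<^sub>v n" using scalar_prod_self_eq_0[OF w] by simp
    then show ?thesis using A by simp
  next
    case False
    define s where "s = scalar_prod w w"
    have s: "s > 0" using False scalar_prod_self_nonneg[of w] by (simp add: s_def)
    define y where "y i = (if i < n then vec_index w i / sqrt s else 0)" for i
    have ww: "s = (\<Sum>i<n. (vec_index w i)\<^sup>2)"
      using w by (simp add: s_def scalar_prod_def atLeast0LessThan power2_eq_square)
    have "(\<Sum>i<n. (y i)\<^sup>2) = (\<Sum>i<n. (vec_index w i)\<^sup>2 / s)"
      using s by (simp add: y_def power_divide)
    also have "\<dots> = 1" using s by (simp add: ww flip: sum_divide_distrib)
    finally have y1: "(\<Sum>i<n. (y i)\<^sup>2) = 1" .
    have "\<bar>y i\<bar> \<le> 1" if "i < n" for i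
    proof -
      have "(y i)\<^sup>2 \<le> (\<Sum>i<n. (y i)\<^sup>2)" using that by (intro member_le_sum) auto
      then show ?thesis using y1 by (simp add: abs_square_le_1)
    qed
    then have "y i \<le> 1" "- 1 \<le> y i" if "i < n" for i
      using that by (auto simp: abs_le_iff minus_le_iff)
    moreover have "y i = 0" if "\<not> i < n" for i using that by (simp add: y_def)
    ultimately have "y \<in> K" using y1 by (simp add: K_def PiE_iff)
    then have "q x \<le> q y" by (rule x(2))
    also have "q y = scalar_prod w (A *\<^sub>v w) / s"
      using s by (simp add: q_vec[OF w] q_def y_def sum_divide_distrib)
    finally show ?thesis using s by (simp add: s_def[symmetric] field_simps)
  qed
  define v where "v = Matrix.vec n x"
  have v: "v \<in> carrier_vec n" by (simp add: v_def)
  have vv: "scalar_prod v v = 1"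
    using x(1) by (simp add: v_def K_def scalar_prod_def atLeast0LessThan power2_eq_square)
  have vAv: "scalar_prod v (A *\<^sub>v v) = q x"
    unfolding q_vec[OF v] by (simp add: q_def v_def)
  \<comment> \<open>The residual of the eigenvalue equation. In the direction r, minimality says 2ta
    + t^2 c \<ge> 0 for all t, and the linear coefficient a will turn out to be the squared length
    of r.\<close>
  define r where "r = A *\<^sub>v v - q x \<cdot>\<^sub>v v"
  have r: "r \<in> carrier_vec n" using A v by (simp add: r_def)
  have Av: "A *\<^sub>v v \<in> carrier_vec n" "A *\<^sub>v r \<in> carrier_vec n" using A v r by auto
  have cross: "scalar_prod v (A *\<^sub>v r) = scalar_prod r (A *\<^sub>v v)"
    using transpose_vec_mult_scalar[OF A r v] sym comm_scalar_prod[OF Av(1) r] by simp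
  define a where "a = scalar_prod r (A *\<^sub>v v) - q x * scalar_prod v r"
  define c where "c = scalar_prod r (A *\<^sub>v r) - q x * scalar_prod r r"
  have c: "c \<ge> 0" using min[OF r] by (simp add: c_def)
  have "2 * t * a + t\<^sup>2 * c \<ge> 0" for t
  proof -
    have tr: "t \<cdot>\<^sub>v r \<in> carrier_vec n" using r by simp
    have 1: "scalar_prod (v + t \<cdot>\<^sub>v r) (v + t \<cdot>\<^sub>v r) = 1 + 2 * t * scalar_prod v r + t\<^sup>2 * scalar_prod r r"
      using v r tr vv comm_scalar_prod[OF r v]
      by (simp add: add_scalar_prod_distrib[of _ n] scalar_prod_add_distrib[of _ n] power2_eq_square algebra_simps)
    have "A *\<^sub>v (v + t \<cdot>\<^sub>v r) = A *\<^sub>v v + t \<cdot>\<^sub>v (A *\<^sub>v r)"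
      using A v r by (simp add: mult_add_distrib_mat_vec[OF A] mult_mat_vec[OF A])
    then have 2: "scalar_prod (v + t \<cdot>\<^sub>v r) (A *\<^sub>v (v + t \<cdot>\<^sub>v r)) =
        q x + 2 * t * scalar_prod r (A *\<^sub>v v) + t\<^sup>2 * scalar_prod r (A *\<^sub>v r)"
      using v r tr Av vAv cross
      by (simp add: add_scalar_prod_distrib[of _ n] scalar_prod_add_distrib[of _ n] power2_eq_square algebra_simps)
    have "v + t \<cdot>\<^sub>v r \<in> carrier_vec n" using v tr by simp
    from min[OF this] show ?thesis
      unfolding 1 2 by (simp add: a_def c_def algebra_simps)
  qed
  note quadratic = this
  have "a = 0"
  proof (rule ccontr)
    assume "a \<noteq> 0"
    \<comment> \<open>For t = -as the quadratic is -a^2 s(2 - sc), which is negative as soon as s >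
      0 and sc \<le> 1; adding 1 in the denominator covers c = 0.\<close>
    define s where "s = 1 / (c + 1)"
    have s: "s > 0" "s * c \<le> 1" using c by (simp_all add: s_def)
    then have "a\<^sup>2 * (s * (2 - s * c)) > 0" using \<open>a \<noteq> 0\<close> by simp
    moreover have "0 \<le> - (a\<^sup>2 * (s * (2 - s * c)))"
      using quadratic[of "- a * s"] by (simp add: algebra_simps power2_eq_square)
    ultimately show False by linarith
  qed
  have "scalar_prod r r = a"
    using r v Av by (subst (2) r_def) (simp add: a_def scalar_prod_minus_distrib[of _ n] comm_scalar_prod[OF r v])
  then have "r = 0\<^sub>v n" using scalar_prod_self_eq_0[OF r] \<open>a = 0\<close> by simp
  have "A *\<^sub>v v = q x \<cdot>\<^sub>v v"
  proof (rule eq_vecI)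
    fix i assume "i < dim_vec (q x \<cdot>\<^sub>v v)"
    then have "i < n" using v by simp
    then have "vec_index r i = 0" using \<open>r = 0\<^sub>v n\<close> by simp
    then show "vec_index (A *\<^sub>v v) i = vec_index (q x \<cdot>\<^sub>v v) i"
      using \<open>i < n\<close> v A unfolding r_def by (subst (asm) index_minus_vec) auto
  qed (use A v in auto)
  moreover have "v \<noteq> 0\<^sub>v n" using vv by auto
  ultimately have "eigenvalue A (q x)"
    using A v by (auto simp: eigenvalue_def eigenvector_def)
  then show ?thesis using min by blast
qed

text \<open>Eigenvalues are roots of a nonzero polynomial. Finiteness gives the \<open>Min\<close>
  in \<open>sigma_min\<close> its meaning.\<close>

lemma finite_eigenvalues:
  fixes A :: "real Matrix.mat"
  assumes A: "A \<in> carrier_mat n n"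
  shows "finite {e. eigenvalue A e}"
proof -
  have "char_poly A \<noteq> 0" using degree_monic_char_poly[OF A] by auto
  then show ?thesis
    by (simp add: eigenvalue_root_char_poly[OF A] poly_roots_finite)
qed

section \<open>Matrices of full row rank and their least squares solutions\<close>

locale full_row_rank =
  fixes C :: "real Matrix.mat" and N M :: nat
  assumes C: "C \<in> carrier_mat N M" and rank: "vec_space.rank N C = N" and N: "N \<ge> 1"
begin

abbreviation "G \<equiv> C * transpose_mat C"

lemma G: "G \<in> carrier_mat N N"
  using C by simp

lemma G_mult: "w \<in> carrier_vec N \<Longrightarrow> G *\<^sub>v w = C *\<^sub>v (transpose_mat C *\<^sub>v w)"
  using C by (simp add: assoc_mult_mat_vec[of C N M "transpose_mat C" N])

lemma G_form: "w \<in> carrier_vec N \<Longrightarrow> v \<in> carrier_vec N \<Longrightarrow>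
    scalar_prod v (G *\<^sub>v w) = scalar_prod (transpose_mat C *\<^sub>v v) (transpose_mat C *\<^sub>v w)"
  using transpose_vec_mult_scalar[OF C, of "transpose_mat C *\<^sub>v w" v] C by (simp add: G_mult)

text \<open>Decides which of the two Gram matrices \<open>singular_values\<close> takes: it is
  \<open>C * transpose_mat C\<close>, also when the matrix is square.\<close>

lemma N_le_M: "N \<le> M"
  using vec_space.rank_le_nc[OF C] unfolding rank .

lemma G_pos:
  assumes w: "w \<in> carrier_vec N" "w \<noteq> 0\<^sub>v N"
  shows "scalar_prod w (G *\<^sub>v w) > 0"
proof -
  have c: "transpose_mat C *\<^sub>v w \<in> carrier_vec M" using C w by simp
  have "scalar_prod w (G *\<^sub>v w) \<noteq> 0"
    using full_row_rank_imp_transpose_inj[OF C rank w(1) scalar_prod_self_eq_0[OF c]] w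
    unfolding G_form[OF w(1) w(1)] by blast
  then show ?thesis using scalar_prod_self_nonneg[of "transpose_mat C *\<^sub>v w"] w by (simp add: G_form)
qed

lemma G_surj:
  assumes b: "b \<in> carrier_vec N"
  shows "\<exists>w\<in>carrier_vec N. G *\<^sub>v w = b"
proof -
  have "det G \<noteq> 0"
  proof
    assume "det G = 0"
    then obtain v where v: "v \<in> carrier_vec N" "v \<noteq> 0\<^sub>v N" "G *\<^sub>v v = 0\<^sub>v N"
      using det_0_iff_vec_prod_zero_field[OF G] by blast
    then show False using G_pos[of v] by simp
  qed
  then have "G \<in> Units (ring_mat TYPE(real) N ())" by (rule det_non_zero_imp_unit[OF G])
  then obtain H where H: "H \<in> carrier_mat N N" "G * H = 1\<^sub>m N"
    by (auto simp: Units_def ring_mat_def)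
  have "G *\<^sub>v (H *\<^sub>v b) = (G * H) *\<^sub>v b"
    using H b G by (intro assoc_mult_mat_vec[symmetric]) auto
  then have "G *\<^sub>v (H *\<^sub>v b) = b" using H b by simp
  moreover have "H *\<^sub>v b \<in> carrier_vec N" using H b by simp
  ultimately show ?thesis by blast
qed

lemma sigma_min:
  shows sigma_min_pos: "sigma_min C > 0"
    and sigma_min_bound: "\<And>w. w \<in> carrier_vec N \<Longrightarrow> (sigma_min C)\<^sup>2 * scalar_prod w w \<le> scalar_prod w (G *\<^sub>v w)"
proof -
  have sv: "singular_values C = sqrt ` {e. eigenvalue G e}"
    using C N_le_M by (auto simp: singular_values_def)
  have fin: "finite (singular_values C)" unfolding sv using finite_eigenvalues[OF G] by simp
  have "transpose_mat G = G"
    using C by (subst transpose_mult[of _ N M _ N]) auto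
  then obtain m where m: "eigenvalue G m" "\<And>w. w \<in> carrier_vec N \<Longrightarrow> m * scalar_prod w w \<le> scalar_prod w (G *\<^sub>v w)"
    using rayleigh_minimum[OF G] N by auto
  have pos: "e > 0" if "eigenvalue G e" for e
  proof -
    have dim: "dim_row G = N" using C by simp
    obtain v where "eigenvector G v e"
      using \<open>eigenvalue G e\<close> by (auto simp only: eigenvalue_def)
    then have v: "v \<in> carrier_vec N" "v \<noteq> 0\<^sub>v N" "G *\<^sub>v v = e \<cdot>\<^sub>v v"
      unfolding eigenvector_def dim by blast+
    have "e * scalar_prod v v > 0" using G_pos[OF v(1,2)] v by simp
    then show ?thesis using scalar_prod_self_nonneg[of v] by (simp add: zero_less_mult_iff)
  qed
  have ne: "singular_values C \<noteq> {}" using m(1) by (auto simp: sv)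
  show s: "sigma_min C > 0"
    unfolding sigma_min_def using fin ne pos by (subst Min_gr_iff) (auto simp: sv)
  fix w :: "real Matrix.vec" assume w: "w \<in> carrier_vec N"
  \<comment> \<open>Since m is itself an eigenvalue, its root is among the singular values; this one
    inequality transfers the Rayleigh bound from m to the square of
    \<open>sigma_min C\<close>.\<close>
  have "sigma_min C \<le> sqrt m"
    unfolding sigma_min_def by (rule Min_le[OF fin]) (use m(1) in \<open>auto simp: sv\<close>)
  then have "(sigma_min C)\<^sup>2 \<le> (sqrt m)\<^sup>2" using s by (intro power_mono) auto
  then have "(sigma_min C)\<^sup>2 \<le> m" using pos[OF m(1)] by simp
  then have "(sigma_min C)\<^sup>2 * scalar_prod w w \<le> m * scalar_prod w w"
    by (intro mult_right_mono scalar_prod_self_nonneg)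
  also have "\<dots> \<le> scalar_prod w (G *\<^sub>v w)" by (rule m(2)[OF w])
  finally show "(sigma_min C)\<^sup>2 * scalar_prod w w \<le> scalar_prod w (G *\<^sub>v w)" .
qed

text \<open>The Moore-Penrose solution, with the inverse of the Gram matrix replaced by the choice
  of a preimage. The choice has no effect because the Gram matrix is injective, which is what
  linearity rests on.\<close>

definition min_norm_solution :: "real Matrix.vec \<Rightarrow> real Matrix.vec" where
  "min_norm_solution b = transpose_mat C *\<^sub>v (SOME w. w \<in> carrier_vec N \<and> G *\<^sub>v w = b)"

lemma min_norm_solution_ex:
  assumes "b \<in> carrier_vec N"
  obtains w where "w \<in> carrier_vec N" "G *\<^sub>v w = b" "min_norm_solution b = transpose_mat C *\<^sub>v w"
  using someI_ex[of "\<lambda>w. w \<in> carrier_vec N \<and> G *\<^sub>v w = b"] G_surj[OF assms]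
  unfolding min_norm_solution_def by blast

lemma min_norm_solution_carrier: "b \<in> carrier_vec N \<Longrightarrow> min_norm_solution b \<in> carrier_vec M"
  using C by (metis min_norm_solution_ex mult_mat_vec_carrier transpose_carrier_mat)

lemma min_norm_solution_solves: "b \<in> carrier_vec N \<Longrightarrow> C *\<^sub>v min_norm_solution b = b"
  by (metis min_norm_solution_ex G_mult)

lemma min_norm_solution_eq:
  assumes "w \<in> carrier_vec N" "G *\<^sub>v w = b"
  shows "min_norm_solution b = transpose_mat C *\<^sub>v w"
proof -
  have b: "b \<in> carrier_vec N" using assms G by auto
  obtain w' where w': "w' \<in> carrier_vec N" "G *\<^sub>v w' = b" "min_norm_solution b = transpose_mat C *\<^sub>v w'"
    by (rule min_norm_solution_ex[OF b])
  have "G *\<^sub>v (w' - w) = 0\<^sub>v N"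
    using assms w' b by (simp add: mult_minus_distrib_mat_vec[OF G])
  then have "w' - w = 0\<^sub>v N" using G_pos[of "w' - w"] assms w' by fastforce
  then have "vec_index (w' - w) i = 0" if "i < N" for i using that by simp
  then have "w' = w"
    using assms w' by (intro eq_vecI) auto
  then show ?thesis using w' by simp
qed

text \<open>Pythagoras: the solution lies in the range of the transpose, hence is orthogonal to the
  kernel of C, where differences of solutions live. As an identity it yields both minimality and
  uniqueness of the minimiser.\<close>

lemma min_norm_solution_optimal:
  assumes b: "b \<in> carrier_vec N" and u: "u \<in> carrier_vec M" "C *\<^sub>v u = b"
  shows "scalar_prod u u = scalar_prod (min_norm_solution b) (min_norm_solution b)
    + scalar_prod (u - min_norm_solution b) (u - min_norm_solution b)"
proof -
  obtain w where w: "w \<in> carrier_vec N" "G *\<^sub>v w = b" "min_norm_solution b = transpose_mat C *\<^sub>v w"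
    by (rule min_norm_solution_ex[OF b])
  let ?m = "min_norm_solution b"
  have m: "?m \<in> carrier_vec M" by (rule min_norm_solution_carrier[OF b])
  have d: "u - ?m \<in> carrier_vec M" using u m by simp
  have "C *\<^sub>v (u - ?m) = 0\<^sub>v N"
    using u m b by (simp add: mult_minus_distrib_mat_vec[OF C] min_norm_solution_solves)
  then have "scalar_prod ?m (u - ?m) = 0"
    using transpose_vec_mult_scalar[OF C d w(1)] w by simp
  then have o: "scalar_prod ?m u = scalar_prod ?m ?m"
    using m u by (simp add: scalar_prod_minus_distrib[of _ M])
  then have "scalar_prod (u - ?m) (u - ?m) = scalar_prod u u - scalar_prod ?m ?m"
    using m u d comm_scalar_prod[OF u(1) m]
    by (simp add: scalar_prod_minus_distrib[of _ M] minus_scalar_prod_distrib[of _ M])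
  then show ?thesis by simp
qed

text \<open>For u = C^T w one has |u|^2 = w.b \<le> |w| |b|, while the Rayleigh bound gives sigma
  |w| \<le> |u|. Combining them, sigma |u|^2 \<le> |u| |b|, and one factor |u| cancels.\<close>

lemma min_norm_solution_bound:
  assumes b: "b \<in> carrier_vec N"
  shows "euclid_norm (min_norm_solution b) \<le> euclid_norm b / sigma_min C"
proof -
  obtain w where w: "w \<in> carrier_vec N" "G *\<^sub>v w = b" "min_norm_solution b = transpose_mat C *\<^sub>v w"
    by (rule min_norm_solution_ex[OF b])
  let ?u = "sqrt (scalar_prod (min_norm_solution b) (min_norm_solution b))"
    and ?w = "sqrt (scalar_prod w w)" and ?b = "sqrt (scalar_prod b b)" and ?s = "sigma_min C"
  have uu: "scalar_prod (min_norm_solution b) (min_norm_solution b) = scalar_prod w b"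
    using G_form[of w w] w by simp
  have "(scalar_prod w b)\<^sup>2 \<le> scalar_prod w w * scalar_prod b b"
    using w(1) b Cauchy_Schwarz_ineq_sum[of "vec_index w" "vec_index b" "{0..<N}"]
    by (simp add: scalar_prod_def power2_eq_square)
  then have "scalar_prod w b \<le> ?w * ?b"
    by (metis real_le_rsqrt real_sqrt_mult)
  moreover have u2: "?u\<^sup>2 = scalar_prod w b"
    using uu real_sqrt_pow2[OF scalar_prod_self_nonneg] by metis
  moreover have w2: "?w\<^sup>2 = scalar_prod w w"
    by (rule real_sqrt_pow2[OF scalar_prod_self_nonneg])
  ultimately have 1: "?u\<^sup>2 \<le> ?w * ?b" by simp
  have "?s\<^sup>2 * scalar_prod w w \<le> scalar_prod w b" using sigma_min_bound[OF w(1)] w by simp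
  then have "(?s * ?w)\<^sup>2 \<le> ?u\<^sup>2"
    by (simp only: power_mult_distrib u2 w2)
  then have 2: "?s * ?w \<le> ?u" by (rule power2_le_imp_le) (simp add: scalar_prod_self_nonneg)
  have s: "?s > 0" by (rule sigma_min_pos)
  have "?s * ?u * ?u \<le> ?s * ?w * ?b" using 1 s by (simp add: power2_eq_square)
  also have "\<dots> \<le> ?u * ?b" using 2 by (intro mult_right_mono) (simp_all add: scalar_prod_self_nonneg)
  finally have "?s * ?u * ?u \<le> ?b * ?u" by (simp add: mult.commute)
  moreover have "?u \<ge> 0" "?b \<ge> 0" by (simp_all add: scalar_prod_self_nonneg)
  ultimately have "?s * ?u \<le> ?b"
    by (cases "?u = 0") (auto simp: mult_le_cancel_right)
  then show ?thesis using s by (simp add: euclid_norm_def field_simps)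
qed

lemma min_norm_solution_linear:
  assumes b: "b \<in> carrier_vec N" "d \<in> carrier_vec N"
  shows "min_norm_solution (s \<cdot>\<^sub>v b + t \<cdot>\<^sub>v d) = s \<cdot>\<^sub>v min_norm_solution b + t \<cdot>\<^sub>v min_norm_solution d"
proof -
  obtain w where w: "w \<in> carrier_vec N" "G *\<^sub>v w = b" "min_norm_solution b = transpose_mat C *\<^sub>v w"
    by (rule min_norm_solution_ex[OF b(1)])
  obtain z where z: "z \<in> carrier_vec N" "G *\<^sub>v z = d" "min_norm_solution d = transpose_mat C *\<^sub>v z"
    by (rule min_norm_solution_ex[OF b(2)])
  have CT: "transpose_mat C \<in> carrier_mat M N" using C by simp
  have "G *\<^sub>v (s \<cdot>\<^sub>v w + t \<cdot>\<^sub>v z) = s \<cdot>\<^sub>v b + t \<cdot>\<^sub>v d"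
    using w z by (simp add: mult_add_distrib_mat_vec[OF G] mult_mat_vec[OF G])
  then have "min_norm_solution (s \<cdot>\<^sub>v b + t \<cdot>\<^sub>v d) = transpose_mat C *\<^sub>v (s \<cdot>\<^sub>v w + t \<cdot>\<^sub>v z)"
    using w z by (intro min_norm_solution_eq) auto
  then show ?thesis
    using w z by (simp add: mult_add_distrib_mat_vec[OF CT] mult_mat_vec[OF CT])
qed

end

section \<open>Observation points and the closed loop\<close>

lemma sum_fun_apply: "sum f A x = (\<Sum>i\<in>A. f i x)" for f :: "'a \<Rightarrow> 'b \<Rightarrow> 'c::comm_monoid_add"
  by (induction A rule: infinite_finite_induct) auto

text \<open>A Gram-Schmidt step. The vector u is generalised in the induction because the hypothesis
  is applied twice, to u and to the new vector a.\<close>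

lemma orthogonal_decomposition_finite:
  fixes W :: "(nat \<Rightarrow> real) set"
  assumes "finite W"
  shows "\<exists>s\<in>span W. \<forall>w\<in>W. (\<Sum>j<M. (u j - s j) * w j) = 0"
  using assms
proof (induction W arbitrary: u rule: finite_induct)
  case empty
  show ?case using real_vector.span_zero by blast
next
  case (insert a W)
  define ip where "ip f g = (\<Sum>j<M. f j * g j)" for f g :: "nat \<Rightarrow> real"
  have ip_add: "ip (f + g) h = ip f h + ip g h" and ip_diff: "ip (f - g) h = ip f h - ip g h"
    and ip_scale: "ip (c *\<^sub>R f) h = c * ip f h" and ip_comm: "ip f h = ip h f" for f g h c
    by (simp_all add: ip_def algebra_simps sum.distrib sum_subtractf sum_distrib_left fun_scaleR_apply)
  obtain sa where sa: "sa \<in> span W" "\<And>w. w \<in> W \<Longrightarrow> ip (a - sa) w = 0"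
    using insert.IH[of a] by (auto simp: ip_def)
  obtain su where su: "su \<in> span W" "\<And>w. w \<in> W \<Longrightarrow> ip (u - su) w = 0"
    using insert.IH[of u] by (auto simp: ip_def)
  have orth: "ip f s = 0" if "s \<in> span W" "\<And>w. w \<in> W \<Longrightarrow> ip f w = 0" for f s
    using that(1)
  proof (induction rule: real_vector.span_induct_alt)
    case base
    show ?case by (simp add: ip_def)
  next
    case (step c x y)
    then show ?case using that(2)[of x] ip_add[of "c *\<^sub>R x" y f] by (simp add: ip_comm[of f] ip_scale del: plus_fun_apply)
  qed
  define a' where "a' = a - sa"
  have mono: "span W \<subseteq> span (insert a W)" by (rule real_vector.span_mono) blast
  have a'_span: "a' \<in> span (insert a W)"
    unfolding a'_def
    by (rule real_vector.span_diff[OF real_vector.span_base[OF insertI1] subsetD[OF mono sa(1)]])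
  define c where "c = ip u a' / ip a' a'"
  \<comment> \<open>The form looks only at coordinates below M and may vanish on a nonzero a'. In
    that case a' is 0 in all these coordinates, so both sides are 0 whatever value the division
    produces.\<close>
  have ca: "c * ip a' a' = ip u a'"
  proof (cases "ip a' a' = 0")
    case True
    then have "a' j = 0" if "j < M" for j
      using that sum_nonneg_eq_0_iff[of "{..<M}" "\<lambda>j. a' j * a' j"] by (simp add: ip_def)
    then have "ip u a' = 0" by (simp add: ip_def)
    then show ?thesis using True by simp
  qed (simp add: c_def)
  have "ip (u - (su + c *\<^sub>R a')) w = 0" if "w \<in> insert a W" for w
  proof -
    have W0: "ip (u - (su + c *\<^sub>R a')) w = 0" if "w \<in> W" for w
      using su(2)[OF that] sa(2)[OF that] by (simp only: ip_diff ip_add ip_scale a'_def)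
    have "ip (u - (su + c *\<^sub>R a')) a' = 0"
      using ca orth[OF su(1), of a'] sa(2) by (simp add: ip_diff ip_add ip_scale ip_comm[of su] a'_def[symmetric])
    moreover have "ip (u - (su + c *\<^sub>R a')) sa = 0"
      by (rule orth[OF sa(1) W0])
    moreover have "ip f a = ip f a' + ip f sa" for f
      unfolding a'_def ip_diff ip_comm[of f] by simp
    ultimately have "ip (u - (su + c *\<^sub>R a')) a = 0" by simp
    then show ?thesis using W0 that by blast
  qed
  moreover have "su + c *\<^sub>R a' \<in> span (insert a W)"
    using su(1) mono a'_span by (intro real_vector.span_add real_vector.span_scale) auto
  ultimately show ?case
    by (intro bexI[of _ "su + c *\<^sub>R a'"]) (auto simp: ip_def)
qed

text \<open>W may be infinite, but it lives in the span of M unit vectors, so a maximal independent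
  subset is finite. Orthogonality to that subset extends to its span, which contains W.\<close>

lemma orthogonal_decomposition:
  fixes W :: "(nat \<Rightarrow> real) set"
  assumes W: "\<And>w j. w \<in> W \<Longrightarrow> j \<ge> M \<Longrightarrow> w j = 0"
  shows "\<exists>s\<in>span W. \<forall>w\<in>W. (\<Sum>j<M. (u j - s j) * w j) = 0"
proof -
  obtain B where B: "B \<subseteq> W" "independent B" "W \<subseteq> span B"
    by (rule real_vector.maximal_independent_subset)
  define e where "e j = (\<lambda>i. if i = j then 1 else 0 :: real)" for j :: nat
  have "w \<in> span (e ` {..<M})" if "w \<in> W" for w
  proof -
    have "w = (\<Sum>j<M. w j *\<^sub>R e j)"
    proof
      fix i
      have "(\<Sum>j<M. w j * e j i) = (\<Sum>j<M. if j = i then w j else 0)"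
        by (rule sum.cong) (auto simp: e_def)
      then show "w i = (\<Sum>j<M. w j *\<^sub>R e j) i"
        using W[OF that, of i] by (simp add: sum_fun_apply fun_scaleR_apply)
    qed
    also have "\<dots> \<in> span (e ` {..<M})"
      by (intro real_vector.span_sum real_vector.span_scale real_vector.span_base) auto
    finally show ?thesis .
  qed
  then have "finite B"
    using real_vector.independent_span_bound[of "e ` {..<M}" B] B by blast
  then obtain s where s: "s \<in> span B" "\<And>w. w \<in> B \<Longrightarrow> (\<Sum>j<M. (u j - s j) * w j) = 0"
    using orthogonal_decomposition_finite[OF \<open>finite B\<close>, of u M] by auto
  have "(\<Sum>j<M. (u j - s j) * w j) = 0" if "w \<in> span B" for w
    using that
  proof (induction rule: real_vector.span_induct_alt)
    case (step c x y)
    have "(\<Sum>j<M. (u j - s j) * (c *\<^sub>R x + y) j) =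
        (\<Sum>j<M. c * ((u j - s j) * x j) + (u j - s j) * y j)"
      by (rule sum.cong[OF refl]) (simp only: plus_fun_apply fun_scaleR_apply real_scaleR_def distrib_left mult.left_commute[of _ c])
    also have "\<dots> = c * (\<Sum>j<M. (u j - s j) * x j) + (\<Sum>j<M. (u j - s j) * y j)"
      by (simp only: sum.distrib sum_distrib_left)
    also have "\<dots> = 0" using s(2)[OF step(1)] step(2) by simp
    finally show ?case .
  qed simp
  then show ?thesis
    using B s(1) real_vector.span_mono[OF B(1)] by blast
qed

lemma euclid_norm_carrier: "u \<in> carrier_vec M \<Longrightarrow> euclid_norm u = sqrt (\<Sum>j<M. (vec_index u j)\<^sup>2)"
  by (simp add: euclid_norm_def scalar_prod_def atLeast0LessThan power2_eq_square)

lemma euclid_norm_nonneg: "euclid_norm u \<ge> 0"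
  by (simp add: euclid_norm_def scalar_prod_self_nonneg)

lemma euclid_norm_smult: "u \<in> carrier_vec M \<Longrightarrow> euclid_norm (c \<cdot>\<^sub>v u) = \<bar>c\<bar> * euclid_norm u"
  by (simp add: euclid_norm_carrier[of _ M] power_mult_distrib real_sqrt_mult flip: sum_distrib_left)

lemma smult_add_zero_smult:
  fixes u v :: "real Matrix.vec"
  shows "u \<in> carrier_vec M \<Longrightarrow> v \<in> carrier_vec M \<Longrightarrow> c \<cdot>\<^sub>v u + 0 \<cdot>\<^sub>v v = c \<cdot>\<^sub>v u"
  by (intro eq_vecI) auto

lemma abs_vec_index_le_euclid_norm:
  assumes "u \<in> carrier_vec M" "j < M"
  shows "\<bar>vec_index u j\<bar> \<le> euclid_norm u"
proof -
  have "(vec_index u j)\<^sup>2 \<le> (\<Sum>j<M. (vec_index u j)\<^sup>2)"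
    using assms(2) by (intro member_le_sum) auto
  then show ?thesis
    unfolding euclid_norm_carrier[OF assms(1)] by (metis real_sqrt_abs real_sqrt_le_mono)
qed

lemma PN_linear: "PN \<phi> N (a *\<^sub>R \<eta> + b *\<^sub>R \<zeta>) = a *\<^sub>R PN \<phi> N \<eta> + b *\<^sub>R PN \<phi> N \<zeta>"
  by (simp add: PN_def fun_scaleR_apply scaleR_add_left sum.distrib scaleR_sum_right)

lemma embed_linear: "embed \<Omega> (a *\<^sub>R f + b *\<^sub>R g) = a *\<^sub>R embed \<Omega> f + b *\<^sub>R embed \<Omega> g"
  by (auto simp: embed_def fun_scaleR_apply inner_add_left)

lemma QN_linear: "QN \<Omega> \<phi> N (a *\<^sub>R \<eta> + b *\<^sub>R \<zeta>) = a *\<^sub>R QN \<Omega> \<phi> N \<eta> + b *\<^sub>R QN \<Omega> \<phi> N \<zeta>"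
  by (simp only: QN_def PN_linear embed_linear scaleR_diff_right) simp

lemma B_op_apply: "y \<in> dom_A0 \<Omega> \<Longrightarrow> B_op \<Omega> M x u y = (\<Sum>j<M. vec_index u j * pt_value \<Omega> y (x j))"
  by (simp add: B_op_def delta_def fun_scaleR_apply sum_fun_apply)

lemma B_op_linear:
  assumes "u \<in> carrier_vec M" "v \<in> carrier_vec M"
  shows "B_op \<Omega> M x (a \<cdot>\<^sub>v u + b \<cdot>\<^sub>v v) = a *\<^sub>R B_op \<Omega> M x u + b *\<^sub>R B_op \<Omega> M x v"
  using assms by (simp add: B_op_def scaleR_add_left sum.distrib scaleR_sum_right del: plus_fun_apply)

section \<open>Spectral projections and the data of the cancellation system\<close>

context neumann
begin

lemma XN_expansion:
  assumes "y \<in> XN \<phi> N"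
  shows "y = (\<Sum>k<N. inner y (\<phi> k) *\<^sub>R \<phi> k)"
  using assms unfolding XN_def
proof (induction rule: real_vector.span_induct_alt)
  case (step c z y)
  then obtain i where i: "i < N" "z = \<phi> i" by auto
  have "(\<Sum>k<N. inner (\<phi> i) (\<phi> k) *\<^sub>R \<phi> k) = (\<Sum>k<N. if k = i then \<phi> k else 0)"
    by (rule sum.cong) (auto simp: phi_orthonormal)
  then have "(\<Sum>k<N. inner (c *\<^sub>R z + y) (\<phi> k) *\<^sub>R \<phi> k) = c *\<^sub>R \<phi> i + (\<Sum>k<N. inner y (\<phi> k) *\<^sub>R \<phi> k)"
    using i by (simp add: inner_add_left scaleR_add_left sum.distrib flip: scaleR_scaleR scaleR_sum_right)
  then show ?case using step i by simp
qed simp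

lemma XN_dom: "y \<in> XN \<phi> N \<Longrightarrow> y \<in> dom_A0 \<Omega>"
  using span_phi_dom real_vector.span_mono[of "\<phi> ` {..<N}" "range \<phi>"] unfolding XN_def by blast

lemma PN_in_XN: "PN \<phi> N \<eta> \<in> XN \<phi> N"
  unfolding PN_def XN_def
  by (intro real_vector.span_sum real_vector.span_scale real_vector.span_base) auto

lemma PN_coefficient: "inner (PN \<phi> N \<eta>) (\<phi> k) = (if k < N then \<eta> (\<phi> k) else 0)"
  by (simp add: PN_def inner_sum_left phi_orthonormal if_distrib cong: if_cong)

lemma embed_coefficient: "inner (J (embed \<Omega> y)) (\<phi> k) = inner y (\<phi> k) / \<rho> k"
  using eta_phi[OF embed_X, of y k] phi_dom[of k] rho_nonzero[of k] by (simp add: embed_def field_simps)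

lemma bessel: "(\<Sum>k<N. (inner f (\<phi> k))\<^sup>2) \<le> (norm f)\<^sup>2"
proof -
  let ?p = "\<Sum>k<N. inner f (\<phi> k) *\<^sub>R \<phi> k"
  have "inner f ?p = (\<Sum>k<N. (inner f (\<phi> k))\<^sup>2)"
    by (simp add: inner_sum_right power2_eq_square)
  moreover have "inner ?p ?p = (\<Sum>k<N. (inner f (\<phi> k))\<^sup>2)"
    using norm_sum_phi[of "{..<N}" "\<lambda>k. inner f (\<phi> k)"] by (simp add: power2_norm_eq_inner)
  moreover have "0 \<le> inner (f - ?p) (f - ?p)" by simp
  ultimately show ?thesis
    by (simp add: inner_diff_left inner_diff_right inner_commute[of ?p f] power2_norm_eq_inner)
qed

lemma X_norm_scale: "\<eta> \<in> X \<Longrightarrow> X_norm \<kappa> \<Omega> (c *\<^sub>R \<eta>) = \<bar>c\<bar> * X_norm \<kappa> \<Omega> \<eta>"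
  by (simp add: X_norm_def J_scale)

text \<open>\<open>J\<close> divides the k-th coefficient by \<open>\<rho> k\<close> before as well
  as after the projection, so it turns the spectral projector into the orthogonal projection of L2,
  to which Bessel's inequality applies.\<close>

lemma X_norm_embed_PN:
  assumes "\<eta> \<in> X"
  shows "X_norm \<kappa> \<Omega> (embed \<Omega> (PN \<phi> N \<eta>)) \<le> X_norm \<kappa> \<Omega> \<eta>"
proof -
  let ?p = "\<Sum>k<N. inner (J \<eta>) (\<phi> k) *\<^sub>R \<phi> k"
  have "J (embed \<Omega> (PN \<phi> N \<eta>)) - ?p = 0"
  proof (rule L2_eq_0)
    show "J (embed \<Omega> (PN \<phi> N \<eta>)) - ?p \<in> L2 \<Omega>"
      by (intro real_vector.subspace_diff real_vector.subspace_sum real_vector.subspace_scale subspace_L2 phi_L2 J_X embed_X)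
    show "inner (J (embed \<Omega> (PN \<phi> N \<eta>)) - ?p) (\<phi> k) = 0" for k
      by (simp add: inner_diff_left embed_coefficient PN_coefficient eta_phi[OF assms] rho_nonzero
          inner_sum_left phi_orthonormal if_distrib cong: if_cong)
  qed
  then have "(norm (J (embed \<Omega> (PN \<phi> N \<eta>))))\<^sup>2 = (\<Sum>k<N. (inner (J \<eta>) (\<phi> k))\<^sup>2)"
    by (simp add: norm_sum_phi)
  also have "\<dots> \<le> (norm (J \<eta>))\<^sup>2" by (rule bessel)
  finally show ?thesis unfolding X_norm_def by (rule power2_le_imp_le) simp
qed

lemma XN_norm_nonneg: "XN_norm \<kappa> \<Omega> y \<ge> 0"
  by (simp add: XN_norm_def X_norm_def)

lemma XN_norm_scale: "XN_norm \<kappa> \<Omega> (c *\<^sub>R y) = \<bar>c\<bar> * XN_norm \<kappa> \<Omega> y"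
  using embed_linear[of \<Omega> c y 0 0] by (simp add: XN_norm_def X_norm_scale embed_X)

lemma XN_norm_eq_0:
  assumes "y \<in> XN \<phi> N" "XN_norm \<kappa> \<Omega> y = 0"
  shows "y = 0"
proof -
  have "inner y (\<phi> k) = 0" for k
    using embed_coefficient[of y k] assms(2) rho_nonzero[of k] by (simp add: XN_norm_def X_norm_def)
  then show ?thesis using XN_expansion[OF assms(1)] by simp
qed

definition rhs :: "nat \<Rightarrow> l2 \<Rightarrow> real Matrix.vec" where
  "rhs N y = Matrix.vec N (\<lambda>k. - inner (A0 \<kappa> \<Omega> y) (\<phi> k))"

text \<open>Indices start at 0, so the modes in play are those below N and \<open>\<mu> N\<close>
  dominates their eigenvalues by monotonicity. The summand 1 keeps the constant positive even when
  \<open>\<mu> N\<close> is 0.\<close>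

definition C\<^sub>0 :: "nat \<Rightarrow> real" where "C\<^sub>0 N = \<kappa> * \<mu> N * \<rho> N + 1"

lemma C0_pos: "C\<^sub>0 N > 0"
  using mu_nonneg[of N] kappa_pos rho_pos[of N] by (simp add: C\<^sub>0_def add_nonneg_pos)

text \<open>\<open>A0\<close> contributes \<open>- \<kappa> * \<mu> k\<close>, and expressing y
  through its image under \<open>J\<close>, whose norm is the one used on \<open>XN\<close>,
  contributes \<open>\<rho> k\<close>.\<close>

lemma A0_coefficient:
  assumes "y \<in> dom_A0 \<Omega>"
  shows "inner (A0 \<kappa> \<Omega> y) (\<phi> k) = - \<kappa> * \<mu> k * \<rho> k * inner (J (embed \<Omega> y)) (\<phi> k)"
proof -
  have "inner (calA \<kappa> \<Omega> y) (\<phi> k) = \<rho> k * inner y (\<phi> k)"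
    using calA_symmetric[OF assms phi_dom, of k] by (simp add: calA_phi)
  then have "inner (A0 \<kappa> \<Omega> y) (\<phi> k) = (1 - \<rho> k) * inner y (\<phi> k)"
    by (simp add: calA_def inner_diff_left algebra_simps)
  moreover have "inner y (\<phi> k) = \<rho> k * inner (J (embed \<Omega> y)) (\<phi> k)"
    by (simp add: embed_coefficient rho_nonzero)
  moreover have "1 - \<rho> k = - \<kappa> * \<mu> k" by (simp add: \<rho>_def)
  ultimately show ?thesis by simp
qed

lemma euclid_norm_rhs:
  assumes "y \<in> XN \<phi> N"
  shows "euclid_norm (rhs N y) \<le> C\<^sub>0 N * XN_norm \<kappa> \<Omega> y"
proof -
  let ?f = "J (embed \<Omega> y)"
  have bound: "\<bar>\<kappa> * \<mu> k * \<rho> k\<bar> \<le> C\<^sub>0 N" if "k < N" for k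
  proof -
    have mu: "\<mu> k \<le> \<mu> N" using that mu_mono by (simp add: monoD)
    then have "\<rho> k \<le> \<rho> N" using kappa_pos by (simp add: \<rho>_def)
    then have "\<kappa> * \<mu> k * \<rho> k \<le> \<kappa> * \<mu> N * \<rho> N"
      using mu kappa_pos mu_nonneg rho_pos[of k] by (intro mult_mono) auto
    moreover have "\<kappa> * \<mu> k * \<rho> k \<ge> 0" using kappa_pos mu_nonneg rho_pos[of k] by simp
    ultimately show ?thesis by (simp add: C\<^sub>0_def)
  qed
  have "(\<Sum>k<N. (vec_index (rhs N y) k)\<^sup>2) = (\<Sum>k<N. (\<kappa> * \<mu> k * \<rho> k)\<^sup>2 * (inner ?f (\<phi> k))\<^sup>2)"
    by (intro sum.cong refl) (simp add: rhs_def A0_coefficient[OF XN_dom[OF assms]] power_mult_distrib)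
  also have "\<dots> \<le> (\<Sum>k<N. (C\<^sub>0 N)\<^sup>2 * (inner ?f (\<phi> k))\<^sup>2)"
    using bound by (intro sum_mono mult_right_mono) (auto intro: abs_le_square_iff[THEN iffD1] simp: less_imp_le[OF C0_pos])
  also have "\<dots> \<le> (C\<^sub>0 N)\<^sup>2 * (norm ?f)\<^sup>2"
    unfolding sum_distrib_left[symmetric] by (intro mult_left_mono bessel) simp
  finally have "sqrt (\<Sum>k<N. (vec_index (rhs N y) k)\<^sup>2) \<le> C\<^sub>0 N * norm ?f"
    using C0_pos[of N] by (intro real_le_lsqrt) (auto simp: power_mult_distrib)
  then show ?thesis
    by (simp add: euclid_norm_carrier[of _ N] rhs_def XN_norm_def X_norm_def)
qed

lemma rhs_linear:
  assumes "y \<in> XN \<phi> N" "z \<in> XN \<phi> N"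
  shows "rhs N (a *\<^sub>R y + b *\<^sub>R z) = a \<cdot>\<^sub>v rhs N y + b \<cdot>\<^sub>v rhs N z"
proof -
  have "y \<in> H2 \<Omega>" "z \<in> H2 \<Omega>" using assms[THEN XN_dom] by (auto simp: dom_A0_def)
  then show ?thesis
    by (intro eq_vecI) (auto simp: rhs_def A0_def laplacian_linear inner_add_left algebra_simps)
qed

end

section \<open>The minimum-norm control as a linear map\<close>

locale sensor_points = neumann +
  fixes N M :: nat and x :: "nat \<Rightarrow> real^3"
  assumes N: "N \<ge> 1" and rank: "vec_space.rank N (C_mat \<Omega> \<phi> N M x) = N"
begin

abbreviation "Cm \<equiv> C_mat \<Omega> \<phi> N M x"
abbreviation "U \<equiv> U_N \<kappa> \<Omega> \<phi> N M x"
abbreviation "B \<equiv> B_op \<Omega> M x"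

lemma Cm_carrier: "Cm \<in> carrier_mat N M"
  by (simp add: C_mat_def)

sublocale mat: full_row_rank Cm N M
  by unfold_locales (fact Cm_carrier rank N)+

lemma rhs_carrier: "rhs N y \<in> carrier_vec N"
  by (simp add: rhs_def)

text \<open>A projection onto the first N eigenfunctions vanishes exactly when its N coefficients
  do. Cancellation thereby becomes a finite linear system with the sensor matrix.\<close>

lemma cancels_iff: "cancels \<kappa> \<Omega> \<phi> N M x y u \<longleftrightarrow> u \<in> carrier_vec M \<and> Cm *\<^sub>v u = rhs N y"
proof -
  have "PN \<phi> N (embed \<Omega> (A0 \<kappa> \<Omega> y) + B u) = 0 \<longleftrightarrow> Cm *\<^sub>v u = rhs N y" if u: "u \<in> carrier_vec M"
  proof -
    let ?\<eta> = "embed \<Omega> (A0 \<kappa> \<Omega> y) + B u"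
    have val: "?\<eta> (\<phi> k) = vec_index (Cm *\<^sub>v u) k - vec_index (rhs N y) k" if k: "k < N" for k
    proof -
      have "B u (\<phi> k) = vec_index (Cm *\<^sub>v u) k"
        using k u by (simp add: B_op_apply[OF phi_dom] C_mat_def scalar_prod_def atLeast0LessThan mult.commute)
      then show ?thesis
        using k phi_dom[of k] by (simp add: embed_def rhs_def)
    qed
    have "PN \<phi> N ?\<eta> = 0 \<longleftrightarrow> (\<forall>k<N. ?\<eta> (\<phi> k) = 0)"
    proof
      assume "PN \<phi> N ?\<eta> = 0"
      then show "\<forall>k<N. ?\<eta> (\<phi> k) = 0"
        using PN_coefficient[of N ?\<eta>] by (metis inner_zero_left)
    qed (simp add: PN_def)
    also have "\<dots> \<longleftrightarrow> Cm *\<^sub>v u = rhs N y"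
    proof
      assume "\<forall>k<N. ?\<eta> (\<phi> k) = 0"
      then show "Cm *\<^sub>v u = rhs N y"
        using val Cm_carrier by (intro eq_vecI) (auto simp: rhs_def simp del: plus_fun_apply)
    qed (simp add: val del: plus_fun_apply)
    finally show ?thesis .
  qed
  then show ?thesis by (auto simp: cancels_def)
qed

text \<open>The Pythagorean identity serves twice: its last term is nonnegative, which gives
  minimality, and it must be 0 for any other minimiser, which gives uniqueness.\<close>

lemma U_eq: "U y = mat.min_norm_solution (rhs N y)"
  unfolding U_N_def
proof (rule the_equality)
  let ?m = "mat.min_norm_solution (rhs N y)"
  have m: "?m \<in> carrier_vec M" by (rule mat.min_norm_solution_carrier[OF rhs_carrier])
  have opt: "scalar_prod w w = scalar_prod ?m ?m + scalar_prod (w - ?m) (w - ?m)"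
    if "cancels \<kappa> \<Omega> \<phi> N M x y w" for w
    using that mat.min_norm_solution_optimal[OF rhs_carrier] by (simp add: cancels_iff)
  have mc: "cancels \<kappa> \<Omega> \<phi> N M x y ?m"
    unfolding cancels_iff using m mat.min_norm_solution_solves[OF rhs_carrier] by blast
  have "euclid_norm ?m \<le> euclid_norm w" if "cancels \<kappa> \<Omega> \<phi> N M x y w" for w
    using opt[OF that] scalar_prod_self_nonneg[of "w - ?m"] by (simp add: euclid_norm_def)
  then show "cancels \<kappa> \<Omega> \<phi> N M x y ?m \<and> (\<forall>w. cancels \<kappa> \<Omega> \<phi> N M x y w \<longrightarrow> euclid_norm ?m \<le> euclid_norm w)"
    using mc by blast
  fix u assume u: "cancels \<kappa> \<Omega> \<phi> N M x y u \<and> (\<forall>w. cancels \<kappa> \<Omega> \<phi> N M x y w \<longrightarrow> euclid_norm u \<le> euclid_norm w)"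
  have uM: "u \<in> carrier_vec M" using u by (simp add: cancels_iff)
  have "scalar_prod u u \<le> scalar_prod ?m ?m" using u mc by (simp add: euclid_norm_def)
  then have "scalar_prod (u - ?m) (u - ?m) = 0"
    using opt[of u] u scalar_prod_self_nonneg[of "u - ?m"] by simp
  then have "u - ?m = 0\<^sub>v M" using scalar_prod_self_eq_0[of "u - ?m" M] uM m by simp
  then have "vec_index (u - ?m) i = 0" if "i < M" for i using that by simp
  then show "u = ?m" using uM m by (intro eq_vecI) auto
qed

lemma U_carrier: "U y \<in> carrier_vec M"
  unfolding U_eq by (rule mat.min_norm_solution_carrier[OF rhs_carrier])

lemma U_linear:
  assumes "y \<in> XN \<phi> N" "z \<in> XN \<phi> N"
  shows "U (a *\<^sub>R y + b *\<^sub>R z) = a \<cdot>\<^sub>v U y + b \<cdot>\<^sub>v U z"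
  unfolding U_eq rhs_linear[OF assms] by (rule mat.min_norm_solution_linear[OF rhs_carrier rhs_carrier])

lemma XN_subspace: "Real_Vector_Spaces.subspace (XN \<phi> N)"
  by (simp add: XN_def)

lemma U_scale: "y \<in> XN \<phi> N \<Longrightarrow> U (c *\<^sub>R y) = c \<cdot>\<^sub>v U y"
  using U_linear[of y y c 0] by (simp add: smult_add_zero_smult[OF U_carrier U_carrier])

lemma U_bound:
  assumes "y \<in> XN \<phi> N"
  shows "euclid_norm (U y) \<le> C\<^sub>0 N / sigma_min Cm * XN_norm \<kappa> \<Omega> y"
proof -
  have "euclid_norm (U y) \<le> euclid_norm (rhs N y) / sigma_min Cm"
    unfolding U_eq by (rule mat.min_norm_solution_bound[OF rhs_carrier])
  also have "\<dots> \<le> C\<^sub>0 N * XN_norm \<kappa> \<Omega> y / sigma_min Cm"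
    using mat.sigma_min_pos by (intro divide_right_mono euclid_norm_rhs assms) auto
  finally show ?thesis by simp
qed

lemma U_norm_le: "U_norm \<kappa> \<Omega> \<phi> N M x \<le> C\<^sub>0 N / sigma_min Cm"
  unfolding U_norm_def
proof (rule op_norm_le)
  show "0 \<in> XN \<phi> N" by (rule real_vector.subspace_0[OF XN_subspace])
  show "XN_norm \<kappa> \<Omega> 0 \<le> 1" using XN_norm_scale[of 0 0] by simp
  fix y assume y: "y \<in> XN \<phi> N" "XN_norm \<kappa> \<Omega> y \<le> 1"
  have "C\<^sub>0 N / sigma_min Cm * XN_norm \<kappa> \<Omega> y \<le> C\<^sub>0 N / sigma_min Cm * 1"
    using y C0_pos mat.sigma_min_pos by (intro mult_left_mono) (auto simp: less_imp_le)
  then show "euclid_norm (U y) \<le> C\<^sub>0 N / sigma_min Cm" using U_bound[OF y(1)] by simp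
qed

lemma U_norm_bound: "y \<in> XN \<phi> N \<Longrightarrow> euclid_norm (U y) \<le> U_norm \<kappa> \<Omega> \<phi> N M x * XN_norm \<kappa> \<Omega> y"
  unfolding U_norm_def
  by (rule op_norm_bound[where s = "\<lambda>c y. c *\<^sub>R y" and V = "XN \<phi> N" and n = "XN_norm \<kappa> \<Omega>" and m = euclid_norm and T = U and K = "C\<^sub>0 N / sigma_min Cm",
      OF U_bound XN_norm_nonneg])
     (auto simp: XN_norm_scale U_scale euclid_norm_smult[OF U_carrier]
        intro: real_vector.subspace_scale[OF XN_subspace])

lemma U_norm_nonneg: "U_norm \<kappa> \<Omega> \<phi> N M x \<ge> 0"
  unfolding U_norm_def
  by (rule op_norm_nonneg[where v = 0 and V = "XN \<phi> N" and n = "XN_norm \<kappa> \<Omega>" and m = euclid_norm and T = U and K = "C\<^sub>0 N / sigma_min Cm",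
      OF U_bound XN_norm_nonneg])
     (use XN_norm_scale[of 0 0] real_vector.subspace_0[OF XN_subspace] in \<open>auto simp: euclid_norm_nonneg\<close>)

end

section \<open>The closed loop operator and its contraction property\<close>

locale closed_loop = sensor_points \<Omega> \<kappa> \<phi> \<mu> N M x + stable_semigroup \<Omega> \<kappa> \<phi> \<mu> S
  for \<Omega> \<kappa> \<phi> \<mu> N M x S +
  fixes lam :: real
  assumes lam: "lam > 0" and closed_loop: "closed_loop_semigroup \<kappa> \<Omega> M x lam S"
begin

lemma A0_ext_X: "A0_ext \<kappa> \<Omega> z \<in> X"
proof (rule X_I[where K = "2 * norm z"])
  fix y assume y: "y \<in> dom_A0 \<Omega>"
  have "A0 \<kappa> \<Omega> y = y - calA \<kappa> \<Omega> y" by (simp add: calA_def)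
  then have "norm (A0 \<kappa> \<Omega> y) \<le> norm y + norm (calA \<kappa> \<Omega> y)" by (simp add: norm_triangle_ineq4)
  also have "\<dots> \<le> 2 * norm (calA \<kappa> \<Omega> y)" using calA_coercive[OF y] by simp
  finally have "norm z * norm (A0 \<kappa> \<Omega> y) \<le> norm z * (2 * norm (calA \<kappa> \<Omega> y))"
    by (intro mult_left_mono) auto
  then show "\<bar>A0_ext \<kappa> \<Omega> z y\<bar> \<le> 2 * norm z * norm (calA \<kappa> \<Omega> y)"
    using Cauchy_Schwarz_ineq2[of z "A0 \<kappa> \<Omega> y"] y by (simp add: A0_ext_def)
next
  fix y w a b assume "y \<in> dom_A0 \<Omega>" "w \<in> dom_A0 \<Omega>"
  then show "A0_ext \<kappa> \<Omega> z (a *\<^sub>R y + b *\<^sub>R w) = a * A0_ext \<kappa> \<Omega> z y + b * A0_ext \<kappa> \<Omega> z w"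
    by (simp add: A0_ext_def dom_A0_comb)
       (simp add: A0_def dom_A0_def laplacian_linear inner_add_right algebra_simps)
qed (simp add: A0_ext_def)

text \<open>The generator takes values in the dual space. Its value at
  \<open>calA \<kappa> \<Omega> z\<close> has feedback coefficients
  \<open>pt_value \<Omega> z (x j)\<close>; subtracting it from the bounded part
  \<open>A0_ext\<close> leaves \<open>lam\<close> times the sum, and \<open>lam\<close> is
  positive.\<close>

lemma point_combination_X:
  assumes z: "z \<in> dom_A0 \<Omega>"
  shows "(\<Sum>j<M. pt_value \<Omega> z (x j) *\<^sub>R delta \<Omega> (x j)) \<in> X"
proof -
  let ?s = "\<Sum>j<M. pt_value \<Omega> z (x j) *\<^sub>R delta \<Omega> (x j)"
  have "(embed \<Omega> (calA \<kappa> \<Omega> z), A_cl \<kappa> \<Omega> M x lam (calA \<kappa> \<Omega> z)) \<in> generator_graph X (X_norm \<kappa> \<Omega>) S"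
    using closed_loop calA_L2[OF z] unfolding closed_loop_semigroup_def by blast
  then have "A_cl \<kappa> \<Omega> M x lam (calA \<kappa> \<Omega> z) \<in> X" by (simp add: generator_graph_def)
  then have "A0_ext \<kappa> \<Omega> (calA \<kappa> \<Omega> z) - lam *\<^sub>R ?s \<in> X"
    by (simp only: A_cl_def J_embed_calA[OF z])
  then have "A0_ext \<kappa> \<Omega> (calA \<kappa> \<Omega> z) - (A0_ext \<kappa> \<Omega> (calA \<kappa> \<Omega> z) - lam *\<^sub>R ?s) \<in> X"
    by (rule real_vector.subspace_diff[OF subspace_X A0_ext_X])
  then have "(1 / lam) *\<^sub>R (lam *\<^sub>R ?s) \<in> X"
    using real_vector.subspace_scale[OF subspace_X] by (simp only: diff_diff_eq2 add_diff_cancel_left')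
  then show ?thesis using lam by simp
qed

text \<open>The generator identity puts \<open>\<Sum>\<^sub>j z(x\<^sub>j) \<delta>\<^bsub>x\<^sub>j\<^esub>\<close> into \<open>\<X>\<close> for every \<open>z\<close> in \<open>D(\<A>)\<close>, while a
  coefficient vector orthogonal to all \<open>(z(x\<^sub>j))\<^sub>j\<close> gives the zero functional.  Hence no Sobolev embedding is
  needed to see that every combination of the \<open>\<delta>\<^bsub>x\<^sub>j\<^esub>\<close> belongs to \<open>\<X>\<close>.\<close>

lemma delta_combination_X: "(\<Sum>j<M. u j *\<^sub>R delta \<Omega> (x j)) \<in> X"
proof -
  define D where "D v = (\<Sum>j<M. v j *\<^sub>R delta \<Omega> (x j))" for v :: "nat \<Rightarrow> real"
  define W where "W = (\<lambda>z j. if j < M then pt_value \<Omega> z (x j) else 0) ` dom_A0 \<Omega>"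
  have "\<exists>s\<in>span W. \<forall>w\<in>W. (\<Sum>j<M. (u j - s j) * w j) = 0"
    by (rule orthogonal_decomposition) (auto simp: W_def)
  then obtain s where s: "s \<in> span W" "\<And>w. w \<in> W \<Longrightarrow> (\<Sum>j<M. (u j - s j) * w j) = 0"
    by blast
  have D_add: "D (a *\<^sub>R v + w) = a *\<^sub>R D v + D w" for a v w
    by (simp add: D_def fun_scaleR_apply scaleR_add_left sum.distrib scaleR_sum_right)
  have "D s \<in> X"
    using s(1)
  proof (induction rule: real_vector.span_induct_alt)
    case base
    have "D 0 = 0" by (rule ext) (simp add: D_def sum_fun_apply fun_scaleR_apply)
    then show ?case using real_vector.subspace_0[OF subspace_X] by (simp only:)
  next
    case (step c w y)
    then obtain z where z: "z \<in> dom_A0 \<Omega>" "w = (\<lambda>j. if j < M then pt_value \<Omega> z (x j) else 0)"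
      by (auto simp: W_def)
    have "D w \<in> X" using point_combination_X[OF z(1)] by (simp add: D_def z(2))
    then show ?case
      unfolding D_add using step
      by (intro real_vector.subspace_add real_vector.subspace_scale subspace_X)
  qed
  moreover have "D (u - s) = 0"
  proof
    fix y
    show "D (u - s) y = 0 y"
    proof (cases "y \<in> dom_A0 \<Omega>")
      case True
      then have "(\<lambda>j. if j < M then pt_value \<Omega> y (x j) else 0) \<in> W" by (simp add: W_def)
      from s(2)[OF this] show ?thesis
        using True by (simp add: D_def sum_fun_apply fun_scaleR_apply delta_def)
    next
      case False
      then show ?thesis by (simp add: D_def sum_fun_apply fun_scaleR_apply delta_def)
    qed
  qed
  moreover have "u = 1 *\<^sub>R (u - s) + s" by simp
  then have "D u = 1 *\<^sub>R D (u - s) + D s" using D_add[of 1 "u - s" s] by simp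
  ultimately have "D u \<in> X" by simp
  then show ?thesis by (simp add: D_def)
qed

lemma B_X: "B u \<in> X"
  unfolding B_op_def by (rule delta_combination_X)

lemma delta_X: "i < M \<Longrightarrow> delta \<Omega> (x i) \<in> X"
proof -
  assume i: "i < M"
  have "(\<Sum>j<M. (if j = i then 1 else 0) *\<^sub>R delta \<Omega> (x j)) = (\<Sum>j<M. if j = i then delta \<Omega> (x j) else 0)"
    by (rule sum.cong) auto
  then show ?thesis using delta_combination_X[of "\<lambda>j. if j = i then 1 else 0"] i by simp
qed

text \<open>A crude bound by the single point evaluations, whose purpose is to make the supremum in
  \<open>B_norm\<close> finite.\<close>

lemma B_bound:
  assumes u: "u \<in> carrier_vec M"
  shows "X_norm \<kappa> \<Omega> (B u) \<le> (\<Sum>j<M. X_norm \<kappa> \<Omega> (delta \<Omega> (x j))) * euclid_norm u"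
proof -
  have "J (B u) = (\<Sum>j<M. vec_index u j *\<^sub>R J (delta \<Omega> (x j)))"
    unfolding B_op_def by (rule J_sum) (simp add: delta_X)
  then have "X_norm \<kappa> \<Omega> (B u) \<le> (\<Sum>j<M. \<bar>vec_index u j\<bar> * norm (J (delta \<Omega> (x j))))"
    unfolding X_norm_def by (simp add: sum_norm_le)
  also have "\<dots> \<le> (\<Sum>j<M. euclid_norm u * norm (J (delta \<Omega> (x j))))"
    by (intro sum_mono mult_right_mono abs_vec_index_le_euclid_norm[OF u]) auto
  finally show ?thesis by (simp add: X_norm_def mult.commute flip: sum_distrib_left)
qed

lemma X_norm_nonneg: "X_norm \<kappa> \<Omega> \<eta> \<ge> 0"
  by (simp add: X_norm_def)

lemma B_norm_bound:
  assumes u: "u \<in> carrier_vec M"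
  shows "X_norm \<kappa> \<Omega> (B u) \<le> B_norm \<kappa> \<Omega> M x * euclid_norm u"
  unfolding B_norm_def
proof (rule op_norm_bound[where s = "\<lambda>c u. c \<cdot>\<^sub>v u" and V = "carrier_vec M" and n = euclid_norm and m = "X_norm \<kappa> \<Omega>" and T = B and K = "\<Sum>j<M. X_norm \<kappa> \<Omega> (delta \<Omega> (x j))",
      OF B_bound euclid_norm_nonneg _ u])
  fix c :: real and v :: "real Matrix.vec" assume "c > 0" "v \<in> carrier_vec M"
  then show "c \<cdot>\<^sub>v v \<in> carrier_vec M \<and> euclid_norm (c \<cdot>\<^sub>v v) = c * euclid_norm v \<and>
      X_norm \<kappa> \<Omega> (B (c \<cdot>\<^sub>v v)) = c * X_norm \<kappa> \<Omega> (B v)"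
    using B_op_linear[of v M v \<Omega> x c 0] X_norm_scale[OF B_X, of c v]
    by (simp add: euclid_norm_smult smult_add_zero_smult del: plus_fun_apply)
qed

lemma B_norm_nonneg: "B_norm \<kappa> \<Omega> M x \<ge> 0"
  unfolding B_norm_def
  by (rule op_norm_nonneg[where v = "0\<^sub>v M" and V = "carrier_vec M" and n = euclid_norm and m = "X_norm \<kappa> \<Omega>" and T = B and K = "\<Sum>j<M. X_norm \<kappa> \<Omega> (delta \<Omega> (x j))",
      OF B_bound euclid_norm_nonneg])
     (auto simp: euclid_norm_def X_norm_nonneg)

lemma QN_X: "\<eta> \<in> X \<Longrightarrow> QN \<Omega> \<phi> N \<eta> \<in> X"
  unfolding QN_def by (rule real_vector.subspace_diff[OF subspace_X _ embed_X])

text \<open>The map common to both sides of the estimate: \<open>L_N\<close> is the norm of its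
  embedding into the dual space, and \<open>T_N\<close> is its composition with \<open>B\<close> and
  \<open>U\<close>.\<close>

definition \<Phi> :: "(l2 \<Rightarrow> real) \<Rightarrow> l2" where
  "\<Phi> \<eta> = PN \<phi> N (R (QN \<Omega> \<phi> N \<eta>))"

lemma Phi_linear: "\<eta> \<in> X \<Longrightarrow> \<zeta> \<in> X \<Longrightarrow> \<Phi> (a *\<^sub>R \<eta> + b *\<^sub>R \<zeta>) = a *\<^sub>R \<Phi> \<eta> + b *\<^sub>R \<Phi> \<zeta>"
  by (simp only: \<Phi>_def QN_linear R_cl_linear QN_X PN_linear)

text \<open>The projector is a contraction, so its complement has norm at most 2 by the triangle
  inequality; together with the bounded integral operator this makes the supremum in
  \<open>L_N\<close> finite.\<close>

lemma Phi_bound: "\<exists>K\<ge>0. \<forall>\<eta>\<in>X. X_norm \<kappa> \<Omega> (embed \<Omega> (\<Phi> \<eta>)) \<le> K * X_norm \<kappa> \<Omega> \<eta>"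
proof -
  obtain K where K: "K \<ge> 0" "\<And>\<eta>. \<eta> \<in> X \<Longrightarrow> norm (J (R \<eta>)) \<le> K * norm (J \<eta>)"
    using R_cl_bounded by blast
  have "X_norm \<kappa> \<Omega> (embed \<Omega> (\<Phi> \<eta>)) \<le> K * 2 * X_norm \<kappa> \<Omega> \<eta>" if X: "\<eta> \<in> X" for \<eta>
  proof -
    have "X_norm \<kappa> \<Omega> (embed \<Omega> (\<Phi> \<eta>)) \<le> X_norm \<kappa> \<Omega> (R (QN \<Omega> \<phi> N \<eta>))"
      unfolding \<Phi>_def by (rule X_norm_embed_PN[OF R_cl_limit(1)[OF QN_X[OF X]]])
    also have "\<dots> \<le> K * X_norm \<kappa> \<Omega> (QN \<Omega> \<phi> N \<eta>)"
      unfolding X_norm_def by (rule K(2)[OF QN_X[OF X]])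
    also have "X_norm \<kappa> \<Omega> (QN \<Omega> \<phi> N \<eta>) \<le> X_norm \<kappa> \<Omega> \<eta> + X_norm \<kappa> \<Omega> (embed \<Omega> (PN \<phi> N \<eta>))"
      unfolding X_norm_def QN_def J_diff[OF X embed_X] by (rule norm_triangle_ineq4)
    also have "\<dots> \<le> 2 * X_norm \<kappa> \<Omega> \<eta>" using X_norm_embed_PN[OF X, of N] by simp
    finally show ?thesis using K(1) by (simp add: mult_left_mono)
  qed
  then show ?thesis using K(1) by (intro exI[of _ "K * 2"]) auto
qed

lemma L_N_eq: "L_N \<kappa> \<Omega> \<phi> N S = op_norm X (X_norm \<kappa> \<Omega>) (X_norm \<kappa> \<Omega>) (\<lambda>\<eta>. embed \<Omega> (\<Phi> \<eta>))"
  by (simp add: L_N_def \<Phi>_def)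

lemma L_N_bound:
  assumes X: "\<eta> \<in> X"
  shows "X_norm \<kappa> \<Omega> (embed \<Omega> (\<Phi> \<eta>)) \<le> L_N \<kappa> \<Omega> \<phi> N S * X_norm \<kappa> \<Omega> \<eta>"
proof -
  obtain K where K: "\<And>\<eta>. \<eta> \<in> X \<Longrightarrow> X_norm \<kappa> \<Omega> (embed \<Omega> (\<Phi> \<eta>)) \<le> K * X_norm \<kappa> \<Omega> \<eta>"
    using Phi_bound by blast
  show ?thesis
    unfolding L_N_eq
  proof (rule op_norm_bound[where s = "\<lambda>c \<eta>. c *\<^sub>R \<eta>" and T = "\<lambda>\<eta>. embed \<Omega> (\<Phi> \<eta>)"
      and V = X and n = "X_norm \<kappa> \<Omega>" and m = "X_norm \<kappa> \<Omega>" and K = K, OF K X_norm_nonneg _ X])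
    fix c :: real and \<zeta> assume "c > 0" "\<zeta> \<in> X"
    then show "c *\<^sub>R \<zeta> \<in> X \<and> X_norm \<kappa> \<Omega> (c *\<^sub>R \<zeta>) = c * X_norm \<kappa> \<Omega> \<zeta> \<and>
        X_norm \<kappa> \<Omega> (embed \<Omega> (\<Phi> (c *\<^sub>R \<zeta>))) = c * X_norm \<kappa> \<Omega> (embed \<Omega> (\<Phi> \<zeta>))"
      using Phi_linear[of \<zeta> \<zeta> c 0] XN_norm_scale[of c "\<Phi> \<zeta>"]
      by (simp add: X_norm_scale XN_norm_def real_vector.subspace_scale[OF subspace_X])
  qed
qed

lemma L_N_nonneg: "L_N \<kappa> \<Omega> \<phi> N S \<ge> 0"
proof -
  obtain K where K: "\<And>\<eta>. \<eta> \<in> X \<Longrightarrow> X_norm \<kappa> \<Omega> (embed \<Omega> (\<Phi> \<eta>)) \<le> K * X_norm \<kappa> \<Omega> \<eta>"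
    using Phi_bound by blast
  show ?thesis
    unfolding L_N_eq
    by (rule op_norm_nonneg[where v = 0 and T = "\<lambda>\<eta>. embed \<Omega> (\<Phi> \<eta>)"
      and V = X and n = "X_norm \<kappa> \<Omega>" and m = "X_norm \<kappa> \<Omega>" and K = K, OF K X_norm_nonneg])
       (auto simp: real_vector.subspace_0[OF subspace_X] X_norm_nonneg, simp add: X_norm_def J_0)
qed

abbreviation "T \<equiv> T_N \<kappa> \<Omega> \<phi> N M x S"

lemma T_eq: "T y = \<Phi> (B (U y))"
  by (simp add: T_N_def \<Phi>_def)

lemma T_XN: "T y \<in> XN \<phi> N"
  unfolding T_N_def by (rule PN_in_XN)

lemma T_linear:
  assumes "y \<in> XN \<phi> N" "z \<in> XN \<phi> N"
  shows "T (a *\<^sub>R y + b *\<^sub>R z) = a *\<^sub>R T y + b *\<^sub>R T z"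
  by (simp only: T_eq U_linear[OF assms] B_op_linear[OF U_carrier U_carrier] Phi_linear[OF B_X B_X])

lemma T_bound_U: "XN_norm \<kappa> \<Omega> (T y) \<le> L_N \<kappa> \<Omega> \<phi> N S * B_norm \<kappa> \<Omega> M x * euclid_norm (U y)"
proof -
  have "XN_norm \<kappa> \<Omega> (T y) \<le> L_N \<kappa> \<Omega> \<phi> N S * X_norm \<kappa> \<Omega> (B (U y))"
    unfolding T_eq XN_norm_def by (rule L_N_bound[OF B_X])
  also have "\<dots> \<le> L_N \<kappa> \<Omega> \<phi> N S * (B_norm \<kappa> \<Omega> M x * euclid_norm (U y))"
    by (intro mult_left_mono B_norm_bound U_carrier L_N_nonneg)
  finally show ?thesis by (simp only: mult.assoc)
qed

lemma T_bound:
  assumes y: "y \<in> XN \<phi> N"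
  shows "XN_norm \<kappa> \<Omega> (T y) \<le> L_N \<kappa> \<Omega> \<phi> N S * B_norm \<kappa> \<Omega> M x * U_norm \<kappa> \<Omega> \<phi> N M x * XN_norm \<kappa> \<Omega> y"
proof -
  have "L_N \<kappa> \<Omega> \<phi> N S * B_norm \<kappa> \<Omega> M x * euclid_norm (U y)
      \<le> L_N \<kappa> \<Omega> \<phi> N S * B_norm \<kappa> \<Omega> M x * (U_norm \<kappa> \<Omega> \<phi> N M x * XN_norm \<kappa> \<Omega> y)"
    by (intro mult_left_mono U_norm_bound[OF y] mult_nonneg_nonneg L_N_nonneg B_norm_nonneg)
  then show ?thesis using T_bound_U[of y] by (simp only: mult.assoc)
qed

lemma T_norm_le: "T_norm \<kappa> \<Omega> \<phi> N M x S \<le> L_N \<kappa> \<Omega> \<phi> N S * B_norm \<kappa> \<Omega> M x * U_norm \<kappa> \<Omega> \<phi> N M x"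
  unfolding T_norm_def
proof (rule op_norm_le)
  show "0 \<in> XN \<phi> N" by (rule real_vector.subspace_0[OF XN_subspace])
  show "XN_norm \<kappa> \<Omega> 0 \<le> 1" using XN_norm_scale[of 0 0] by simp
  fix y assume y: "y \<in> XN \<phi> N" "XN_norm \<kappa> \<Omega> y \<le> 1"
  have "L_N \<kappa> \<Omega> \<phi> N S * B_norm \<kappa> \<Omega> M x * U_norm \<kappa> \<Omega> \<phi> N M x * XN_norm \<kappa> \<Omega> y
      \<le> L_N \<kappa> \<Omega> \<phi> N S * B_norm \<kappa> \<Omega> M x * U_norm \<kappa> \<Omega> \<phi> N M x * 1"
    by (intro mult_left_mono y mult_nonneg_nonneg L_N_nonneg B_norm_nonneg U_norm_nonneg)
  then show "XN_norm \<kappa> \<Omega> (T y) \<le> L_N \<kappa> \<Omega> \<phi> N S * B_norm \<kappa> \<Omega> M x * U_norm \<kappa> \<Omega> \<phi> N M x"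
    using T_bound[OF y(1)] by simp
qed

text \<open>A strict contraction bound excludes kernel vectors of I + T, and on an N-dimensional
  space injectivity gives surjectivity. As linearity of T is established on \<open>XN\<close> only,
  T is precomposed with the projection P, which makes \<open>g\<close> linear on the whole type and
  equal to I + T on \<open>XN\<close>.\<close>

lemma I_plus_T_surj:
  assumes q: "L_N \<kappa> \<Omega> \<phi> N S * B_norm \<kappa> \<Omega> M x * U_norm \<kappa> \<Omega> \<phi> N M x < 1" and r: "r \<in> XN \<phi> N"
  shows "\<exists>y\<in>XN \<phi> N. y + T y = r"
proof -
  define P where "P y = (\<Sum>k<N. inner y (\<phi> k) *\<^sub>R \<phi> k)" for y
  define g where "g y = P y + T (P y)" for y
  have P_XN: "P y \<in> XN \<phi> N" for y
    unfolding P_def XN_def by (intro real_vector.span_sum real_vector.span_scale real_vector.span_base) auto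
  have P_id: "P y = y" if "y \<in> XN \<phi> N" for y
    using XN_expansion[OF that] by (simp add: P_def)
  have P_lin: "P (a *\<^sub>R y + b *\<^sub>R z) = a *\<^sub>R P y + b *\<^sub>R P z" for a b y z
    by (simp add: P_def inner_add_left scaleR_add_left sum.distrib scaleR_sum_right)
  have g_lin: "g (a *\<^sub>R y + b *\<^sub>R z) = a *\<^sub>R g y + b *\<^sub>R g z" for a b y z
    unfolding g_def P_lin T_linear[OF P_XN P_XN] by (simp add: scaleR_add_right)
  have lin: "linear g"
    by (rule linearI) (use g_lin[of 1 _ 1] g_lin[of _ _ 0] in auto)
  have inj: "inj_on g (XN \<phi> N)"
  proof (rule inj_onI)
    fix y z assume yz: "y \<in> XN \<phi> N" "z \<in> XN \<phi> N" "g y = g z"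
    let ?d = "y - z"
    have d: "?d \<in> XN \<phi> N" using yz by (simp add: real_vector.subspace_diff[OF XN_subspace])
    have "g ?d = 0" using g_lin[of 1 y "-1" z] yz by simp
    then have "T ?d = (-1) *\<^sub>R ?d" by (simp add: g_def P_id[OF d] add_eq_0_iff)
    then have "XN_norm \<kappa> \<Omega> (T ?d) = XN_norm \<kappa> \<Omega> ?d"
      using XN_norm_scale[of "-1" ?d] by simp
    then have "XN_norm \<kappa> \<Omega> ?d \<le> L_N \<kappa> \<Omega> \<phi> N S * B_norm \<kappa> \<Omega> M x * U_norm \<kappa> \<Omega> \<phi> N M x * XN_norm \<kappa> \<Omega> ?d"
      using T_bound[OF d] by simp
    then have "XN_norm \<kappa> \<Omega> ?d = 0"
      using q XN_norm_nonneg[of ?d] by (smt (verit) mult_le_cancel_right1)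
    then show "y = z" using XN_norm_eq_0[OF d] by simp
  qed
  let ?E = "\<phi> ` {..<N}"
  have inj_phi: "inj \<phi>"
    by (rule injI) (metis phi_orthonormal zero_neq_one)
  have indep: "independent ?E"
  proof (rule real_vector.independent_if_scalars_zero)
    fix f v assume f: "(\<Sum>w\<in>?E. f w *\<^sub>R w) = 0" and v: "v \<in> ?E"
    then obtain i where i: "i < N" "v = \<phi> i" by auto
    have "(\<Sum>k<N. f (\<phi> k) *\<^sub>R \<phi> k) = 0"
      using f inj_phi by (simp add: sum.reindex inj_on_subset)
    then have "inner (\<Sum>k<N. f (\<phi> k) *\<^sub>R \<phi> k) (\<phi> i) = 0" by simp
    then show "f v = 0"
      using i by (simp add: inner_sum_left phi_orthonormal if_distrib cong: if_cong)
  qed simp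
  have inj_E: "inj_on g (span ?E)" using inj by (simp add: XN_def)
  have indep_g: "independent (g ` ?E)"
    by (rule linear_independent_injective_image[OF lin indep inj_E])
  have card_g: "card (g ` ?E) = N"
    using inj_on_subset[OF inj_E real_vector.span_superset] inj_phi
    by (simp add: card_image inj_on_subset)
  have g_XN: "g y \<in> XN \<phi> N" for y
    unfolding g_def by (rule real_vector.subspace_add[OF XN_subspace P_XN T_XN])
  \<comment> \<open>The images of the N eigenfunctions are independent and lie in their span. Were r
    outside the span of the images, adding it would give N + 1 independent vectors in a space
    spanned by N.\<close>
  have "r \<in> span (g ` ?E)"
  proof (rule ccontr)
    assume nr: "r \<notin> span (g ` ?E)"
    then have "independent (insert r (g ` ?E))"
      using indep_g by (simp add: real_vector.independent_insert)
    moreover have "insert r (g ` ?E) \<subseteq> span ?E"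
      using r g_XN by (auto simp: XN_def)
    ultimately have "card (insert r (g ` ?E)) \<le> card ?E"
      using real_vector.independent_span_bound[of ?E "insert r (g ` ?E)"] by simp
    moreover have "r \<notin> g ` ?E" using nr real_vector.span_base[of r "g ` ?E"] by auto
    moreover have "card ?E \<le> N" using card_image_le[of "{..<N}" \<phi>] by simp
    ultimately show False using card_g by simp
  qed
  then obtain y where y: "y \<in> span ?E" "r = g y"
    using linear_span_image[OF lin, of ?E] by blast
  then have "y \<in> XN \<phi> N" by (simp add: XN_def)
  then show ?thesis using y P_id by (auto simp: g_def)
qed

end

theorem proposition10p19:
  fixes \<Omega> :: "(real^3) set" and \<kappa> :: real
    and \<phi> :: "nat \<Rightarrow> l2" and \<mu> :: "nat \<Rightarrow> real" and N :: nat
  assumes "bounded_C2_domain \<Omega>" and "\<kappa> > 0"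
    and "neumann_eigenbasis \<Omega> \<phi> \<mu>" and "N \<ge> 1"
  shows
    "(\<exists>C>0. \<forall>(M::nat) (x::nat \<Rightarrow> real^3).
        (\<forall>j<M. x j \<in> \<Omega>) \<longrightarrow> vec_space.rank N (C_mat \<Omega> \<phi> N M x) = N \<longrightarrow>
        sigma_min (C_mat \<Omega> \<phi> N M x) > 0 \<and>
        U_norm \<kappa> \<Omega> \<phi> N M x \<le> C / sigma_min (C_mat \<Omega> \<phi> N M x))
     \<and>
     (\<forall>(M::nat) (x::nat \<Rightarrow> real^3) (lam::real)
        (S :: real \<Rightarrow> (l2 \<Rightarrow> real) \<Rightarrow> (l2 \<Rightarrow> real)) (C::real).
        (\<forall>j<M. x j \<in> \<Omega>) \<longrightarrow> vec_space.rank N (C_mat \<Omega> \<phi> N M x) = N \<longrightarrow>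
        lam > 0 \<longrightarrow> closed_loop_semigroup \<kappa> \<Omega> M x lam S \<longrightarrow>
        C > 0 \<longrightarrow> U_norm \<kappa> \<Omega> \<phi> N M x \<le> C / sigma_min (C_mat \<Omega> \<phi> N M x) \<longrightarrow>
        T_norm \<kappa> \<Omega> \<phi> N M x S \<le> L_N \<kappa> \<Omega> \<phi> N S * B_norm \<kappa> \<Omega> M x * U_norm \<kappa> \<Omega> \<phi> N M x \<and>
        L_N \<kappa> \<Omega> \<phi> N S * B_norm \<kappa> \<Omega> M x * U_norm \<kappa> \<Omega> \<phi> N M x
          \<le> C * L_N \<kappa> \<Omega> \<phi> N S * B_norm \<kappa> \<Omega> M x * (1 / sigma_min (C_mat \<Omega> \<phi> N M x)) \<and>
        (sigma_min (C_mat \<Omega> \<phi> N M x) > C * L_N \<kappa> \<Omega> \<phi> N S * B_norm \<kappa> \<Omega> M x \<longrightarrow>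
           (\<forall>y\<^sub>r\<in>XN \<phi> N. \<exists>ys\<in>XN \<phi> N. ys + T_N \<kappa> \<Omega> \<phi> N M x S ys = y\<^sub>r)))"
proof -
  have nm: "neumann \<Omega> \<kappa> \<phi> \<mu>"
    using assms by unfold_locales (auto simp: bounded_C2_domain_def)
  interpret neumann \<Omega> \<kappa> \<phi> \<mu> by (rule nm)
  have sp: "sensor_points \<Omega> \<kappa> \<phi> \<mu> N M x" if "vec_space.rank N (C_mat \<Omega> \<phi> N M x) = N" for M x
    using nm that assms(4) by (simp add: sensor_points_def sensor_points_axioms_def)
  show ?thesis
  proof (intro conjI)
    show "\<exists>C>0. \<forall>(M::nat) (x::nat \<Rightarrow> real^3).
        (\<forall>j<M. x j \<in> \<Omega>) \<longrightarrow> vec_space.rank N (C_mat \<Omega> \<phi> N M x) = N \<longrightarrow>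
        sigma_min (C_mat \<Omega> \<phi> N M x) > 0 \<and>
        U_norm \<kappa> \<Omega> \<phi> N M x \<le> C / sigma_min (C_mat \<Omega> \<phi> N M x)"
    \<comment> \<open>\<open>C\<^sub>0 N\<close> is built from \<open>\<kappa>\<close>, the
      eigenvalues and N, so it can be fixed before the number and position of the points.\<close>
    proof (intro exI[of _ "C\<^sub>0 N"] conjI allI impI C0_pos)
      fix M x assume "vec_space.rank N (C_mat \<Omega> \<phi> N M x) = N"
      then interpret sensor_points \<Omega> \<kappa> \<phi> \<mu> N M x by (rule sp)
      show "sigma_min (C_mat \<Omega> \<phi> N M x) > 0" by (rule mat.sigma_min_pos)
      show "U_norm \<kappa> \<Omega> \<phi> N M x \<le> C\<^sub>0 N / sigma_min (C_mat \<Omega> \<phi> N M x)" by (rule U_norm_le)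
    qed
  next
    show "\<forall>(M::nat) (x::nat \<Rightarrow> real^3) (lam::real)
        (S :: real \<Rightarrow> (l2 \<Rightarrow> real) \<Rightarrow> (l2 \<Rightarrow> real)) (C::real).
        (\<forall>j<M. x j \<in> \<Omega>) \<longrightarrow> vec_space.rank N (C_mat \<Omega> \<phi> N M x) = N \<longrightarrow>
        lam > 0 \<longrightarrow> closed_loop_semigroup \<kappa> \<Omega> M x lam S \<longrightarrow>
        C > 0 \<longrightarrow> U_norm \<kappa> \<Omega> \<phi> N M x \<le> C / sigma_min (C_mat \<Omega> \<phi> N M x) \<longrightarrow>
        T_norm \<kappa> \<Omega> \<phi> N M x S \<le> L_N \<kappa> \<Omega> \<phi> N S * B_norm \<kappa> \<Omega> M x * U_norm \<kappa> \<Omega> \<phi> N M x \<and>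
        L_N \<kappa> \<Omega> \<phi> N S * B_norm \<kappa> \<Omega> M x * U_norm \<kappa> \<Omega> \<phi> N M x
          \<le> C * L_N \<kappa> \<Omega> \<phi> N S * B_norm \<kappa> \<Omega> M x * (1 / sigma_min (C_mat \<Omega> \<phi> N M x)) \<and>
        (sigma_min (C_mat \<Omega> \<phi> N M x) > C * L_N \<kappa> \<Omega> \<phi> N S * B_norm \<kappa> \<Omega> M x \<longrightarrow>
           (\<forall>y\<^sub>r\<in>XN \<phi> N. \<exists>ys\<in>XN \<phi> N. ys + T_N \<kappa> \<Omega> \<phi> N M x S ys = y\<^sub>r))"
      (is "\<forall>M x lam S C. _ \<longrightarrow> _ \<longrightarrow> _ \<longrightarrow> _ \<longrightarrow> _ \<longrightarrow> _ \<longrightarrow> ?bound M x S \<and> ?scaled M x S C \<and> (?small M x S C \<longrightarrow> ?solvable M x S)")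
    proof (intro allI impI)
      fix M x lam S and C :: real
      assume rank: "vec_space.rank N (C_mat \<Omega> \<phi> N M x) = N" and lam: "lam > 0"
        and cl: "closed_loop_semigroup \<kappa> \<Omega> M x lam S"
        and U: "U_norm \<kappa> \<Omega> \<phi> N M x \<le> C / sigma_min (C_mat \<Omega> \<phi> N M x)"
      interpret sensor_points \<Omega> \<kappa> \<phi> \<mu> N M x by (rule sp[OF rank])
      interpret closed_loop \<Omega> \<kappa> \<phi> \<mu> N M x S lam
        using cl lam by unfold_locales (auto simp: closed_loop_semigroup_def)
      let ?LB = "L_N \<kappa> \<Omega> \<phi> N S * B_norm \<kappa> \<Omega> M x"
      have scaled: "?LB * U_norm \<kappa> \<Omega> \<phi> N M x \<le> C * ?LB / sigma_min Cm"
        using mult_left_mono[OF U, of ?LB] L_N_nonneg B_norm_nonneg by (simp add: mult.commute)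
      have "?small M x S C \<longrightarrow> ?solvable M x S"
      proof (intro impI ballI)
        fix r assume small: "?small M x S C" and r: "r \<in> XN \<phi> N"
        \<comment> \<open>Dividing the smallness condition by the positive singular value puts the
          contraction bound below 1.\<close>
        have "C * ?LB / sigma_min Cm < 1"
          using small mat.sigma_min_pos by (simp add: mult.assoc)
        then show "\<exists>ys\<in>XN \<phi> N. ys + T ys = r"
          using scaled r by (intro I_plus_T_surj) auto
      qed
      then show "?bound M x S \<and> ?scaled M x S C \<and> (?small M x S C \<longrightarrow> ?solvable M x S)"
        using T_norm_le scaled by (simp add: mult.assoc)
    qed
  qed
qed

end
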